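(* Let $A$ be a symmetric convex body on $\mathbb R^n$ and let $1\leqslant k\leqslant n-1$. Then $$\nu_{n,k}\big(\{F\in G_{n,k}:|w(P_FA)-w(A)|\geqslant t\,w(A)\}\big)\leqslant c_1\exp(-c_2t^2k\,k_\ast(A))$$ for all $t>0$, where $c_1,c_2>0$ are absolute constants.
   Context: $G_{n,k}$ is the Grassmannian with Haar probability $\nu_{n,k}$, $P_F$ the orthogonal projection onto $F$. $h_A(\theta)=\max_{x\in A}\langle x,\theta\rangle$; for a body $L$ in a Euclidean space, $w(L)$ is the average of $h_L$ over the unit sphere of that space with respect to the uniform probability. $R(A)=\max_{x\in A}\|x\|_2$ and $k_\ast(A)=n(w(A)/R(A))^2$. *)

theory Defs
  imports "HOL-Probability.Probability"
begin

text \<open>Explicit model of R^n (n varies inside the statement, since the constants are absolute):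
vectors are extensional functions nat => real supported on {..<n}; matrices are extensional
functions nat => nat => real on {..<n} x {..<n}.\<close>

definition vecs :: "nat \<Rightarrow> (nat \<Rightarrow> real) set" where
  "vecs n = PiE {..<n} (\<lambda>_. UNIV)"

definition vecM :: "nat \<Rightarrow> (nat \<Rightarrow> real) measure" where
  "vecM n = PiM {..<n} (\<lambda>_. borel)"

definition mats :: "nat \<Rightarrow> (nat \<Rightarrow> nat \<Rightarrow> real) set" where
  "mats n = PiE {..<n} (\<lambda>_. vecs n)"

definition matM :: "nat \<Rightarrow> (nat \<Rightarrow> nat \<Rightarrow> real) measure" where
  "matM n = PiM {..<n} (\<lambda>_. vecM n)"

definition ip :: "nat \<Rightarrow> (nat \<Rightarrow> real) \<Rightarrow> (nat \<Rightarrow> real) \<Rightarrow> real" where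
  "ip n x y = (\<Sum>i<n. x i * y i)"

definition nrm :: "nat \<Rightarrow> (nat \<Rightarrow> real) \<Rightarrow> real" where
  "nrm n x = sqrt (ip n x x)"

definition vdist :: "nat \<Rightarrow> (nat \<Rightarrow> real) \<Rightarrow> (nat \<Rightarrow> real) \<Rightarrow> real" where
  "vdist n x y = sqrt (\<Sum>i<n. (x i - y i)\<^sup>2)"

definition vneg :: "nat \<Rightarrow> (nat \<Rightarrow> real) \<Rightarrow> (nat \<Rightarrow> real)" where
  "vneg n x = (\<lambda>i\<in>{..<n}. - x i)"

definition mv :: "nat \<Rightarrow> (nat \<Rightarrow> nat \<Rightarrow> real) \<Rightarrow> (nat \<Rightarrow> real) \<Rightarrow> (nat \<Rightarrow> real)" where
  "mv n M x = (\<lambda>i\<in>{..<n}. \<Sum>j<n. M i j * x j)"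

definition mm :: "nat \<Rightarrow> (nat \<Rightarrow> nat \<Rightarrow> real) \<Rightarrow> (nat \<Rightarrow> nat \<Rightarrow> real) \<Rightarrow> (nat \<Rightarrow> nat \<Rightarrow> real)" where
  "mm n M N = (\<lambda>i\<in>{..<n}. \<lambda>j\<in>{..<n}. \<Sum>l<n. M i l * N l j)"

definition tr :: "nat \<Rightarrow> (nat \<Rightarrow> nat \<Rightarrow> real) \<Rightarrow> (nat \<Rightarrow> nat \<Rightarrow> real)" where
  "tr n M = (\<lambda>i\<in>{..<n}. \<lambda>j\<in>{..<n}. M j i)"

definition idm :: "nat \<Rightarrow> (nat \<Rightarrow> nat \<Rightarrow> real)" where
  "idm n = (\<lambda>i\<in>{..<n}. \<lambda>j\<in>{..<n}. if i = j then 1 else 0)"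

definition orth :: "nat \<Rightarrow> (nat \<Rightarrow> nat \<Rightarrow> real) set" where
  "orth n = {U \<in> mats n. mm n (tr n U) U = idm n}"

text \<open>The Grassmannian G_{n,k}, each k-dimensional subspace F being represented by its
orthogonal projection matrix P_F (symmetric, idempotent, trace k); F = range of P_F.\<close>
definition grass :: "nat \<Rightarrow> nat \<Rightarrow> (nat \<Rightarrow> nat \<Rightarrow> real) set" where
  "grass n k = {P \<in> mats n. tr n P = P \<and> mm n P P = P \<and> (\<Sum>i<n. P i i) = real k}"

text \<open>Haar probability nu_{n,k}: the O(n)-invariant Borel probability measure on G_{n,k}
(action F |-> U F, i.e. P |-> U P U^T).\<close>
definition nu :: "nat \<Rightarrow> nat \<Rightarrow> (nat \<Rightarrow> nat \<Rightarrow> real) measure" where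
  "nu n k = (THE \<mu>. prob_space \<mu> \<and> sets \<mu> = sets (restrict_space (matM n) (grass n k)) \<and>
      (\<forall>U \<in> orth n. distr \<mu> \<mu> (\<lambda>P. mm n (mm n U P) (tr n U)) = \<mu>))"

definition usphere :: "nat \<Rightarrow> (nat \<Rightarrow> nat \<Rightarrow> real) \<Rightarrow> (nat \<Rightarrow> real) set" where
  "usphere n P = {x \<in> vecs n. mv n P x = x \<and> nrm n x = 1}"

text \<open>Uniform probability on the unit sphere of F = range P: the Borel probability measure
invariant under all orthogonal maps of R^n that map F onto itself.\<close>
definition unif_sphere :: "nat \<Rightarrow> (nat \<Rightarrow> nat \<Rightarrow> real) \<Rightarrow> (nat \<Rightarrow> real) measure" where
  "unif_sphere n P = (THE \<sigma>. prob_space \<sigma> \<and> sets \<sigma> = sets (restrict_space (vecM n) (usphere n P)) \<and>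
      (\<forall>U \<in> orth n. mm n U P = mm n P U \<longrightarrow> distr \<sigma> \<sigma> (mv n U) = \<sigma>))"

definition supp :: "nat \<Rightarrow> (nat \<Rightarrow> real) set \<Rightarrow> (nat \<Rightarrow> real) \<Rightarrow> real" where
  "supp n L \<theta> = (SUP x\<in>L. ip n x \<theta>)"

definition mwidth :: "nat \<Rightarrow> (nat \<Rightarrow> nat \<Rightarrow> real) \<Rightarrow> (nat \<Rightarrow> real) set \<Rightarrow> real" where
  "mwidth n P L = (\<integral>\<theta>. supp n L \<theta> \<partial>(unif_sphere n P))"

definition wA :: "nat \<Rightarrow> (nat \<Rightarrow> real) set \<Rightarrow> real" where
  "wA n A = mwidth n (idm n) A"

definition radius :: "nat \<Rightarrow> (nat \<Rightarrow> real) set \<Rightarrow> real" where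
  "radius n A = (SUP x\<in>A. nrm n x)"

definition kstar :: "nat \<Rightarrow> (nat \<Rightarrow> real) set \<Rightarrow> real" where
  "kstar n A = real n * (wA n A / radius n A)\<^sup>2"

definition sym_convex_body :: "nat \<Rightarrow> (nat \<Rightarrow> real) set \<Rightarrow> bool" where
  "sym_convex_body n A \<longleftrightarrow> A \<subseteq> vecs n \<and> compact A \<and>
     (\<forall>x\<in>A. \<forall>y\<in>A. \<forall>t::real. 0 \<le> t \<and> t \<le> 1 \<longrightarrow> (\<lambda>i\<in>{..<n}. t * x i + (1 - t) * y i) \<in> A) \<and>
     (\<exists>x\<in>A. \<exists>r>0. \<forall>y\<in>vecs n. vdist n x y < r \<longrightarrow> y \<in> A) \<and>
     (\<forall>x\<in>A. vneg n x \<in> A)"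

end

theory Submission
  imports Defs "HOL-Real_Asymp.Real_Asymp"
begin

text \<open>Let \<open>G\<close> be a Gaussian matrix with \<open>k\<close> independent standard Gaussian columns \<open>g\<^sub>j\<close> in \<open>\<real>\<^sup>n\<close>; its column span \<open>F\<close> is
  distributed according to \<open>\<nu>\<close>. Given \<open>F\<close>, the direction of each column, size-biased by the length of that
  column, is uniform on the sphere of \<open>F\<close>, so the conditional expectation of \<open>h\<^sub>A(g\<^sub>j)\<close> given \<open>F\<close> is
  \<open>c w(P\<^sub>F A)\<close> with \<open>c = E |g| \<ge> sqrt (2n/\<pi>)\<close>. By Jensen's inequality the deviation \<open>c (w(P\<^sub>F A) - w(A))\<close> has exponential
  moments bounded by those of the average of the \<open>k\<close> independent variables \<open>h\<^sub>A(g\<^sub>j) - E h\<^sub>A(g)\<close>. Each of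
  these is subgaussian with variance proxy of order \<open>R(A)\<^sup>2\<close>, by a discretised Maurey--Pisier rotation argument
  for the convex function \<open>h\<^sub>A\<close>; averaging gains the factor \<open>k\<close>, and Chernoff's bound concludes.

  The invariant measures are handled through uniqueness: probability measures invariant under a transitive family
  of isometries coincide (Christensen). The same principle identifies the size-biased law on flags.\<close>

text \<open>The size bias absorbs the length of a column into the law: the weighted pair (direction,
  span) has again an orthogonally invariant distribution, so uniqueness identifies it where one
  would otherwise have to separate length from direction conditionally on F. All k columns have the
  same conditional mean given F, hence so does their average; this is how their independence reaches
  the single function w(P_F A). Conditioning is expressed by testing against bounded functions of F,
  and Jensen's inequality becomes a tangent-line inequality whose test function is the exponential
  itself. Origin of the constants: a rotation through a quarter turn bounds the logarithm of the
  exponential moment at s by s^2 pi^2 R^2 / 8; averaging at parameter s divides this by k; the best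
  parameter gives the exponent 2 k c^2 t^2 w^2 / (pi^2 R^2), and c^2 >= 2n/pi turns it into (4/pi^3)
  t^2 k k_*. The prefactor 2 counts the two tails.\<close>

type_synonym rvec = "nat \<Rightarrow> real"
type_synonym rmat = "nat \<Rightarrow> nat \<Rightarrow> real"

section \<open>Measures determined by finitely many coordinates\<close>

text \<open>Finitely many real functions that are measurable and generate the whole sigma-algebra of
  \<open>N\<close>. Vectors, matrices, pairs of vectors and flags are all described this way, so
  each uniqueness principle is proved once for all of them.\<close>

definition coords :: "'j set \<Rightarrow> ('a \<Rightarrow> 'j \<Rightarrow> real) \<Rightarrow> 'a measure \<Rightarrow> bool" where
  "coords J c N \<longleftrightarrow> finite J \<and> (\<forall>j\<in>J. (\<lambda>x. c x j) \<in> borel_measurable N) \<and>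
     (\<forall>B\<in>sets N. \<exists>C\<in>sets (PiM J (\<lambda>_. borel)). B = (\<lambda>x. \<lambda>j\<in>J. c x j) -` C \<inter> space N)"

text \<open>It suffices that \<open>g\<close> rebuilds a point measurably from its coordinates: the
  set \<open>C\<close> belonging to \<open>B\<close> is then the preimage of \<open>B\<close> under
  \<open>g\<close>.\<close>

lemma coordsI:
  assumes "finite J" "\<And>j. j \<in> J \<Longrightarrow> (\<lambda>x. c x j) \<in> borel_measurable N"
    "g \<in> PiM J (\<lambda>_. borel) \<rightarrow>\<^sub>M N" "\<And>x. x \<in> space N \<Longrightarrow> g (\<lambda>j\<in>J. c x j) = x"
  shows "coords J c N"
  unfolding coords_def
proof (intro conjI ballI)
  fix B assume B: "B \<in> sets N"
  show "\<exists>C\<in>sets (PiM J (\<lambda>_. borel)). B = (\<lambda>x. \<lambda>j\<in>J. c x j) -` C \<inter> space N"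
  proof (intro bexI)
    show "g -` B \<inter> space (PiM J (\<lambda>_. borel)) \<in> sets (PiM J (\<lambda>_. borel))"
      using assms(3) B by (rule measurable_sets)
    show "B = (\<lambda>x. \<lambda>j\<in>J. c x j) -` (g -` B \<inter> space (PiM J (\<lambda>_. borel))) \<inter> space N"
      using assms(4) sets.sets_into_space[OF B] by (auto simp: space_PiM)
  qed
qed (use assms in auto)

text \<open>Closed lower boxes are stable under intersection (take the minimum of the corners),
  generate the product sigma-algebra, and those with natural-number corners exhaust the
  space.\<close>

lemma PiM_borel_box_eqI:
  fixes \<mu> \<nu> :: "('j \<Rightarrow> real) measure"
  assumes J: "finite J" and s: "sets \<mu> = sets (PiM J (\<lambda>_. borel))" "sets \<nu> = sets (PiM J (\<lambda>_. borel))"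
    and p: "prob_space \<mu>" "prob_space \<nu>"
    and eq: "\<And>a. emeasure \<mu> {x\<in>space (PiM J (\<lambda>_. borel :: real measure)). \<forall>j\<in>J. x j \<le> a j} =
                  emeasure \<nu> {x\<in>space (PiM J (\<lambda>_. borel :: real measure)). \<forall>j\<in>J. x j \<le> a j}"
  shows "\<mu> = \<nu>"
proof -
  interpret m: prob_space \<mu> by fact
  interpret n: prob_space \<nu> by fact
  let ?P = "{{f\<in>(\<Pi>\<^sub>E i\<in>J. UNIV). \<forall>i\<in>j. f i \<in> A i} | A j. j \<in> {J} \<and> A \<in> Pi j (\<lambda>_. range (\<lambda>a::real. {..a}))}"
  have b: "(borel :: real measure) = sigma UNIV (range (\<lambda>a. {..a}))" by (rule borel_eq_atMost)
  have S0: "sets (PiM J (\<lambda>_. sigma UNIV (range (\<lambda>a::real. {..a})))) = sets (sigma (\<Pi>\<^sub>E i\<in>J. UNIV) ?P)"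
  proof (rule sets_PiM_sigma)
    have "UNIV = (\<Union>i::nat. {..real i})" by (auto intro: real_arch_simple)
    then show "\<exists>S\<subseteq>range (\<lambda>a::real. {..a}). countable S \<and> UNIV = \<Union> S"
      by (intro exI[of _ "range (\<lambda>i::nat. {..real i})"]) auto
  qed (use J in auto)
  have S: "sets (PiM J (\<lambda>_. borel)) = sigma_sets (\<Pi>\<^sub>E i\<in>J. UNIV) ?P"
    unfolding b S0 by (subst sets_measure_of) auto
  have rep: "\<exists>a::'j \<Rightarrow> real. X = {x\<in>space (PiM J (\<lambda>_. borel :: real measure)). \<forall>j\<in>J. x j \<le> a j}" if "X \<in> ?P" for X
  proof -
    from that obtain A j where "X = {f\<in>(\<Pi>\<^sub>E i\<in>J. UNIV). \<forall>i\<in>j. f i \<in> A i}" "j \<in> {J}" "A \<in> Pi j (\<lambda>_. range (\<lambda>a::real. {..a}))"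
      unfolding mem_Collect_eq by (elim exE conjE)
    then have A: "X = {f\<in>(\<Pi>\<^sub>E i\<in>J. UNIV). \<forall>i\<in>J. f i \<in> A i}" "A \<in> Pi J (\<lambda>_. range (\<lambda>a::real. {..a}))"
      by simp_all
    have "\<forall>j\<in>J. \<exists>a. A j = {..a}"
      using funcset_mem[OF A(2)] by fast
    then obtain a where a: "\<And>j. j \<in> J \<Longrightarrow> A j = {..a j}" by metis
    have "X = {x\<in>space (PiM J (\<lambda>_. borel :: real measure)). \<forall>j\<in>J. x j \<le> a j}"
      unfolding A(1) space_PiM space_borel by (rule Collect_cong) (simp add: a cong: conj_cong ball_cong)
    then show ?thesis by (rule exI[where x=a])
  qed
  have box: "{x\<in>space (PiM J (\<lambda>_. borel :: real measure)). \<forall>j\<in>J. x j \<le> a j} \<in> ?P" for a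
    unfolding mem_Collect_eq
    by (intro exI[of _ "\<lambda>j. {..a j}"] exI[of _ J]) (simp add: space_PiM)
  show ?thesis
  proof (rule measure_eqI_generator_eq[where E="?P" and \<Omega>="\<Pi>\<^sub>E i\<in>J. UNIV"
        and A="\<lambda>i. {x\<in>space (PiM J (\<lambda>_. borel :: real measure)). \<forall>j\<in>J. x j \<le> real i}"])
    show "Int_stable ?P"
    proof (rule Int_stableI)
      fix X Y assume XP: "X \<in> ?P" and YP: "Y \<in> ?P"
      obtain a where a: "X = {x\<in>space (PiM J (\<lambda>_. borel :: real measure)). \<forall>j\<in>J. x j \<le> a j}"
        using rep[OF XP] by (elim exE)
      obtain b where b: "Y = {x\<in>space (PiM J (\<lambda>_. borel :: real measure)). \<forall>j\<in>J. x j \<le> b j}"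
        using rep[OF YP] by (elim exE)
      have XY: "X \<inter> Y = {x\<in>space (PiM J (\<lambda>_. borel :: real measure)). \<forall>j\<in>J. x j \<le> min (a j) (b j)}"
        unfolding a b by (rule set_eqI) (simp, blast)
      show "X \<inter> Y \<in> ?P" unfolding XY by (rule box)
    qed
    show "?P \<subseteq> Pow (\<Pi>\<^sub>E i\<in>J. UNIV)" by blast
    show "emeasure \<mu> X = emeasure \<nu> X" if "X \<in> ?P" for X by (rule exE[OF rep[OF that]]) (simp only: eq)
    show "sets \<mu> = sigma_sets (\<Pi>\<^sub>E i\<in>J. UNIV) ?P" "sets \<nu> = sigma_sets (\<Pi>\<^sub>E i\<in>J. UNIV) ?P"
      using s S by auto
    show "range (\<lambda>i. {x\<in>space (PiM J (\<lambda>_. borel :: real measure)). \<forall>j\<in>J. x j \<le> real i}) \<subseteq> ?P"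
      by (rule image_subsetI) (rule box)
    show "(\<Union>i. {x\<in>space (PiM J (\<lambda>_. borel :: real measure)). \<forall>j\<in>J. x j \<le> real i}) = (\<Pi>\<^sub>E i\<in>J. UNIV)"
    proof (intro equalityI subsetI)
      fix x :: "'j \<Rightarrow> real" assume x: "x \<in> (\<Pi>\<^sub>E i\<in>J. UNIV)"
      obtain i :: nat where i: "(\<Sum>j\<in>J. \<bar>x j\<bar>) \<le> real i" using real_arch_simple by blast
      have "x j \<le> real i" if "j \<in> J" for j
        using i member_le_sum[of j J "\<lambda>j. \<bar>x j\<bar>"] that J by auto
      then show "x \<in> (\<Union>i. {x\<in>space (PiM J (\<lambda>_. borel :: real measure)). \<forall>j\<in>J. x j \<le> real i})"
        using x by (auto simp: space_PiM)
    qed (auto simp: space_PiM)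
  qed auto
qed

abbreviation cbox_of :: "'a measure \<Rightarrow> 'j set \<Rightarrow> ('a \<Rightarrow> 'j \<Rightarrow> real) \<Rightarrow> ('j \<Rightarrow> real) \<Rightarrow> 'a set" where
  "cbox_of N J c a \<equiv> {x\<in>space N. \<forall>j\<in>J. c x j \<le> a j}"

text \<open>Every set of \<open>N\<close> is a preimage under the coordinate map, so the joint law
  of the coordinates determines the measure.\<close>

lemma coords_box_eqI:
  fixes J :: "'j set" and c :: "'a \<Rightarrow> 'j \<Rightarrow> real"
  assumes c: "coords J c N" and s: "sets \<mu> = sets N" "sets \<nu> = sets N"
    and p: "prob_space \<mu>" "prob_space \<nu>"
    and eq: "\<And>a. measure \<mu> (cbox_of N J c a) = measure \<nu> (cbox_of N J c a)"
  shows "\<mu> = \<nu>"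
proof -
  interpret m: prob_space \<mu> by fact
  interpret n: prob_space \<nu> by fact
  note [measurable_cong] = s
  let ?h = "\<lambda>x. \<lambda>j\<in>J. c x j" and ?B = "PiM J (\<lambda>_. borel) :: ('j \<Rightarrow> real) measure"
  have J: "finite J" and cm: "\<And>j. j \<in> J \<Longrightarrow> (\<lambda>x. c x j) \<in> borel_measurable N"
    using c unfolding coords_def by auto
  have h: "?h \<in> N \<rightarrow>\<^sub>M ?B" using cm by (intro measurable_restrict) auto
  then have h1: "?h \<in> \<mu> \<rightarrow>\<^sub>M ?B" and h2: "?h \<in> \<nu> \<rightarrow>\<^sub>M ?B" by measurable
  have sp: "space \<mu> = space N" "space \<nu> = space N" using s by (auto dest: sets_eq_imp_space_eq)
  have bx: "{x\<in>space ?B. \<forall>j\<in>J. x j \<le> a j} \<in> sets ?B" for a using J by measurable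
  have "distr \<mu> ?B ?h = distr \<nu> ?B ?h"
  proof (rule PiM_borel_box_eqI[OF J])
    fix a
    have "?h -` {x\<in>space ?B. \<forall>j\<in>J. x j \<le> a j} \<inter> space N = cbox_of N J c a"
      by (auto simp: space_PiM)
    then show "emeasure (distr \<mu> ?B ?h) {x \<in> space ?B. \<forall>j\<in>J. x j \<le> a j} =
         emeasure (distr \<nu> ?B ?h) {x \<in> space ?B. \<forall>j\<in>J. x j \<le> a j}"
      using bx eq[of a] h1 h2
      by (simp add: emeasure_distr sp m.emeasure_eq_measure n.emeasure_eq_measure)
  qed (use h1 h2 in \<open>auto intro: m.prob_space_distr n.prob_space_distr\<close>)
  show ?thesis
  proof (rule measure_eqI)
    fix B assume "B \<in> sets \<mu>"
    then obtain C where C: "C \<in> sets ?B" "B = ?h -` C \<inter> space N" using c s unfolding coords_def by metis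
    then have "emeasure \<mu> B = emeasure (distr \<mu> ?B ?h) C" using h1 by (simp add: emeasure_distr sp)
    also have "\<dots> = emeasure (distr \<nu> ?B ?h) C" by (simp add: \<open>distr \<mu> ?B ?h = distr \<nu> ?B ?h\<close>)
    also have "\<dots> = emeasure \<nu> B" using C h2 by (simp add: emeasure_distr sp)
    finally show "emeasure \<mu> B = emeasure \<nu> B" .
  qed (use s in auto)
qed

text \<open>Integrating the kernel over the box with corner \<open>a + sqrt \<sigma>\<close> yields the probability that
  the point, perturbed by independent noise of size \<open>\<sigma>\<close>, lies in that box; the margin \<open>sqrt \<sigma>\<close> makes this
  tend to the indicator of the closed box with corner \<open>a\<close> as \<open>\<sigma> \<rightarrow> 0\<close>.\<close>
lemma normal_box_limit:
  fixes x a :: real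
  shows "(\<lambda>m. \<integral>z. normal_density z (1 / real (Suc m) ^ 2) x * indicator {..a + 1 / real (Suc m)} z \<partial>lborel)
     \<longlonglongrightarrow> indicator {..a} x"
proof -
  define s where "s m = 1 / real (Suc m)" for m
  have s0: "s m > 0" for m by (simp add: s_def)
  \<comment> \<open>The substitution \<open>z = x + s^2 y\<close> leaves a standard normal
    \<open>y\<close>, whose density serves as dominating function for all \<open>m\<close>.\<close>
  have eq: "(\<integral>z. normal_density z ((s m)^2) x * indicator {..a + s m} z \<partial>lborel)
      = (\<integral>y. normal_density 0 1 y * indicator {..a + s m} (x + (s m)^2 * y) \<partial>lborel)" for m
  proof -
    have "(\<integral>z. normal_density z ((s m)^2) x * indicator {..a + s m} z \<partial>lborel)
      = \<bar>(s m)^2\<bar> *\<^sub>R (\<integral>y. normal_density (x + (s m)^2 * y) ((s m)^2) x * indicator {..a + s m} (x + (s m)^2 * y) \<partial>lborel)"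
      using s0[of m] by (intro lborel_integral_real_affine) auto
    also have "\<dots> = (\<integral>y. \<bar>(s m)^2\<bar> *\<^sub>R (normal_density (x + (s m)^2 * y) ((s m)^2) x * indicator {..a + s m} (x + (s m)^2 * y)) \<partial>lborel)"
      by (simp only: integral_scaleR_right)
    also have "\<dots> = (\<integral>y. normal_density 0 1 y * indicator {..a + s m} (x + (s m)^2 * y) \<partial>lborel)"
    proof (rule Bochner_Integration.integral_cong[OF refl])
      fix y
      have "(s m)^2 * normal_density (x + (s m)^2 * y) ((s m)^2) x = normal_density 0 1 y"
      proof -
        have "sqrt (2 * pi * (s m ^ 2) ^ 2) = sqrt (2 * pi) * s m ^ 2"
          unfolding real_sqrt_mult real_sqrt_abs by simp
        then show ?thesis
          using s0[of m] by (simp add: normal_density_def field_simps power_mult_distrib)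
      qed
      then show "\<bar>(s m)^2\<bar> *\<^sub>R (normal_density (x + (s m)^2 * y) ((s m)^2) x * indicator {..a + s m} (x + (s m)^2 * y))
        = normal_density 0 1 y * indicator {..a + s m} (x + (s m)^2 * y)" by simp
    qed
    finally show ?thesis .
  qed
  have lims: "s \<longlonglongrightarrow> 0" unfolding s_def by real_asymp
  have "(\<lambda>m. \<integral>y. normal_density 0 1 y * indicator {..a + s m} (x + (s m)^2 * y) \<partial>lborel)
     \<longlonglongrightarrow> (\<integral>y. normal_density 0 1 y * indicator {..a} x \<partial>lborel)"
  proof (rule integral_dominated_convergence[where w="normal_density 0 1"])
    show "integrable lborel (normal_density 0 1)" by simp
    show "AE y in lborel. (\<lambda>m. normal_density 0 1 y * indicator {..a + s m} (x + (s m)^2 * y)) \<longlonglongrightarrow> normal_density 0 1 y * indicator {..a} x"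
    proof (intro AE_I2 tendsto_mult tendsto_const)
      fix y :: real
      show "(\<lambda>m. indicator {..a + s m} (x + (s m)^2 * y)) \<longlonglongrightarrow> (indicator {..a} x :: real)"
      proof (rule tendsto_eventually, cases "x \<le> a")
        case True
        have "(\<lambda>m. s m * y) \<longlonglongrightarrow> 0 * y" by (intro tendsto_intros lims)
        then have "eventually (\<lambda>m. s m * y < 1) sequentially" by (rule order_tendstoD) simp
        then show "\<forall>\<^sub>F m in sequentially. indicator {..a + s m} (x + (s m)^2 * y) = (indicator {..a} x :: real)"
        proof eventually_elim
          case (elim m)
          then have "s m * (s m * y) \<le> s m * 1" using s0[of m] by (intro mult_left_mono) auto
          then show ?case using True by (auto simp: power2_eq_square algebra_simps split: split_indicator)
        qed
      next
        case False
        have "(\<lambda>m. x + (s m)^2 * y - s m) \<longlonglongrightarrow> x + 0^2 * y - 0" by (intro tendsto_intros lims)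
        then have "eventually (\<lambda>m. x + (s m)^2 * y - s m > a) sequentially" using False by (intro order_tendstoD) auto
        then show "\<forall>\<^sub>F m in sequentially. indicator {..a + s m} (x + (s m)^2 * y) = (indicator {..a} x :: real)"
          by eventually_elim (use False in \<open>auto split: split_indicator\<close>)
      qed
    qed
    show "AE y in lborel. norm (normal_density 0 1 y * indicator {..a + s m} (x + (s m)^2 * y)) \<le> normal_density 0 1 y" for m
      by (auto split: split_indicator)
  qed measurable
  then show ?thesis using eq by (simp add: s_def power_divide split: split_indicator)
qed


lemma normal_density_commute: "normal_density z \<sigma> x = normal_density x \<sigma> z"
  by (simp add: normal_density_def power2_commute)

text \<open>Uniqueness through Gaussian transforms, in the role usually taken by characteristic
  functions. Integrating the kernels over a box in \<open>z\<close> gives a smoothed box indicator,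
  and the box itself is recovered as \<sigma> tends to 0.\<close>

lemma gauss_kernel_eqI:
  fixes J :: "'j set" and c :: "'a \<Rightarrow> 'j \<Rightarrow> real"
  assumes c: "coords J c N" and s: "sets \<mu> = sets N" "sets \<nu> = sets N"
    and p: "prob_space \<mu>" "prob_space \<nu>"
    and eq: "\<And>\<sigma> z. \<sigma> > 0 \<Longrightarrow> (\<integral>\<^sup>+x. (\<Prod>j\<in>J. ennreal (normal_density (z j) \<sigma> (c x j))) \<partial>\<mu>) =
                           (\<integral>\<^sup>+x. (\<Prod>j\<in>J. ennreal (normal_density (z j) \<sigma> (c x j))) \<partial>\<nu>)"
  shows "\<mu> = \<nu>"
proof (rule coords_box_eqI[OF c s p])
  fix a :: "'j \<Rightarrow> real"
  have J: "finite J" and cm: "\<And>j. j \<in> J \<Longrightarrow> (\<lambda>x. c x j) \<in> borel_measurable N"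
    using c unfolding coords_def by auto
  define \<sigma> where "\<sigma> m = 1 / real (Suc m) ^ 2" for m
  have \<sigma>0: "\<sigma> m > 0" for m by (simp add: \<sigma>_def)
  define q where "q m j x = (\<integral>z. normal_density z (\<sigma> m) x * indicator {..a j + 1 / real (Suc m)} z \<partial>lborel)" for m j x
  have nd: "integrable lborel (\<lambda>z. normal_density z (\<sigma> m) x)" for m x
    using \<sigma>0[of m] by (subst normal_density_commute) simp
  have ndi: "integrable lborel (\<lambda>z. normal_density z (\<sigma> m) x * indicator {..a j + 1 / real (Suc m)} z)" for m j x
    using integrable_mult_indicator[OF _ nd[of m x], of "{..a j + 1 / real (Suc m)}"] by (simp add: mult.commute)
  have q0: "0 \<le> q m j x" for m j x
    unfolding q_def by (intro integral_nonneg_AE AE_I2) auto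
  have q1: "q m j x \<le> 1" for m j x
  proof -
    have "q m j x \<le> (\<integral>z. normal_density z (\<sigma> m) x \<partial>lborel)"
      unfolding q_def by (intro integral_mono ndi nd) (auto split: split_indicator)
    also have "\<dots> = 1" using \<sigma>0[of m] by (subst normal_density_commute) simp
    finally show ?thesis .
  qed
  have qm[measurable]: "q m j \<in> borel_measurable borel" for m j
    unfolding q_def normal_density_def by measurable
  let ?L = "PiM J (\<lambda>_. lborel) :: ('j \<Rightarrow> real) measure"
  interpret L: product_sigma_finite "\<lambda>_::'j. lborel :: real measure"
    by (intro product_sigma_finite.intro) (rule lborel.sigma_finite_measure_axioms)
  interpret LS: sigma_finite_measure ?L by (rule L.sigma_finite[OF J])
  \<comment> \<open>By Fubini the smoothed box mass depends on \<open>M\<close> only through its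
    kernel transform, where the hypothesis applies.\<close>
  have key: "(\<integral>\<^sup>+x. ennreal (\<Prod>j\<in>J. q m j (c x j)) \<partial>M)
     = (\<integral>\<^sup>+z. (\<integral>\<^sup>+x. (\<Prod>j\<in>J. ennreal (normal_density (z j) (\<sigma> m) (c x j))) \<partial>M)
           * (\<Prod>j\<in>J. indicator {..a j + 1 / real (Suc m)} (z j)) \<partial>?L)"
    if M: "sets M = sets N" "prob_space M" for M m
  proof -
    interpret M: prob_space M by fact
    interpret PS: pair_sigma_finite M ?L ..
    note [measurable_cong] = M(1)
    have [measurable]: "(\<lambda>x. c x j) \<in> borel_measurable M" if "j \<in> J" for j using cm[OF that] by measurable
    have qe: "ennreal (q m j y) = (\<integral>\<^sup>+z. ennreal (normal_density z (\<sigma> m) y) * indicator {..a j + 1 / real (Suc m)} z \<partial>lborel)" for j y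
      unfolding q_def
      by (subst nn_integral_eq_integral[symmetric, OF ndi]) (auto intro!: nn_integral_cong split: split_indicator)
    have "(\<integral>\<^sup>+x. ennreal (\<Prod>j\<in>J. q m j (c x j)) \<partial>M) =
       (\<integral>\<^sup>+x. (\<integral>\<^sup>+z. (\<Prod>j\<in>J. ennreal (normal_density (z j) (\<sigma> m) (c x j)) * indicator {..a j + 1 / real (Suc m)} (z j)) \<partial>?L) \<partial>M)"
    proof (rule nn_integral_cong)
      fix x
      have "ennreal (\<Prod>j\<in>J. q m j (c x j)) = (\<Prod>j\<in>J. ennreal (q m j (c x j)))"
        using q0 by (simp add: prod_ennreal)
      also have "\<dots> = (\<integral>\<^sup>+z. (\<Prod>j\<in>J. ennreal (normal_density (z j) (\<sigma> m) (c x j)) * indicator {..a j + 1 / real (Suc m)} (z j)) \<partial>?L)"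
        unfolding qe normal_density_def by (subst L.product_nn_integral_prod[OF J]) measurable
      finally show "ennreal (\<Prod>j\<in>J. q m j (c x j)) = \<dots>" .
    qed
    also have "\<dots> = (\<integral>\<^sup>+z. (\<integral>\<^sup>+x. (\<Prod>j\<in>J. ennreal (normal_density (z j) (\<sigma> m) (c x j)) * indicator {..a j + 1 / real (Suc m)} (z j)) \<partial>M) \<partial>?L)"
      by (rule PS.Fubini'[symmetric]) (unfold normal_density_def split_beta', measurable)
    also have "\<dots> = (\<integral>\<^sup>+z. (\<integral>\<^sup>+x. (\<Prod>j\<in>J. ennreal (normal_density (z j) (\<sigma> m) (c x j))) \<partial>M)
           * (\<Prod>j\<in>J. indicator {..a j + 1 / real (Suc m)} (z j)) \<partial>?L)"
      unfolding prod.distrib normal_density_def by (subst nn_integral_multc) auto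
    finally show ?thesis .
  qed
  have conv: "(\<lambda>m. \<integral>x. (\<Prod>j\<in>J. q m j (c x j)) \<partial>M) \<longlonglongrightarrow> measure M (cbox_of N J c a)"
    if M: "sets M = sets N" "prob_space M" for M
  proof -
    interpret M: prob_space M by fact
    note [measurable_cong] = M(1)
    have sp: "space M = space N" using M by (auto dest: sets_eq_imp_space_eq)
    have [measurable]: "(\<lambda>x. c x j) \<in> borel_measurable M" if "j \<in> J" for j using cm[OF that] by measurable
    have "(\<lambda>m. \<integral>x. (\<Prod>j\<in>J. q m j (c x j)) \<partial>M) \<longlonglongrightarrow> (\<integral>x. (\<Prod>j\<in>J. indicator {..a j} (c x j)) \<partial>M)"
    proof (rule integral_dominated_convergence[where w="\<lambda>_. 1"])
      show "AE x in M. (\<lambda>m. \<Prod>j\<in>J. q m j (c x j)) \<longlonglongrightarrow> (\<Prod>j\<in>J. indicator {..a j} (c x j))"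
        unfolding q_def \<sigma>_def by (intro AE_I2 tendsto_prod normal_box_limit)
      show "AE x in M. norm (\<Prod>j\<in>J. q m j (c x j)) \<le> 1" for m
        using q0 q1 by (auto simp: abs_prod intro!: prod_le_1)
    qed auto
    also have "(\<integral>x. (\<Prod>j\<in>J. indicator {..a j} (c x j)) \<partial>M) = (\<integral>x. indicator (cbox_of N J c a) x \<partial>M :: real)"
    proof (rule Bochner_Integration.integral_cong[OF refl])
      fix x assume x: "x \<in> space M"
      show "(\<Prod>j\<in>J. indicator {..a j} (c x j)) = (indicator (cbox_of N J c a) x :: real)"
      proof (cases "\<forall>j\<in>J. c x j \<le> a j")
        case True then show ?thesis using x sp by simp
      next
        case False
        then have "(\<Prod>j\<in>J. indicator {..a j} (c x j)) = (0::real)"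
          using J by (intro prod_zero) (auto simp: indicator_def)
        then show ?thesis using False by auto
      qed
    qed
    also have "\<dots> = measure M (cbox_of N J c a)"
    proof -
      have "cbox_of N J c a \<inter> space M = cbox_of N J c a"
        using sp by blast
      then show ?thesis by (subst Bochner_Integration.integral_indicator) simp
    qed
    finally show ?thesis .
  qed
  have qq: "(\<integral>x. (\<Prod>j\<in>J. q m j (c x j)) \<partial>\<mu>) = (\<integral>x. (\<Prod>j\<in>J. q m j (c x j)) \<partial>\<nu>)" for m
  proof -
    have [measurable]: "(\<lambda>x. \<Prod>j\<in>J. q m j (c x j)) \<in> borel_measurable \<mu>" "(\<lambda>x. \<Prod>j\<in>J. q m j (c x j)) \<in> borel_measurable \<nu>"
      using cm by (auto intro!: borel_measurable_prod measurable_compose[OF _ qm] simp: measurable_cong_sets[OF s(1) refl] measurable_cong_sets[OF s(2) refl])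
    have "(\<integral>\<^sup>+x. ennreal (\<Prod>j\<in>J. q m j (c x j)) \<partial>\<mu>) = (\<integral>\<^sup>+x. ennreal (\<Prod>j\<in>J. q m j (c x j)) \<partial>\<nu>)"
      unfolding key[OF s(1) p(1)] key[OF s(2) p(2)] by (simp add: eq \<sigma>0)
    then show ?thesis
      by (subst (1 2) integral_eq_nn_integral) (auto intro!: prod_nonneg q0)
  qed
  show "measure \<mu> (cbox_of N J c a) = measure \<nu> (cbox_of N J c a)"
    by (rule LIMSEQ_unique[OF conv[OF s(1) p(1), unfolded qq] conv[OF s(2) p(2)]])
qed

section \<open>Uniqueness of invariant measures\<close>

definition csq :: "'j set \<Rightarrow> ('a \<Rightarrow> 'j \<Rightarrow> real) \<Rightarrow> 'a \<Rightarrow> 'a \<Rightarrow> real" where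
  "csq J c x y = (\<Sum>j\<in>J. (c x j - c y j)\<^sup>2)"

lemma csq_commute: "csq J c x y = csq J c y x"
  by (simp add: csq_def power2_commute)

text \<open>A countable grid of small cells covers the space. If all balls centred in
  \<open>X\<close> were null, every cell meeting \<open>X\<close> would be null, since it lies in
  the ball around any of its points of \<open>X\<close>; the whole space would then have mass
  0.\<close>

lemma csq_ball_pos:
  fixes J :: "'j set" and c :: "'a \<Rightarrow> 'j \<Rightarrow> real"
  assumes J: "finite J" and cm: "\<And>j. j \<in> J \<Longrightarrow> (\<lambda>x. c x j) \<in> borel_measurable \<nu>"
    and p: "prob_space \<nu>" and X: "AE x in \<nu>. x \<in> X" and r: "r > 0"
  shows "\<exists>x\<in>X. x \<in> space \<nu> \<and> measure \<nu> {w\<in>space \<nu>. csq J c x w < r\<^sup>2} \<noteq> 0"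
proof (rule ccontr)
  assume "\<not> ?thesis"
  then have z: "x \<in> X \<Longrightarrow> x \<in> space \<nu> \<Longrightarrow> measure \<nu> {w\<in>space \<nu>. csq J c x w < r\<^sup>2} = 0" for x by blast
  interpret prob_space \<nu> by fact
  \<comment> \<open>Two points of one cell differ by at most \<open>\<epsilon>\<close> in each
    coordinate, hence by less than \<open>r\<close> overall. The \<open>+ 1\<close> keeps
    \<open>\<epsilon>\<close> positive when \<open>J\<close> is empty.\<close>
  define \<epsilon> where "\<epsilon> = r / (real (card J) + 1)"
  have \<epsilon>: "\<epsilon> > 0" using r by (simp add: \<epsilon>_def)
  have "real (card J) * \<epsilon>\<^sup>2 < (real (card J) + 1)\<^sup>2 * \<epsilon>\<^sup>2"
    using \<epsilon> by (intro mult_strict_right_mono) (auto simp: power2_eq_square algebra_simps add_pos_nonneg)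
  also have "\<dots> = r\<^sup>2" by (simp add: \<epsilon>_def power_divide)
  finally have \<epsilon>r: "real (card J) * \<epsilon>\<^sup>2 < r\<^sup>2" .
  define C where "C q = {w\<in>space \<nu>. \<forall>j\<in>J. \<lfloor>c w j / \<epsilon>\<rfloor> = q j}" for q :: "'j \<Rightarrow> int"
  have Cm: "{w\<in>space \<nu>. csq J c x w < r\<^sup>2} \<in> sets \<nu>" for x
    unfolding csq_def using cm by measurable
  have CN: "AE w in \<nu>. w \<notin> C q" for q
  proof (cases "X \<inter> C q = {}")
    case True
    then show ?thesis using X by (auto elim!: eventually_mono)
  next
    case False
    then obtain x where x: "x \<in> X" "x \<in> C q" by blast
    then have xs: "x \<in> space \<nu>" by (auto simp: C_def)
    have "csq J c x w < r\<^sup>2" if w: "w \<in> C q" for w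
    proof -
      have "(c x j - c w j)\<^sup>2 \<le> \<epsilon>\<^sup>2" if j: "j \<in> J" for j
      proof -
        have "\<lfloor>c x j / \<epsilon>\<rfloor> = \<lfloor>c w j / \<epsilon>\<rfloor>" using x w j by (simp add: C_def)
        then have "\<bar>c x j / \<epsilon> - c w j / \<epsilon>\<bar> < 1" by linarith
        then have "\<bar>c x j - c w j\<bar> / \<epsilon> < 1" using \<epsilon> by (simp add: diff_divide_distrib[symmetric])
        then have "\<bar>c x j - c w j\<bar> \<le> \<bar>\<epsilon>\<bar>" using \<epsilon> by (simp add: field_simps)
        then show ?thesis by (simp add: abs_le_square_iff)
      qed
      then have "csq J c x w \<le> real (card J) * \<epsilon>\<^sup>2"
        unfolding csq_def by (rule sum_bounded_above)
      then show ?thesis using \<epsilon>r by linarith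
    qed
    then have sub: "w \<in> C q \<Longrightarrow> w \<in> {w\<in>space \<nu>. csq J c x w < r\<^sup>2}" for w by (auto simp: C_def)
    have "{w\<in>space \<nu>. csq J c x w < r\<^sup>2} \<in> null_sets \<nu>"
      using z[OF x(1) xs] Cm[of x] by (simp add: null_sets_def emeasure_eq_measure)
    then have "AE w in \<nu>. w \<notin> {w\<in>space \<nu>. csq J c x w < r\<^sup>2}" by (rule AE_not_in)
    then show ?thesis by eventually_elim (use sub in blast)
  qed
  have "countable (PiE J (\<lambda>_. UNIV :: int set))" using J by (intro countable_PiE) auto
  then have "AE w in \<nu>. \<forall>q\<in>PiE J (\<lambda>_. UNIV :: int set). w \<notin> C q"
    using CN by (subst AE_ball_countable) auto
  then have "AE w in \<nu>. False"
  proof (rule AE_mp, intro AE_I2 impI)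
    fix w assume w: "w \<in> space \<nu>" "\<forall>q\<in>PiE J (\<lambda>_. UNIV :: int set). w \<notin> C q"
    have "w \<in> C (\<lambda>j\<in>J. \<lfloor>c w j / \<epsilon>\<rfloor>)" using w(1) by (simp add: C_def)
    moreover have "(\<lambda>j\<in>J. \<lfloor>c w j / \<epsilon>\<rfloor>) \<in> PiE J (\<lambda>_. UNIV :: int set)" by simp
    ultimately show False using w(2) by blast
  qed
  then show False by simp
qed

text \<open>This is Christensen's argument: two probability measures for which all balls of a given radius have the
  same mass have, by Fubini, the same ball masses, and averaging a Lipschitz function over balls
  then shows that they give it nearly the same integral.\<close>
lemma invariant_eqI:
  fixes J :: "'j set" and c :: "'a \<Rightarrow> 'j \<Rightarrow> real"
  assumes c: "coords J c N" and s: "sets \<mu> = sets N" "sets \<nu> = sets N"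
    and p: "prob_space \<mu>" "prob_space \<nu>"
    and X: "AE x in \<mu>. x \<in> X" "AE x in \<nu>. x \<in> X"
    and Tm: "\<And>T. T \<in> \<T> \<Longrightarrow> T \<in> N \<rightarrow>\<^sub>M N"
    and inv: "\<And>T. T \<in> \<T> \<Longrightarrow> distr \<mu> N T = \<mu>" "\<And>T. T \<in> \<T> \<Longrightarrow> distr \<nu> N T = \<nu>"
    and iso: "\<And>T x w. T \<in> \<T> \<Longrightarrow> csq J c (T x) (T w) = csq J c x w"
    and trans: "\<And>x y. x \<in> X \<Longrightarrow> y \<in> X \<Longrightarrow> \<exists>T\<in>\<T>. T x = y"
  shows "\<mu> = \<nu>"
proof (rule coords_box_eqI[OF c s p])
  fix a :: "'j \<Rightarrow> real"
  interpret m: prob_space \<mu> by fact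
  interpret n: prob_space \<nu> by fact
  interpret P: pair_prob_space \<mu> \<nu> ..
  have J: "finite J" and cm: "\<And>j. j \<in> J \<Longrightarrow> (\<lambda>x. c x j) \<in> borel_measurable N"
    using c unfolding coords_def by auto
  note [measurable_cong] = s
  have sp: "space \<mu> = space N" "space \<nu> = space N" using s by (auto dest: sets_eq_imp_space_eq)
  have cN[measurable]: "(\<lambda>x. c x j) \<in> borel_measurable N" if "j \<in> J" for j using cm that .
  have c1[measurable]: "(\<lambda>x. c x j) \<in> borel_measurable \<mu>" if "j \<in> J" for j using cm[OF that] by measurable
  have c2[measurable]: "(\<lambda>x. c x j) \<in> borel_measurable \<nu>" if "j \<in> J" for j using cm[OF that] by measurable
  have sqm[measurable]: "(\<lambda>p. csq J c (fst p) (snd p)) \<in> borel_measurable (\<mu> \<Otimes>\<^sub>M \<nu>)"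
    unfolding csq_def by (intro borel_measurable_sum borel_measurable_power borel_measurable_diff)
      (auto intro: measurable_compose[OF measurable_fst c1] measurable_compose[OF measurable_snd c2])
  have ballm: "{w\<in>space N. csq J c x w < r\<^sup>2} \<in> sets N" for x r
    unfolding csq_def using cm by measurable
  have ball_inv: "measure M {w\<in>space N. csq J c x w < r\<^sup>2} = measure M {w\<in>space N. csq J c y w < r\<^sup>2}"
    if M: "M = \<mu> \<or> M = \<nu>" and xy: "x \<in> X" "y \<in> X" for M x y r
  proof -
    obtain T where T: "T \<in> N \<rightarrow>\<^sub>M N" "T x = y" "distr M N T = M" "\<And>w. csq J c (T x) (T w) = csq J c x w"
      using trans[OF xy] Tm inv iso M by metis
    have sM: "sets M = sets N" using M s by auto
    then have spM: "space M = space N" by (rule sets_eq_imp_space_eq)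
    have TM: "T \<in> M \<rightarrow>\<^sub>M N" using T(1) sM by (simp cong: measurable_cong_sets)
    have "measure M {w\<in>space N. csq J c y w < r\<^sup>2} = measure (distr M N T) {w\<in>space N. csq J c y w < r\<^sup>2}"
      by (simp add: T(3))
    also have "\<dots> = measure M (T -` {w\<in>space N. csq J c y w < r\<^sup>2} \<inter> space N)"
      using TM ballm by (simp add: measure_distr spM)
    also have "T -` {w\<in>space N. csq J c y w < r\<^sup>2} \<inter> space N = {w\<in>space N. csq J c x w < r\<^sup>2}"
      using measurable_space[OF T(1)] T(4) unfolding T(2) by auto
    finally show ?thesis by simp
  qed
  have fint: "(\<integral>x. f x \<partial>\<mu>) = (\<integral>x. f x \<partial>\<nu>)"
    if f[measurable]: "f \<in> borel_measurable N" and B: "\<And>x. x \<in> space N \<Longrightarrow> \<bar>f x\<bar> \<le> 1"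
      and L: "\<And>x y r. x \<in> space N \<Longrightarrow> y \<in> space N \<Longrightarrow> 0 \<le> r \<Longrightarrow> csq J c x y < r\<^sup>2 \<Longrightarrow> \<bar>f x - f y\<bar> \<le> K * r" and K: "K \<ge> 0" for f K
  proof -
    have f1[measurable]: "f \<in> borel_measurable \<mu>" and f2[measurable]: "f \<in> borel_measurable \<nu>" using f by measurable
    have main: "\<bar>(\<integral>x. f x \<partial>\<mu>) - (\<integral>x. f x \<partial>\<nu>)\<bar> \<le> K * r" if r: "r > 0" for r
    proof -
      \<comment> \<open>Fubini will only control \<open>b\<close> times the difference of the
        integrals; a centre with positive ball mass makes \<open>b\<close> cancellable.\<close>
      obtain x0 where x0: "x0 \<in> X" "measure \<nu> {w\<in>space N. csq J c x0 w < r\<^sup>2} \<noteq> 0"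
        using csq_ball_pos[where c=c, OF J c2 p(2) X(2) r, unfolded sp] by auto
      define b where "b = measure \<nu> {w\<in>space N. csq J c x0 w < r\<^sup>2}"
      define a' where "a' = measure \<mu> {w\<in>space N. csq J c x0 w < r\<^sup>2}"
      have b0: "b > 0" using x0 by (simp add: b_def zero_less_measure_iff)
      define k where "k p = (indicator {p. csq J c (fst p) (snd p) < r\<^sup>2} p :: real)" for p
      have km[measurable]: "k \<in> borel_measurable (\<mu> \<Otimes>\<^sub>M \<nu>)"
        unfolding k_def indicator_def mem_Collect_eq using sqm by measurable
      have k01: "0 \<le> k p" "k p \<le> 1" for p by (auto simp: k_def split: split_indicator)
      have fst_f: "(\<lambda>p. f (fst p)) \<in> borel_measurable (\<mu> \<Otimes>\<^sub>M \<nu>)"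
        by (rule measurable_compose[OF measurable_fst f1])
      have snd_f: "(\<lambda>p. f (snd p)) \<in> borel_measurable (\<mu> \<Otimes>\<^sub>M \<nu>)"
        by (rule measurable_compose[OF measurable_snd f2])
      have spP: "space (\<mu> \<Otimes>\<^sub>M \<nu>) = space N \<times> space N" by (simp add: space_pair_measure sp)
      have bd: "integrable (\<mu> \<Otimes>\<^sub>M \<nu>) (\<lambda>p. k p * g p)"
        if "g \<in> borel_measurable (\<mu> \<Otimes>\<^sub>M \<nu>)" "\<And>p. p \<in> space N \<times> space N \<Longrightarrow> \<bar>g p\<bar> \<le> 1" for g
      proof (rule P.integrable_const_bound[where B=1])
        show "AE p in \<mu> \<Otimes>\<^sub>M \<nu>. norm (k p * g p) \<le> 1"
        proof (rule AE_I2)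
          fix p assume p: "p \<in> space (\<mu> \<Otimes>\<^sub>M \<nu>)"
          show "norm (k p * g p) \<le> 1"
            using that(2)[of p] p k01[of p] by (auto simp: spP abs_mult intro: mult_le_one)
        qed
      qed (use that in measurable)
      have i1: "integrable (\<mu> \<Otimes>\<^sub>M \<nu>) (\<lambda>p. k p * f (fst p))" using fst_f B by (intro bd) auto
      have i2: "integrable (\<mu> \<Otimes>\<^sub>M \<nu>) (\<lambda>p. k p * f (snd p))" using snd_f B by (intro bd) auto
      have i0: "integrable (\<mu> \<Otimes>\<^sub>M \<nu>) k" using bd[of "\<lambda>_. 1"] by simp
      have kx: "(\<integral>y. k (x, y) \<partial>\<nu>) = b" if "x \<in> X" "x \<in> space N" for x
      proof -
        have "(\<integral>y. k (x, y) \<partial>\<nu>) = (\<integral>y. indicator {w\<in>space N. csq J c x w < r\<^sup>2} y \<partial>\<nu>)"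
          by (intro Bochner_Integration.integral_cong) (auto simp: k_def sp split: split_indicator)
        also have "\<dots> = measure \<nu> ({w\<in>space N. csq J c x w < r\<^sup>2} \<inter> space \<nu>)" by simp
        also have "{w\<in>space N. csq J c x w < r\<^sup>2} \<inter> space \<nu> = {w\<in>space N. csq J c x w < r\<^sup>2}" using sp by auto
        finally show ?thesis unfolding b_def using ball_inv[of \<nu> x x0] that x0 by simp
      qed
      have ky: "(\<integral>x. k (x, y) \<partial>\<mu>) = a'" if "y \<in> X" "y \<in> space N" for y
      proof -
        have "(\<integral>x. k (x, y) \<partial>\<mu>) = (\<integral>x. indicator {w\<in>space N. csq J c y w < r\<^sup>2} x \<partial>\<mu>)"
          by (intro Bochner_Integration.integral_cong) (auto simp: k_def sp csq_commute[of J c y] split: split_indicator)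
        also have "\<dots> = measure \<mu> ({w\<in>space N. csq J c y w < r\<^sup>2} \<inter> space \<mu>)" by simp
        also have "{w\<in>space N. csq J c y w < r\<^sup>2} \<inter> space \<mu> = {w\<in>space N. csq J c y w < r\<^sup>2}" using sp by auto
        finally show ?thesis unfolding a'_def using ball_inv[of \<mu> y x0] that x0 by simp
      qed
      have I1: "(\<integral>p. k p * g (fst p) \<partial>(\<mu> \<Otimes>\<^sub>M \<nu>)) = b * (\<integral>x. g x \<partial>\<mu>)"
        if g: "g \<in> borel_measurable \<mu>" and i: "integrable (\<mu> \<Otimes>\<^sub>M \<nu>) (\<lambda>p. k p * g (fst p))" for g
      proof -
        have "(\<integral>p. k p * g (fst p) \<partial>(\<mu> \<Otimes>\<^sub>M \<nu>)) = (\<integral>x. (\<integral>y. k (x, y) * g x \<partial>\<nu>) \<partial>\<mu>)"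
          using P.integral_fst'[OF i] by simp
        also have "\<dots> = (\<integral>x. b * g x \<partial>\<mu>)"
        proof (rule integral_cong_AE)
          show "AE x in \<mu>. (\<integral>y. k (x, y) * g x \<partial>\<nu>) = b * g x"
            using X(1) AE_space by eventually_elim (simp add: kx sp)
          show "(\<lambda>x. \<integral>y. k (x, y) * g x \<partial>\<nu>) \<in> borel_measurable \<mu>"
            using borel_measurable_integrable[OF P.integrable_fst'[OF i]] by simp
        qed (use g in measurable)
        finally show ?thesis by simp
      qed
      have I2: "(\<integral>p. k p * g (snd p) \<partial>(\<mu> \<Otimes>\<^sub>M \<nu>)) = a' * (\<integral>x. g x \<partial>\<nu>)"
        if g: "g \<in> borel_measurable \<nu>" and i: "integrable (\<mu> \<Otimes>\<^sub>M \<nu>) (\<lambda>p. k p * g (snd p))" for g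
      proof -
        have "(\<integral>p. k p * g (snd p) \<partial>(\<mu> \<Otimes>\<^sub>M \<nu>)) = (\<integral>y. (\<integral>x. k (x, y) * g y \<partial>\<mu>) \<partial>\<nu>)"
          using P.integral_snd[of "\<lambda>x y. k (x, y) * g y"] i by (simp add: case_prod_unfold)
        also have "\<dots> = (\<integral>y. a' * g y \<partial>\<nu>)"
        proof (rule integral_cong_AE)
          show "AE y in \<nu>. (\<integral>x. k (x, y) * g y \<partial>\<mu>) = a' * g y"
            using X(2) AE_space by eventually_elim (simp add: ky sp)
          show "(\<lambda>y. \<integral>x. k (x, y) * g y \<partial>\<mu>) \<in> borel_measurable \<nu>"
            using borel_measurable_integrable[OF P.integrable_snd[of "\<lambda>x y. k (x, y) * g y"]] i
            by (simp add: case_prod_unfold)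
        qed (use g in measurable)
        finally show ?thesis by simp
      qed
      have K1: "(\<integral>p. k p \<partial>(\<mu> \<Otimes>\<^sub>M \<nu>)) = b" using I1[of "\<lambda>_. 1"] i0 by (simp add: m.prob_space)
      have K2: "(\<integral>p. k p \<partial>(\<mu> \<Otimes>\<^sub>M \<nu>)) = a'" using I2[of "\<lambda>_. 1"] i0 by (simp add: n.prob_space)
      \<comment> \<open>Both numbers are the product measure of the set of pairs at distance less
        than \<open>r\<close>: this matches the ball masses of the two measures.\<close>
      have ab: "a' = b" using K1 K2 by simp
      have "b * ((\<integral>x. f x \<partial>\<mu>) - (\<integral>x. f x \<partial>\<nu>)) = (\<integral>p. k p * f (fst p) - k p * f (snd p) \<partial>(\<mu> \<Otimes>\<^sub>M \<nu>))"
        using I1[OF f1 i1] I2[OF f2 i2] ab by (simp add: Bochner_Integration.integral_diff[OF i1 i2] right_diff_distrib)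
      also have "norm \<dots> \<le> (\<integral>p. k p * (K * r) \<partial>(\<mu> \<Otimes>\<^sub>M \<nu>))"
      proof (rule order_trans[OF integral_norm_bound integral_mono])
        show "integrable (\<mu> \<Otimes>\<^sub>M \<nu>) (\<lambda>p. norm (k p * f (fst p) - k p * f (snd p)))"
          by (intro integrable_norm Bochner_Integration.integrable_diff i1 i2)
        show "integrable (\<mu> \<Otimes>\<^sub>M \<nu>) (\<lambda>p. k p * (K * r))" using i0 by simp
        fix p assume p: "p \<in> space (\<mu> \<Otimes>\<^sub>M \<nu>)"
        show "norm (k p * f (fst p) - k p * f (snd p)) \<le> k p * (K * r)"
        proof (cases "csq J c (fst p) (snd p) < r\<^sup>2")
          case True
          then have "\<bar>f (fst p) - f (snd p)\<bar> \<le> K * r" using p r by (intro L) (auto simp: spP)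
          then show ?thesis using True by (simp add: k_def)
        qed (simp add: k_def)
      qed
      also have "\<dots> = b * (K * r)" by (simp add: K1)
      finally show ?thesis using b0 by (simp add: abs_mult)
    qed
    have "\<bar>(\<integral>x. f x \<partial>\<mu>) - (\<integral>x. f x \<partial>\<nu>)\<bar> \<le> 0"
    proof (rule field_le_epsilon)
      fix e :: real assume e: "e > 0"
      have "K * (e / (K + 1)) \<le> e" using K e by (simp add: field_simps)
      then show "\<bar>(\<integral>x. f x \<partial>\<mu>) - (\<integral>x. f x \<partial>\<nu>)\<bar> \<le> 0 + e"
        using main[of "e / (K + 1)"] K e by (simp add: add_nonneg_pos)
    qed
    then show ?thesis by simp
  qed
  \<comment> \<open>A Lipschitz cut-off: it is 1 on the box and, off the box, vanishes once
    \<open>m\<close> times the total excess over the corner reaches 1.\<close>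
  define f where "f m x = max 0 (1 - real m * (\<Sum>j\<in>J. max 0 (c x j - a j)))" for m x
  have fm[measurable]: "f m \<in> borel_measurable N" for m unfolding f_def using cN by measurable
  have f01: "\<bar>f m x\<bar> \<le> 1" for m x
  proof -
    have "0 \<le> real m * (\<Sum>j\<in>J. max 0 (c x j - a j))" by (intro mult_nonneg_nonneg sum_nonneg) auto
    then show ?thesis by (simp add: f_def)
  qed
  have fL: "\<bar>f m x - f m y\<bar> \<le> (real m * real (card J)) * r" if "0 \<le> r" and lt: "csq J c x y < r\<^sup>2" for m x y r
  proof -
    have "\<bar>c x j - c y j\<bar> \<le> r" if j: "j \<in> J" for j
    proof -
      have "(c x j - c y j)\<^sup>2 \<le> csq J c x y" unfolding csq_def using J j by (intro member_le_sum) auto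
      then have "(c x j - c y j)\<^sup>2 \<le> r\<^sup>2" using lt by linarith
      then show ?thesis using \<open>0 \<le> r\<close> by (simp add: abs_le_square_iff[symmetric])
    qed
    then have "\<bar>max 0 (c x j - a j) - max 0 (c y j - a j)\<bar> \<le> r" if "j \<in> J" for j using that by fastforce
    then have "(\<Sum>j\<in>J. \<bar>max 0 (c x j - a j) - max 0 (c y j - a j)\<bar>) \<le> real (card J) * r"
      by (rule sum_bounded_above)
    then have "\<bar>(\<Sum>j\<in>J. max 0 (c x j - a j)) - (\<Sum>j\<in>J. max 0 (c y j - a j))\<bar> \<le> real (card J) * r"
      unfolding sum_subtractf[symmetric] using sum_abs[of "\<lambda>j. max 0 (c x j - a j) - max 0 (c y j - a j)" J] by linarith
    then have "real m * \<bar>(\<Sum>j\<in>J. max 0 (c x j - a j)) - (\<Sum>j\<in>J. max 0 (c y j - a j))\<bar> \<le> real m * (real (card J) * r)"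
      by (rule mult_left_mono) simp
    then have "\<bar>real m * (\<Sum>j\<in>J. max 0 (c x j - a j)) - real m * (\<Sum>j\<in>J. max 0 (c y j - a j))\<bar> \<le> real m * real (card J) * r"
      by (simp add: right_diff_distrib[symmetric] abs_mult)
    then show ?thesis unfolding f_def by linarith
  qed
  have feq: "(\<integral>x. f m x \<partial>\<mu>) = (\<integral>x. f m x \<partial>\<nu>)" for m
    by (rule fint[OF fm f01 fL]) auto
  have conv: "(\<lambda>m. \<integral>x. f m x \<partial>M) \<longlonglongrightarrow> measure M (cbox_of N J c a)"
    if M: "sets M = sets N" "prob_space M" for M
  proof -
    interpret M: prob_space M by fact
    note [measurable_cong] = M(1)
    have spM: "space M = space N" using M by (auto dest: sets_eq_imp_space_eq)
    have bm: "cbox_of N J c a \<in> sets N" using J by measurable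
    have "(\<lambda>m. \<integral>x. f m x \<partial>M) \<longlonglongrightarrow> (\<integral>x. indicator (cbox_of N J c a) x \<partial>M)"
    proof (rule integral_dominated_convergence[where w="\<lambda>_. 1"])
      show "AE x in M. (\<lambda>m. f m x) \<longlonglongrightarrow> indicator (cbox_of N J c a) x"
      proof (rule AE_I2)
        fix x assume x: "x \<in> space M"
        show "(\<lambda>m. f m x) \<longlonglongrightarrow> indicator (cbox_of N J c a) x"
        proof (cases "\<forall>j\<in>J. c x j \<le> a j")
          case True
          then have "(\<Sum>j\<in>J. max 0 (c x j - a j)) = 0" by (intro sum.neutral) auto
          then show ?thesis using True x by (simp add: f_def spM)
        next
          case False
          then obtain j where j: "j \<in> J" "c x j > a j" by auto
          have pos: "(\<Sum>j\<in>J. max 0 (c x j - a j)) > 0"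
            by (rule sum_pos2[OF J j(1)]) (use j in auto)
          obtain m0 :: nat where m0: "1 < real m0 * (\<Sum>j\<in>J. max 0 (c x j - a j))"
            using pos by (rule ex_less_of_nat_mult[THEN exE])
          have "f m x = 0" if "m \<ge> m0" for m
          proof -
            have "real m0 * (\<Sum>j\<in>J. max 0 (c x j - a j)) \<le> real m * (\<Sum>j\<in>J. max 0 (c x j - a j))"
              using that pos by (intro mult_right_mono) auto
            then show ?thesis using m0 by (simp add: f_def)
          qed
          then have "\<forall>\<^sub>F m in sequentially. f m x = indicator (cbox_of N J c a) x"
            using False by (auto simp: eventually_sequentially)
          then show ?thesis by (rule tendsto_eventually)
        qed
      qed
      show "AE x in M. norm (f m x) \<le> 1" for m using f01 by simp
      show "f m \<in> borel_measurable M" for m using fm by measurable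
      show "indicator (cbox_of N J c a) \<in> borel_measurable M" using bm by measurable
    qed auto
    also have "(\<integral>x. indicator (cbox_of N J c a) x \<partial>M) = measure M (cbox_of N J c a)"
    proof -
      have "cbox_of N J c a \<inter> space M = cbox_of N J c a"
        using spM by blast
      then show ?thesis by (subst Bochner_Integration.integral_indicator) simp
    qed
    finally show ?thesis .
  qed
  show "measure \<mu> (cbox_of N J c a) = measure \<nu> (cbox_of N J c a)"
    by (rule LIMSEQ_unique[OF conv[OF s(1) p(1), unfolded feq] conv[OF s(2) p(2)]])
qed

section \<open>Matrices and orthogonal maps\<close>

definition madd :: "nat \<Rightarrow> rmat \<Rightarrow> rmat \<Rightarrow> rmat" where
  "madd n A B = (\<lambda>i\<in>{..<n}. \<lambda>j\<in>{..<n}. A i j + B i j)"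

definition msub :: "nat \<Rightarrow> rmat \<Rightarrow> rmat \<Rightarrow> rmat" where
  "msub n A B = (\<lambda>i\<in>{..<n}. \<lambda>j\<in>{..<n}. A i j - B i j)"

definition mzero :: "nat \<Rightarrow> rmat" where
  "mzero n = (\<lambda>i\<in>{..<n}. \<lambda>j\<in>{..<n}. 0)"

definition outer :: "nat \<Rightarrow> rvec \<Rightarrow> rvec \<Rightarrow> rmat" where
  "outer n x y = (\<lambda>i\<in>{..<n}. \<lambda>j\<in>{..<n}. x i * y j)"

definition mtrace :: "nat \<Rightarrow> rmat \<Rightarrow> real" where
  "mtrace n A = (\<Sum>i<n. A i i)"

definition vsmul :: "nat \<Rightarrow> real \<Rightarrow> rvec \<Rightarrow> rvec" where
  "vsmul n a x = (\<lambda>i\<in>{..<n}. a * x i)"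

definition proj :: "nat \<Rightarrow> rmat \<Rightarrow> bool" where
  "proj n P \<longleftrightarrow> P \<in> mats n \<and> tr n P = P \<and> mm n P P = P"

section \<open>Algebra of matrices, vectors and traces\<close>

lemma vecs_eqI: "x \<in> vecs n \<Longrightarrow> y \<in> vecs n \<Longrightarrow> (\<And>i. i < n \<Longrightarrow> x i = y i) \<Longrightarrow> x = y"
  unfolding vecs_def by (rule PiE_ext) auto

lemma mats_eqI:
  assumes "A \<in> mats n" "B \<in> mats n" "\<And>i j. i < n \<Longrightarrow> j < n \<Longrightarrow> A i j = B i j"
  shows "A = B"
proof -
  have "A i = B i" if "i < n" for i
    using assms that by (intro vecs_eqI[of _ n]) (auto simp: mats_def)
  then show ?thesis using assms unfolding mats_def by (intro PiE_ext[of A "{..<n}" _ B]) auto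
qed

lemma mats_closed [simp]:
  "mm n A B \<in> mats n" "tr n A \<in> mats n" "idm n \<in> mats n" "madd n A B \<in> mats n"
  "msub n A B \<in> mats n" "mzero n \<in> mats n" "outer n x y \<in> mats n"
  by (auto simp: mats_def vecs_def mm_def tr_def idm_def madd_def msub_def mzero_def outer_def)

lemma vecs_closed [simp]: "mv n A x \<in> vecs n" "vsmul n a x \<in> vecs n"
  by (auto simp: vecs_def mv_def vsmul_def)

lemma mat_nth [simp]:
  assumes "i < n" "j < n"
  shows "mm n A B i j = (\<Sum>l<n. A i l * B l j)" "tr n A i j = A j i" "idm n i j = (if i = j then 1 else 0)"
    "madd n A B i j = A i j + B i j" "msub n A B i j = A i j - B i j" "mzero n i j = 0"
    "outer n x y i j = x i * y j"
  using assms by (auto simp: mm_def tr_def idm_def madd_def msub_def mzero_def outer_def)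

lemma mv_nth [simp]: "i < n \<Longrightarrow> mv n A x i = (\<Sum>j<n. A i j * x j)" "i < n \<Longrightarrow> vsmul n a x i = a * x i"
  by (auto simp: mv_def vsmul_def)

lemma mm_assoc: "mm n (mm n A B) C = mm n A (mm n B C)"
proof (rule mats_eqI[of _ n])
  fix i j assume ij: "i < n" "j < n"
  have "mm n (mm n A B) C i j = (\<Sum>l<n. \<Sum>m<n. A i m * B m l * C l j)"
    using ij by (simp add: sum_distrib_right)
  also have "\<dots> = (\<Sum>m<n. \<Sum>l<n. A i m * B m l * C l j)" by (rule sum.swap)
  also have "\<dots> = mm n A (mm n B C) i j"
    using ij by (simp add: sum_distrib_left mult.assoc)
  finally show "mm n (mm n A B) C i j = mm n A (mm n B C) i j" .
qed auto

lemma mv_mm: "mv n (mm n A B) x = mv n A (mv n B x)"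
proof (rule vecs_eqI[of _ n])
  fix i assume i: "i < n"
  have "mv n (mm n A B) x i = (\<Sum>l<n. \<Sum>m<n. A i m * B m l * x l)"
    using i by (simp add: sum_distrib_right)
  also have "\<dots> = (\<Sum>m<n. \<Sum>l<n. A i m * B m l * x l)" by (rule sum.swap)
  also have "\<dots> = mv n A (mv n B x) i"
    using i by (simp add: sum_distrib_left mult.assoc)
  finally show "mv n (mm n A B) x i = mv n A (mv n B x) i" .
qed auto

lemma tr_mm: "tr n (mm n A B) = mm n (tr n B) (tr n A)"
  by (rule mats_eqI[of _ n]) (auto simp: mult.commute)

lemma tr_tr: "A \<in> mats n \<Longrightarrow> tr n (tr n A) = A"
  by (rule mats_eqI[of _ n]) auto

lemma idm_mult [simp]: "A \<in> mats n \<Longrightarrow> mm n (idm n) A = A" "A \<in> mats n \<Longrightarrow> mm n A (idm n) = A"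
  "x \<in> vecs n \<Longrightarrow> mv n (idm n) x = x" "tr n (idm n) = idm n"
proof -
  show "A \<in> mats n \<Longrightarrow> mm n (idm n) A = A"
    by (rule mats_eqI[of _ n]) (auto simp: if_distrib[of "\<lambda>a. a * _"] sum.delta cong: if_cong)
  show "A \<in> mats n \<Longrightarrow> mm n A (idm n) = A"
    by (rule mats_eqI[of _ n]) (auto simp: if_distrib[of "\<lambda>a. _ * a"] sum.delta cong: if_cong)
  show "x \<in> vecs n \<Longrightarrow> mv n (idm n) x = x"
    by (rule vecs_eqI[of _ n]) (auto simp: if_distrib[of "\<lambda>a. a * _"] sum.delta cong: if_cong)
  show "tr n (idm n) = idm n" by (rule mats_eqI[of _ n]) auto
qed

lemma mm_distrib:
  "mm n (madd n A B) C = madd n (mm n A C) (mm n B C)" "mm n C (madd n A B) = madd n (mm n C A) (mm n C B)"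
  "mm n (msub n A B) C = msub n (mm n A C) (mm n B C)" "mm n C (msub n A B) = msub n (mm n C A) (mm n C B)"
  "tr n (madd n A B) = madd n (tr n A) (tr n B)" "tr n (msub n A B) = msub n (tr n A) (tr n B)"
  by - (rule mats_eqI[of _ n]; simp add: sum.distrib sum_subtractf algebra_simps)+

lemma mzero_simps [simp]:
  "mm n (mzero n) A = mzero n" "mm n A (mzero n) = mzero n" "tr n (mzero n) = mzero n"
  "A \<in> mats n \<Longrightarrow> madd n (mzero n) A = A" "A \<in> mats n \<Longrightarrow> madd n A (mzero n) = A"
  "A \<in> mats n \<Longrightarrow> msub n A (mzero n) = A" "msub n A A = mzero n"
  by - (rule mats_eqI[of _ n]; simp)+

lemma msub_eq_mzero: "A \<in> mats n \<Longrightarrow> B \<in> mats n \<Longrightarrow> msub n A B = mzero n \<Longrightarrow> A = B"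
proof (rule mats_eqI[of _ n])
  fix i j assume "msub n A B = mzero n" "i < n" "j < n"
  then show "A i j = B i j" using mat_nth(5)[of i n j A B] by simp
qed

lemma mm_outer: "mm n A (outer n x y) = outer n (mv n A x) y" "mm n (outer n x y) A = outer n x (mv n (tr n A) y)"
  "tr n (outer n x y) = outer n y x"
  by - (rule mats_eqI[of _ n]; simp add: sum_distrib_right sum_distrib_left algebra_simps)+

lemma mv_outer: "mv n (outer n x y) z = vsmul n (ip n y z) x"
  by (rule vecs_eqI[of _ n]) (auto simp: ip_def sum_distrib_left sum_distrib_right algebra_simps)

lemma outer_outer: "ip n y u = 1 \<Longrightarrow> mm n (outer n x y) (outer n u v) = outer n x v"
proof (rule mats_eqI[of _ n])
  fix i j assume a: "ip n y u = 1" and ij: "i < n" "j < n"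
  have "mm n (outer n x y) (outer n u v) i j = (\<Sum>l<n. (y l * u l) * (x i * v j))"
    using ij by (simp add: algebra_simps)
  also have "\<dots> = ip n y u * (x i * v j)" by (simp add: ip_def sum_distrib_right)
  finally show "mm n (outer n x y) (outer n u v) i j = outer n x v i j" using a ij by simp
qed auto

lemma ip_mv: "ip n (mv n A x) y = ip n x (mv n (tr n A) y)"
proof -
  have "ip n (mv n A x) y = (\<Sum>i<n. \<Sum>j<n. A i j * x j * y i)" by (simp add: ip_def sum_distrib_right)
  also have "\<dots> = (\<Sum>j<n. \<Sum>i<n. A i j * x j * y i)" by (rule sum.swap)
  also have "\<dots> = ip n x (mv n (tr n A) y)" by (simp add: ip_def sum_distrib_left algebra_simps)
  finally show ?thesis .
qed

lemma ip_vsmul [simp]: "ip n (vsmul n a x) y = a * ip n x y" "ip n x (vsmul n a y) = a * ip n x y"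
  by (auto simp: ip_def sum_distrib_left algebra_simps)

lemma mv_vsmul: "mv n A (vsmul n a x) = vsmul n a (mv n A x)"
  by (rule vecs_eqI[of _ n]) (auto simp: sum_distrib_left algebra_simps)

lemma ip_self: "0 \<le> ip n x x" "ip n x x = (nrm n x)\<^sup>2" "0 \<le> nrm n x"
proof -
  show "0 \<le> ip n x x" by (auto simp: ip_def intro: sum_nonneg)
  then show "ip n x x = (nrm n x)\<^sup>2" "0 \<le> nrm n x" by (auto simp: nrm_def)
qed

lemma ip_self_zero: "ip n x x = 0 \<Longrightarrow> i < n \<Longrightarrow> x i = 0"
  by (auto simp: ip_def sum_nonneg_eq_0_iff)

lemma mtrace_mm: "mtrace n (mm n A B) = mtrace n (mm n B A)"
proof -
  have "mtrace n (mm n A B) = (\<Sum>i<n. \<Sum>l<n. A i l * B l i)" by (simp add: mtrace_def)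
  also have "\<dots> = (\<Sum>l<n. \<Sum>i<n. A i l * B l i)" by (rule sum.swap)
  also have "\<dots> = mtrace n (mm n B A)" by (simp add: mtrace_def mult.commute)
  finally show ?thesis .
qed

lemma mtrace_simps [simp]: "mtrace n (madd n A B) = mtrace n A + mtrace n B"
  "mtrace n (msub n A B) = mtrace n A - mtrace n B" "mtrace n (idm n) = real n" "mtrace n (mzero n) = 0"
  "mtrace n (outer n x y) = ip n x y"
  by (auto simp: mtrace_def sum.distrib sum_subtractf ip_def)

section \<open>Orthogonal projections: trace, fixed vectors and equivalence\<close>

lemma grass_proj: "grass n k = {P. proj n P \<and> mtrace n P = real k}"
  by (auto simp: grass_def proj_def mtrace_def)

text \<open>For a symmetric idempotent matrix the trace is the sum of the squares of all
  entries.\<close>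

lemma proj_mtrace_0:
  assumes P: "proj n P" and t: "mtrace n P = 0"
  shows "P = mzero n"
proof (rule mats_eqI[of _ n])
  have sym: "P j i = P i j" if "i < n" "j < n" for i j
    using P mat_nth(2)[OF that, of P] that unfolding proj_def by metis
  have d: "P i i = (\<Sum>j<n. (P i j)\<^sup>2)" if i: "i < n" for i
  proof -
    have "P i i = mm n P P i i" using P by (simp add: proj_def)
    then show ?thesis using i sym by (simp add: power2_eq_square)
  qed
  then have "(\<Sum>i<n. \<Sum>j<n. (P i j)\<^sup>2) = 0" using t by (simp add: mtrace_def)
  then show "P i j = mzero n i j" if "i < n" "j < n" for i j
    using that by (auto simp: sum_nonneg_eq_0_iff sum_nonneg)
qed (use P in \<open>auto simp: proj_def\<close>)

lemma proj_mtrace_nonneg: "proj n P \<Longrightarrow> 0 \<le> mtrace n P"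
proof -
  assume "proj n P"
  then have "mtrace n P = mtrace n (mm n (tr n P) P)" by (simp add: proj_def)
  also have "\<dots> \<ge> 0" by (auto simp: mtrace_def intro!: sum_nonneg)
  finally show ?thesis .
qed

lemma proj_idm: "proj n (idm n)" by (simp add: proj_def)

lemma proj_msub: "proj n P \<Longrightarrow> proj n Q \<Longrightarrow> mm n P Q = Q \<Longrightarrow> mm n Q P = Q \<Longrightarrow> proj n (msub n P Q)"
  by (auto simp: proj_def mm_distrib)

lemma proj_outer: "ip n x x = 1 \<Longrightarrow> proj n (outer n x x)"
  by (simp add: proj_def mm_outer(3) outer_outer)

text \<open>A column of \<open>P\<close> through a nonzero diagonal entry is fixed by
  \<open>P\<close> because \<open>P\<close> is idempotent, and its squared norm is that diagonal
  entry; it remains to normalise.\<close>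

lemma proj_unit_vector:
  assumes P: "proj n P" and t: "mtrace n P \<noteq> 0"
  shows "\<exists>x\<in>vecs n. mv n P x = x \<and> ip n x x = 1"
proof -
  obtain i where i: "i < n" "P i i \<noteq> 0" using t by (auto simp: mtrace_def intro: sum.neutral)
  have sym: "P l j = P j l" if "l < n" "j < n" for l j
    using P mat_nth(2)[OF that, of P] that unfolding proj_def by metis
  define c where "c = (\<lambda>j\<in>{..<n}. P j i)"
  have idem: "mm n P P = P" using P by (simp add: proj_def)
  have Pc: "mv n P c = c"
  proof (rule vecs_eqI[of _ n])
    fix j assume "j < n" then show "mv n P c j = c j"
      using i fun_cong[OF fun_cong[OF idem], of j i] by (simp add: c_def)
  qed (auto simp: vecs_def c_def mv_def)
  have "ip n c c = P i i"
    using i fun_cong[OF fun_cong[OF idem], of i i] sym by (simp add: ip_def c_def)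
  then have c0: "ip n c c > 0" using i ip_self(1)[of n c] by simp
  show ?thesis
  proof (intro bexI conjI)
    show "mv n P (vsmul n (1 / nrm n c) c) = vsmul n (1 / nrm n c) c" by (simp add: mv_vsmul Pc)
    show "ip n (vsmul n (1 / nrm n c) c) (vsmul n (1 / nrm n c) c) = 1"
      using c0 by (simp add: nrm_def field_simps)
  qed auto
qed

text \<open>Murray--von Neumann equivalence of projections, witnessed by a partial isometry. It is additive over
  orthogonal sums, so orthogonal maps can be assembled from rank-one pieces without choosing bases.\<close>
definition mvn :: "nat \<Rightarrow> rmat \<Rightarrow> rmat \<Rightarrow> rmat \<Rightarrow> bool" where
  "mvn n W P Q \<longleftrightarrow> W \<in> mats n \<and> mm n (tr n W) W = P \<and> mm n W (tr n W) = Q \<and> mm n W P = W \<and> mm n Q W = W"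

text \<open>Kills the cross terms when partial isometries between mutually orthogonal projections
  are added.\<close>

lemma mm_annihilate:
  assumes "mm n V P = V" "mm n Q W = W" "mm n P Q = mzero n"
  shows "mm n V W = mzero n"
proof -
  have "mm n V W = mm n (mm n V P) (mm n Q W)" by (simp add: assms)
  also have "\<dots> = mm n V (mm n (mm n P Q) W)" by (simp only: mm_assoc)
  finally show ?thesis by (simp add: assms)
qed

lemma mvn_add:
  assumes W: "mvn n W P Q" and W': "mvn n W' P' Q'" and pr: "proj n P" "proj n Q" "proj n P'" "proj n Q'"
    and o: "mm n P P' = mzero n" "mm n Q Q' = mzero n"
  shows "mvn n (madd n W W') (madd n P P') (madd n Q Q')"
proof -
  have o': "mm n P' P = mzero n" "mm n Q' Q = mzero n"
    using arg_cong[OF o(1), of "tr n"] arg_cong[OF o(2), of "tr n"] pr by (simp_all add: tr_mm proj_def)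
  have d: "mm n W P = W" "mm n Q W = W" "mm n W' P' = W'" "mm n Q' W' = W'" using W W' by (auto simp: mvn_def)
  have t: "mm n P (tr n W) = tr n W" "mm n (tr n W) Q = tr n W" "mm n P' (tr n W') = tr n W'" "mm n (tr n W') Q' = tr n W'"
    using arg_cong[OF d(1), of "tr n"] arg_cong[OF d(2), of "tr n"] arg_cong[OF d(3), of "tr n"] arg_cong[OF d(4), of "tr n"] pr
    by (simp_all add: tr_mm proj_def)
  have i: "mm n P P = P" "mm n P' P' = P'" "mm n Q Q = Q" "mm n Q' Q' = Q'" using pr by (auto simp: proj_def)
  have z: "mm n (tr n W) W' = mzero n" "mm n (tr n W') W = mzero n" "mm n W (tr n W') = mzero n" "mm n W' (tr n W) = mzero n"
    "mm n W P' = mzero n" "mm n W' P = mzero n" "mm n Q W' = mzero n" "mm n Q' W = mzero n"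
    using mm_annihilate[OF t(2) d(4) o(2)] mm_annihilate[OF t(4) d(2) o'(2)] mm_annihilate[OF d(1) t(3) o(1)]
      mm_annihilate[OF d(3) t(1) o'(1)] mm_annihilate[OF d(1) i(2) o(1)] mm_annihilate[OF d(3) i(1) o'(1)]
      mm_annihilate[OF i(3) d(4) o(2)] mm_annihilate[OF i(4) d(2) o'(2)] by simp_all
  show ?thesis using W W' z unfolding mvn_def by (auto simp: mm_distrib)
qed

lemma mvn_outer: "ip n x x = 1 \<Longrightarrow> ip n y y = 1 \<Longrightarrow> mvn n (outer n y x) (outer n x x) (outer n y y)"
  by (simp add: mvn_def mm_outer(3) outer_outer)

text \<open>Peels the line of \<open>x\<close> off the range of \<open>P\<close>, lowering the trace
  by one; this drives the induction on rank and singles out the distinguished vector of a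
  flag.\<close>

lemma proj_split:
  assumes P: "proj n P" and x: "mv n P x = x" "ip n x x = 1"
  shows "proj n (msub n P (outer n x x))" "mtrace n (msub n P (outer n x x)) = mtrace n P - 1"
    "mm n (outer n x x) (msub n P (outer n x x)) = mzero n" "madd n (outer n x x) (msub n P (outer n x x)) = P"
proof -
  have t: "tr n P = P" "P \<in> mats n" using P by (auto simp: proj_def)
  have PO: "mm n P (outer n x x) = outer n x x" "mm n (outer n x x) P = outer n x x"
    by (simp_all add: mm_outer x t)
  show "proj n (msub n P (outer n x x))" by (rule proj_msub[OF P proj_outer[OF x(2)] PO])
  show "mtrace n (msub n P (outer n x x)) = mtrace n P - 1" by (simp add: x)
  show "mm n (outer n x x) (msub n P (outer n x x)) = mzero n" by (simp add: mm_distrib PO outer_outer x)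
  show "madd n (outer n x x) (msub n P (outer n x x)) = P"
    using t(2) by (intro mats_eqI[of _ n]) auto
qed

text \<open>The trace is the rank, so induction on it matches the ranges one unit vector at a time:
  \<open>outer n y x\<close> carries \<open>x\<close> to \<open>y\<close>, and the induction
  hypothesis handles the orthogonal remainders.\<close>

lemma mvn_exists:
  "proj n P \<Longrightarrow> proj n Q \<Longrightarrow> mtrace n P = real k \<Longrightarrow> mtrace n Q = real k \<Longrightarrow> \<exists>W. mvn n W P Q"
proof (induction k arbitrary: P Q)
  case 0
  then have "P = mzero n" "Q = mzero n" using proj_mtrace_0 by auto
  then have "mvn n (mzero n) P Q" by (simp add: mvn_def)
  then show ?case by blast
next
  case (Suc k)
  obtain x where x: "mv n P x = x" "ip n x x = 1" using proj_unit_vector[OF Suc.prems(1)] Suc.prems by auto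
  obtain y where y: "mv n Q y = y" "ip n y y = 1" using proj_unit_vector[OF Suc.prems(2)] Suc.prems by auto
  note X = proj_split[OF Suc.prems(1) x] and Y = proj_split[OF Suc.prems(2) y]
  obtain W where W: "mvn n W (msub n P (outer n x x)) (msub n Q (outer n y y))"
    using Suc.IH[OF X(1) Y(1)] X(2) Y(2) Suc.prems by auto
  have "mvn n (madd n (outer n y x) W) P Q"
    using mvn_add[OF mvn_outer[OF x(2) y(2)] W proj_outer[OF x(2)] proj_outer[OF y(2)] X(1) Y(1) X(3) Y(3)] X(4) Y(4) by simp
  then show ?case by blast
qed

text \<open>A left inverse is a right inverse by counting traces: \<open>U U^T\<close> is a
  projection of trace \<open>n\<close>, so its complement is a projection of trace 0.\<close>

lemma orth_right: "U \<in> orth n \<Longrightarrow> mm n U (tr n U) = idm n"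
proof -
  assume U: "U \<in> orth n"
  then have U': "U \<in> mats n" "mm n (tr n U) U = idm n" by (auto simp: orth_def)
  have "mm n (mm n U (tr n U)) (mm n U (tr n U)) = mm n U (mm n (mm n (tr n U) U) (tr n U))"
    by (simp only: mm_assoc)
  then have p: "proj n (mm n U (tr n U))" using U' by (simp add: proj_def tr_mm tr_tr)
  have "proj n (msub n (idm n) (mm n U (tr n U)))" using p by (intro proj_msub proj_idm) auto
  moreover have "mtrace n (msub n (idm n) (mm n U (tr n U))) = 0"
    by (simp add: mtrace_mm[of n U] U')
  ultimately have "msub n (idm n) (mm n U (tr n U)) = mzero n" by (rule proj_mtrace_0)
  from msub_eq_mzero[OF mats_closed(3) mats_closed(1) this] show "mm n U (tr n U) = idm n" by (rule sym)
qed

lemma orth_ip: "U \<in> orth n \<Longrightarrow> ip n (mv n U x) (mv n U y) = ip n x y"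
proof -
  assume U: "U \<in> orth n"
  have "ip n (mv n U x) (mv n U y) = ip n x (mv n (mm n (tr n U) U) y)" by (simp add: ip_mv mv_mm)
  also have "\<dots> = ip n x (mv n (idm n) y)" using U by (simp add: orth_def)
  also have "\<dots> = ip n x y"
    by (simp add: ip_def if_distrib[of "\<lambda>a. a * _"] sum.delta cong: if_cong)
  finally show ?thesis .
qed

text \<open>\<open>U\<close> is the sum of three partial isometries with orthogonal sources and
  orthogonal targets: the line of \<open>x\<close> to that of \<open>y\<close>, the rest of
  \<open>P\<close> to the rest of \<open>Q\<close>, and complement to complement. Taking
  \<open>P = Q\<close> gives transitivity on the unit sphere of one subspace by maps preserving that
  subspace.\<close>

lemma orth_transitive_flags:
  assumes P: "P \<in> grass n k" and Q: "Q \<in> grass n k"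
    and x: "mv n P x = x" "ip n x x = 1" and y: "mv n Q y = y" "ip n y y = 1"
  shows "\<exists>U\<in>orth n. mv n U x = y \<and> mm n (mm n U P) (tr n U) = Q"
proof -
  have p: "proj n P" "proj n Q" and t: "mtrace n P = real k" "mtrace n Q = real k" using P Q by (auto simp: grass_proj)
  note X = proj_split[OF p(1) x] and Y = proj_split[OF p(2) y]
  have k: "k \<ge> 1" using proj_mtrace_nonneg[OF X(1)] X(2) t by simp
  obtain W where W: "mvn n W (msub n P (outer n x x)) (msub n Q (outer n y y))"
    using mvn_exists[OF X(1) Y(1), of "k - 1"] X(2) Y(2) t k by (auto simp: of_nat_diff)
  have c: "proj n (msub n (idm n) P)" "proj n (msub n (idm n) Q)"
    by (rule proj_msub[OF proj_idm]; use p in \<open>simp add: proj_def\<close>)+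
  have kn: "k \<le> n" using proj_mtrace_nonneg[OF c(1)] t by simp
  obtain V where V: "mvn n V (msub n (idm n) P) (msub n (idm n) Q)"
    using mvn_exists[OF c, of "n - k"] t kn by (auto simp: of_nat_diff)
  define W1 where "W1 = madd n (outer n y x) W"
  have W1: "mvn n W1 P Q" unfolding W1_def
    using mvn_add[OF mvn_outer[OF x(2) y(2)] W proj_outer[OF x(2)] proj_outer[OF y(2)] X(1) Y(1) X(3) Y(3)] X(4) Y(4) by simp
  have pq: "mm n P (msub n (idm n) P) = mzero n" "mm n Q (msub n (idm n) Q) = mzero n"
    using p by (auto simp: mm_distrib proj_def)
  have s: "madd n P (msub n (idm n) P) = idm n" "madd n Q (msub n (idm n) Q) = idm n"
    by - (rule mats_eqI[of _ n]; simp)+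
  define U where "U = madd n W1 V"
  have U: "mvn n U (idm n) (idm n)" unfolding U_def using mvn_add[OF W1 V p c pq] s by simp
  have orthU: "U \<in> orth n" using U by (auto simp: mvn_def orth_def)
  have VP: "mm n V P = mzero n"
  proof -
    have "mm n V P = mm n V (mm n (msub n (idm n) P) P)" using V by (simp add: mvn_def mm_assoc[symmetric])
    then show ?thesis using p by (simp add: mm_distrib proj_def)
  qed
  have UP: "mm n U P = W1" unfolding U_def using W1 VP by (auto simp: mm_distrib mvn_def)
  have Wx: "mm n W (outer n x x) = mzero n"
  proof -
    have "mm n W (outer n x x) = mm n (mm n W (msub n P (outer n x x))) (outer n x x)" using W by (simp add: mvn_def)
    also have "\<dots> = mm n W (mm n (msub n P (outer n x x)) (outer n x x))" by (simp add: mm_assoc)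
    also have "mm n (msub n P (outer n x x)) (outer n x x) = mzero n"
      using arg_cong[OF X(3), of "tr n"] X(1) by (simp add: tr_mm mm_outer(3) proj_def)
    finally show ?thesis by simp
  qed
  \<comment> \<open>The image of \<open>x\<close> is read off from a matrix identity: applying both
    sides to the unit vector \<open>x\<close> isolates \<open>mv n U x\<close> and
    \<open>y\<close>.\<close>
  have "outer n (mv n U x) x = outer n y x"
  proof -
    have "mm n P (outer n x x) = outer n x x" by (simp add: mm_outer x)
    then have "mm n U (outer n x x) = mm n (mm n U P) (outer n x x)" by (simp add: mm_assoc)
    also have "\<dots> = outer n y x" by (simp add: UP W1_def mm_distrib Wx outer_outer x)
    finally show ?thesis by (simp add: mm_outer)
  qed
  then have "mv n (outer n (mv n U x) x) x = mv n (outer n y x) x" by simp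
  then have "mv n U x = y"
  proof -
    assume "mv n (outer n (mv n U x) x) x = mv n (outer n y x) x"
    then have e: "vsmul n 1 (mv n U x) = vsmul n 1 y" by (simp add: mv_outer x)
    have yv: "y \<in> vecs n" using vecs_closed(1)[of n Q y] y by simp
    show ?thesis
      by (rule vecs_eqI[OF vecs_closed(1) yv]) (metis e mv_nth(2) mult_1)
  qed
  moreover have "mm n (mm n U P) (tr n U) = Q"
  proof -
    have "mm n (mm n U P) (tr n U) = mm n (mm n U P) (tr n (mm n U P))"
    proof -
      have "mm n (mm n U P) (tr n (mm n U P)) = mm n U (mm n (mm n P P) (tr n U))"
      proof -
        have PP: "mm n P (mm n P X) = mm n P X" for X
          using p by (simp add: mm_assoc[symmetric] proj_def)
        show ?thesis using p by (simp add: tr_mm mm_assoc proj_def PP)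
      qed
      moreover have "mm n U (mm n (mm n P P) (tr n U)) = mm n (mm n U P) (tr n U)"
        using p by (simp add: mm_assoc[symmetric] proj_def)
      ultimately show ?thesis by simp
    qed
    then show ?thesis using W1 by (simp add: UP mvn_def)
  qed
  ultimately show ?thesis using orthU by blast
qed

section \<open>Gaussian measures\<close>

abbreviation "stdn \<equiv> (density lborel (\<lambda>x. ennreal (std_normal_density x)) :: real measure)"

definition gm :: "nat \<Rightarrow> rvec measure" where
  "gm n = PiM {..<n} (\<lambda>_. stdn)"

lemma prob_stdn: "prob_space stdn" by (rule prob_space_normal_density) simp

lemma sets_gm [measurable_cong]: "sets (gm n) = sets (vecM n)"
  unfolding gm_def vecM_def by (intro sets_PiM_cong) auto

lemma space_vecM [simp]: "space (vecM n) = vecs n"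
  by (simp add: vecM_def space_PiM vecs_def)

lemma space_gm [simp]: "space (gm n) = vecs n"
  using sets_eq_imp_space_eq[OF sets_gm] by simp

lemma prob_gm: "prob_space (gm n)"
  unfolding gm_def by (intro prob_space_PiM prob_stdn)

lemma measurable_vecM_component [measurable]: "i < n \<Longrightarrow> (\<lambda>x. x i) \<in> borel_measurable (vecM n)"
  unfolding vecM_def by measurable

lemma measurable_vecM_I:
  assumes "\<And>x. x \<in> space M \<Longrightarrow> f x \<in> vecs n" "\<And>i. i < n \<Longrightarrow> (\<lambda>x. f x i) \<in> borel_measurable M"
  shows "f \<in> M \<rightarrow>\<^sub>M vecM n"
proof -
  have "(\<lambda>x. \<lambda>i\<in>{..<n}. f x i) \<in> M \<rightarrow>\<^sub>M vecM n"
    unfolding vecM_def by (rule measurable_restrict) (use assms in auto)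
  moreover have "(\<lambda>i\<in>{..<n}. f x i) = f x" if "x \<in> space M" for x
    using assms(1)[OF that] by (auto simp: vecs_def fun_eq_iff PiE_def extensional_def)
  ultimately show ?thesis by (simp cong: measurable_cong)
qed

lemma coords_vecM: "coords {..<n} (\<lambda>x j. x j) (vecM n)"
proof (rule coordsI[where g="\<lambda>x. x"])
  show "(\<lambda>x. x) \<in> PiM {..<n} (\<lambda>_. borel) \<rightarrow>\<^sub>M vecM n" by (simp add: vecM_def)
  show "(\<lambda>j\<in>{..<n}. x j) = x" if "x \<in> space (vecM n)" for x
    using that by (auto simp: vecs_def fun_eq_iff PiE_def extensional_def)
qed auto

lemma nn_integral_gm_prod:
  assumes "\<And>i. i < n \<Longrightarrow> f i \<in> borel_measurable borel"
  shows "(\<integral>\<^sup>+x. (\<Prod>i<n. f i (x i)) \<partial>gm n) = (\<Prod>i<n. \<integral>\<^sup>+t. f i t \<partial>stdn)"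
proof -
  interpret product_sigma_finite "\<lambda>_::nat. stdn"
    by (intro product_sigma_finite.intro) (rule prob_space_imp_sigma_finite[OF prob_stdn])
  show ?thesis unfolding gm_def by (rule product_nn_integral_prod) (use assms in auto)
qed

text \<open>By symmetry of the kernel this is the density at \<open>z\<close> of the sum of two
  independent centred normals, with variances \<open>\<sigma>\<^sup>2\<close> and 1.\<close>

lemma stdn_kernel:
  assumes "\<sigma> > 0"
  shows "(\<integral>\<^sup>+t. ennreal (normal_density z \<sigma> t) \<partial>stdn) = ennreal (normal_density 0 (sqrt (\<sigma>\<^sup>2 + 1)) z)"
proof -
  have "(\<integral>\<^sup>+t. ennreal (normal_density z \<sigma> t) \<partial>stdn) = (\<integral>\<^sup>+t. ennreal (std_normal_density t) * ennreal (normal_density z \<sigma> t) \<partial>lborel)"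
    by (rule nn_integral_density) auto
  also have "\<dots> = (\<integral>\<^sup>+t. ennreal (normal_density 0 \<sigma> (z - t) * normal_density 0 1 t) \<partial>lborel)"
  proof (rule nn_integral_cong)
    fix t
    have "normal_density z \<sigma> t = normal_density 0 \<sigma> (z - t)"
      by (simp add: normal_density_def power2_commute)
    then show "ennreal (std_normal_density t) * ennreal (normal_density z \<sigma> t) = ennreal (normal_density 0 \<sigma> (z - t) * normal_density 0 1 t)"
      by (simp add: ennreal_mult'[symmetric] mult.commute)
  qed
  also have "\<dots> = ennreal (normal_density 0 (sqrt (\<sigma>\<^sup>2 + 1\<^sup>2)) z)"
    using fun_cong[OF conv_normal_density_zero_mean[OF assms zero_less_one], of z] .
  finally show ?thesis by simp
qed

lemma prod_normal_density:
  "finite J \<Longrightarrow> (\<Prod>j\<in>J. normal_density (z j) \<sigma> (y j)) = (1 / sqrt (2 * pi * \<sigma>\<^sup>2)) ^ card J * exp (- (\<Sum>j\<in>J. (z j - y j)\<^sup>2) / (2 * \<sigma>\<^sup>2))"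
  by (simp add: normal_density_def prod_dividef exp_sum[symmetric] sum_negf sum_divide_distrib[symmetric]
      power2_commute[of "y _"] power_divide)

text \<open>The transform of a standard Gaussian against Gaussian kernels depends on the centre only through its norm,
  which is what makes isometries preserve it.\<close>
lemma gaussian_isometry:
  fixes J :: "'j set" and c :: "'a \<Rightarrow> 'j \<Rightarrow> real"
  assumes c: "coords J c N" and s: "sets \<mu> = sets N" and p: "prob_space \<mu>" and T: "T \<in> N \<rightarrow>\<^sub>M N"
    and iso: "\<And>z x. x \<in> space N \<Longrightarrow> (\<Sum>j\<in>J. (z j - c (T x) j)\<^sup>2) = (\<Sum>j\<in>J. (T' z j - c x j)\<^sup>2)"
    and iso': "\<And>z. (\<Sum>j\<in>J. (T' z j)\<^sup>2) = (\<Sum>j\<in>J. (z j)\<^sup>2)"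
    and ker: "\<And>\<sigma> z. \<sigma> > 0 \<Longrightarrow> (\<integral>\<^sup>+x. (\<Prod>j\<in>J. ennreal (normal_density (z j) \<sigma> (c x j))) \<partial>\<mu>)
               = (\<Prod>j\<in>J. ennreal (normal_density 0 (sqrt (\<sigma>\<^sup>2 + 1)) (z j)))"
  shows "distr \<mu> N T = \<mu>"
proof (rule gauss_kernel_eqI[OF c _ s _ p])
  have J: "finite J" and cm: "\<And>j. j \<in> J \<Longrightarrow> (\<lambda>x. c x j) \<in> borel_measurable N"
    using c unfolding coords_def by auto
  have T': "T \<in> \<mu> \<rightarrow>\<^sub>M N" using T s by (simp cong: measurable_cong_sets)
  then show "prob_space (distr \<mu> N T)" by (rule prob_space.prob_space_distr[OF p])
  have sp: "space \<mu> = space N" using s by (rule sets_eq_imp_space_eq)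
  fix \<sigma> :: real and z assume \<sigma>: "\<sigma> > 0"
  have "(\<integral>\<^sup>+x. (\<Prod>j\<in>J. ennreal (normal_density (z j) \<sigma> (c x j))) \<partial>distr \<mu> N T)
      = (\<integral>\<^sup>+x. (\<Prod>j\<in>J. ennreal (normal_density (z j) \<sigma> (c (T x) j))) \<partial>\<mu>)"
    by (rule nn_integral_distr[OF T'])
      (auto intro!: borel_measurable_prod_ennreal measurable_compose[OF cm] simp: normal_density_def)
  also have "\<dots> = (\<integral>\<^sup>+x. (\<Prod>j\<in>J. ennreal (normal_density (T' z j) \<sigma> (c x j))) \<partial>\<mu>)"
    by (rule nn_integral_cong) (simp add: prod_ennreal prod_normal_density[OF J] iso sp)
  also have "\<dots> = (\<Prod>j\<in>J. ennreal (normal_density 0 (sqrt (\<sigma>\<^sup>2 + 1)) (T' z j)))" by (rule ker[OF \<sigma>])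
  also have "\<dots> = (\<Prod>j\<in>J. ennreal (normal_density 0 (sqrt (\<sigma>\<^sup>2 + 1)) (z j)))"
    by (simp add: prod_ennreal prod_normal_density[OF J, of "\<lambda>_. 0"] iso')
  also have "\<dots> = (\<integral>\<^sup>+x. (\<Prod>j\<in>J. ennreal (normal_density (z j) \<sigma> (c x j))) \<partial>\<mu>)" by (rule ker[OF \<sigma>, symmetric])
  finally show "(\<integral>\<^sup>+x. (\<Prod>j\<in>J. ennreal (normal_density (z j) \<sigma> (c x j))) \<partial>distr \<mu> N T)
     = (\<integral>\<^sup>+x. (\<Prod>j\<in>J. ennreal (normal_density (z j) \<sigma> (c x j))) \<partial>\<mu>)" .
qed simp

lemma gm_kernel:
  assumes "\<sigma> > 0"
  shows "(\<integral>\<^sup>+x. (\<Prod>j<n. ennreal (normal_density (z j) \<sigma> (x j))) \<partial>gm n)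
     = (\<Prod>j<n. ennreal (normal_density 0 (sqrt (\<sigma>\<^sup>2 + 1)) (z j)))"
  using assms by (subst nn_integral_gm_prod) (auto simp: stdn_kernel)

lemma measurable_mv [measurable]: "mv n U \<in> vecM n \<rightarrow>\<^sub>M vecM n"
  by (rule measurable_vecM_I) auto

lemma ip_sum: "ip n x x = (\<Sum>j<n. (x j)\<^sup>2)" by (simp add: ip_def power2_eq_square)

lemma gm_orth:
  assumes U: "U \<in> orth n"
  shows "distr (gm n) (vecM n) (mv n U) = gm n"
\<comment> \<open>\<open>T'\<close> moves the isometry to the other argument: |z - U x| = |U^T z -
  x|.\<close>
proof (rule gaussian_isometry[OF coords_vecM sets_gm prob_gm measurable_mv, where T'="\<lambda>z. mv n (tr n U) z"])
  have Um: "U \<in> mats n" using U by (simp add: orth_def)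
  have trU: "tr n U \<in> orth n" using orth_right[OF U] Um by (simp add: orth_def tr_tr)
  fix z :: "nat \<Rightarrow> real"
  show "(\<Sum>j<n. (mv n (tr n U) z j)\<^sup>2) = (\<Sum>j<n. (z j)\<^sup>2)"
    using orth_ip[OF trU, of z z] by (simp only: ip_sum)
  fix x assume "x \<in> space (vecM n)"
  have e: "(\<Sum>j<n. (u j - v j)\<^sup>2) = ip n u u - 2 * ip n u v + ip n v v" for u v
    by (simp add: ip_def power2_eq_square algebra_simps sum.distrib sum_subtractf sum_distrib_left)
  show "(\<Sum>j<n. (z j - mv n U x j)\<^sup>2) = (\<Sum>j<n. (mv n (tr n U) z j - x j)\<^sup>2)"
    unfolding e orth_ip[OF U] orth_ip[OF trU] by (simp add: ip_mv[of n "tr n U"] tr_tr[OF Um])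
qed (rule gm_kernel)

lemma gm_orth': "U \<in> orth n \<Longrightarrow> distr (gm n) (gm n) (mv n U) = gm n"
proof -
  assume U: "U \<in> orth n"
  have "distr (gm n) (gm n) (mv n U) = distr (gm n) (vecM n) (mv n U)" by (rule distr_cong) (auto simp: sets_gm)
  then show ?thesis by (simp add: gm_orth[OF U])
qed

lemma measurable_gm_I: "f \<in> vecM n \<rightarrow>\<^sub>M N \<Longrightarrow> f \<in> gm n \<rightarrow>\<^sub>M N"
  by (simp add: measurable_cong_sets[OF sets_gm refl])

text \<open>The arc of the Maurey--Pisier argument: the first component runs from the first vector
  at angle 0 to the second at angle pi/2, and the second component is its derivative in the
  angle.\<close>

definition rot :: "nat \<Rightarrow> real \<Rightarrow> rvec \<times> rvec \<Rightarrow> rvec \<times> rvec" where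
  "rot n \<phi> p = ((\<lambda>i\<in>{..<n}. cos \<phi> * fst p i + sin \<phi> * snd p i), (\<lambda>i\<in>{..<n}. cos \<phi> * snd p i - sin \<phi> * fst p i))"

lemma coords_pair: "coords ({..<n} \<times> UNIV) (\<lambda>p (i, b). if b then fst p i else snd p i) (vecM n \<Otimes>\<^sub>M vecM n)"
proof (rule coordsI[where g="\<lambda>z. (\<lambda>i\<in>{..<n}. z (i, True), \<lambda>i\<in>{..<n}. z (i, False))"])
  show "(\<lambda>z. (\<lambda>i\<in>{..<n}. z (i, True), \<lambda>i\<in>{..<n}. z (i, False))) \<in> PiM ({..<n} \<times> UNIV) (\<lambda>_. borel) \<rightarrow>\<^sub>M vecM n \<Otimes>\<^sub>M vecM n"
    unfolding vecM_def by (intro measurable_Pair measurable_restrict measurable_component_singleton) auto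
  fix p assume "p \<in> space (vecM n \<Otimes>\<^sub>M vecM n)"
  then have "fst p \<in> vecs n" "snd p \<in> vecs n" by (auto simp: space_pair_measure)
  then show "(\<lambda>i\<in>{..<n}. (\<lambda>j\<in>{..<n} \<times> UNIV. case j of (i, b) \<Rightarrow> if b then fst p i else snd p i) (i, True),
      \<lambda>i\<in>{..<n}. (\<lambda>j\<in>{..<n} \<times> UNIV. case j of (i, b) \<Rightarrow> if b then fst p i else snd p i) (i, False)) = p"
    by (auto simp: vecs_def fun_eq_iff PiE_def extensional_def prod_eq_iff)
qed (auto split: prod.split intro!: measurable_compose[OF measurable_fst] measurable_compose[OF measurable_snd])

lemma measurable_rot: "rot n \<phi> \<in> vecM n \<Otimes>\<^sub>M vecM n \<rightarrow>\<^sub>M vecM n \<Otimes>\<^sub>M vecM n"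
  unfolding rot_def
  by (intro measurable_Pair measurable_vecM_I)
    (auto simp: vecs_def intro!: borel_measurable_add borel_measurable_diff borel_measurable_times measurable_compose[OF measurable_fst] measurable_compose[OF measurable_snd])

lemma sum_pair_bool: "(\<Sum>j\<in>{..<n} \<times> UNIV. f j) = (\<Sum>i<n. f (i, True) + f (i, False) :: real)"
proof -
  have "(\<Sum>j\<in>{..<n} \<times> UNIV. f j) = (\<Sum>i<n. \<Sum>b\<in>UNIV. f (i, b))"
    by (subst sum.cartesian_product) simp
  then show ?thesis by (simp add: UNIV_bool add.commute)
qed

lemma prod_pair_bool: "(\<Prod>j\<in>{..<n} \<times> UNIV. f j) = (\<Prod>i<n. f (i, True)) * (\<Prod>i<n. f (i, False) :: ennreal)"
proof -
  have "(\<Prod>j\<in>{..<n} \<times> UNIV. f j) = (\<Prod>i<n. \<Prod>b\<in>UNIV. f (i, b))"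
    by (subst prod.cartesian_product) simp
  then show ?thesis by (simp add: UNIV_bool prod.distrib mult.commute)
qed

abbreviation gm2 :: "nat \<Rightarrow> (rvec \<times> rvec) measure" where "gm2 n \<equiv> gm n \<Otimes>\<^sub>M gm n"

abbreviation vecM2 :: "nat \<Rightarrow> (rvec \<times> rvec) measure" where "vecM2 n \<equiv> vecM n \<Otimes>\<^sub>M vecM n"

lemma gm_rot: "distr (gm2 n) (vecM2 n) (rot n \<phi>) = gm2 n"
proof (rule gaussian_isometry[OF coords_pair _ _ measurable_rot, where
      T'="\<lambda>z (i, b). if b then cos \<phi> * z (i, True) - sin \<phi> * z (i, False) else cos \<phi> * z (i, False) + sin \<phi> * z (i, True)"])
  interpret gm: prob_space "gm n" by (rule prob_gm)
  interpret pair_prob_space "gm n" "gm n" ..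
  show "prob_space (gm2 n)" by (rule prob_space_axioms)
  show "sets (gm2 n) = sets (vecM2 n)" by (intro sets_pair_measure_cong sets_gm)
  define s c where sc: "s = sin \<phi>" "c = cos \<phi>"
  have c2: "c\<^sup>2 = 1 - s\<^sup>2" by (simp add: sc cos_squared_eq)
  fix z :: "nat \<times> bool \<Rightarrow> real"
  show "(\<Sum>j\<in>{..<n} \<times> UNIV. ((case j of (i, b) \<Rightarrow> if b then cos \<phi> * z (i, True) - sin \<phi> * z (i, False) else cos \<phi> * z (i, False) + sin \<phi> * z (i, True)))\<^sup>2)
      = (\<Sum>j\<in>{..<n} \<times> UNIV. (z j)\<^sup>2)"
    unfolding sum_pair_bool sc[symmetric]
  proof (intro sum.cong refl, simp)
    fix i show "(c * z (i, True) - s * z (i, False))\<^sup>2 + (c * z (i, False) + s * z (i, True))\<^sup>2 = (z (i, True))\<^sup>2 + (z (i, False))\<^sup>2"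
      using c2 by algebra
  qed
  fix x
  show "(\<Sum>j\<in>{..<n} \<times> UNIV. (z j - (case j of (i, b) \<Rightarrow> if b then fst (rot n \<phi> x) i else snd (rot n \<phi> x) i))\<^sup>2)
      = (\<Sum>j\<in>{..<n} \<times> UNIV. ((case j of (i, b) \<Rightarrow> if b then cos \<phi> * z (i, True) - sin \<phi> * z (i, False) else cos \<phi> * z (i, False) + sin \<phi> * z (i, True))
          - (case j of (i, b) \<Rightarrow> if b then fst x i else snd x i))\<^sup>2)"
    unfolding sum_pair_bool sc[symmetric]
  proof (intro sum.cong refl, simp add: rot_def sc[symmetric])
    fix i show "(z (i, True) - (c * fst x i + s * snd x i))\<^sup>2 + (z (i, False) - (c * snd x i - s * fst x i))\<^sup>2
      = (c * z (i, True) - s * z (i, False) - fst x i)\<^sup>2 + (c * z (i, False) + s * z (i, True) - snd x i)\<^sup>2"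
      using c2 by algebra
  qed
next
  fix \<sigma> :: real and z :: "nat \<times> bool \<Rightarrow> real" assume \<sigma>: "\<sigma> > 0"
  interpret gm: prob_space "gm n" by (rule prob_gm)
  interpret pair_prob_space "gm n" "gm n" ..
  have m[measurable]: "(\<lambda>x. \<Prod>i<n. ennreal (normal_density (w i) \<sigma> (x i))) \<in> borel_measurable (gm n)" for w
    by (intro borel_measurable_prod_ennreal) (unfold normal_density_def, measurable)
  have "(\<integral>\<^sup>+x. (\<Prod>j\<in>{..<n} \<times> UNIV. ennreal (normal_density (z j) \<sigma> (case j of (i, b) \<Rightarrow> if b then fst x i else snd x i))) \<partial>gm2 n)
     = (\<integral>\<^sup>+p. (\<Prod>i<n. ennreal (normal_density (z (i, True)) \<sigma> (fst p i))) * (\<Prod>i<n. ennreal (normal_density (z (i, False)) \<sigma> (snd p i))) \<partial>gm2 n)"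
    unfolding prod_pair_bool by simp
  also have "\<dots> = (\<integral>\<^sup>+x. \<integral>\<^sup>+y. (\<Prod>i<n. ennreal (normal_density (z (i, True)) \<sigma> (x i))) * (\<Prod>i<n. ennreal (normal_density (z (i, False)) \<sigma> (y i))) \<partial>gm n \<partial>gm n)"
    by (subst gm.nn_integral_fst[symmetric]) (auto intro!: borel_measurable_times_ennreal measurable_compose[OF measurable_fst m] measurable_compose[OF measurable_snd m])
  also have "\<dots> = (\<Prod>j\<in>{..<n} \<times> UNIV. ennreal (normal_density 0 (sqrt (\<sigma>\<^sup>2 + 1)) (z j)))"
    unfolding prod_pair_bool using \<sigma> by (simp add: nn_integral_cmult nn_integral_multc gm_kernel)
  finally show "(\<integral>\<^sup>+x. (\<Prod>j\<in>{..<n} \<times> UNIV. ennreal (normal_density (z j) \<sigma> (case j of (i, b) \<Rightarrow> if b then fst x i else snd x i))) \<partial>gm2 n)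
     = (\<Prod>j\<in>{..<n} \<times> UNIV. ennreal (normal_density 0 (sqrt (\<sigma>\<^sup>2 + 1)) (z j)))" .
qed

section \<open>Gaussian concentration of the support function\<close>

lemma nrm_L2_set: "nrm n x = L2_set x {..<n}"
  by (simp add: nrm_def ip_def L2_set_def power2_eq_square)

lemma ip_le_nrm: "\<bar>ip n x y\<bar> \<le> nrm n x * nrm n y"
proof -
  have "\<bar>ip n x y\<bar> \<le> (\<Sum>i<n. \<bar>x i\<bar> * \<bar>y i\<bar>)"
    unfolding ip_def by (rule order_trans[OF sum_abs]) (simp add: abs_mult)
  also have "\<dots> \<le> nrm n x * nrm n y" unfolding nrm_L2_set by (rule L2_set_mult_ineq)
  finally show ?thesis .
qed

lemma nrm_le_sum: "nrm n x \<le> (\<Sum>i<n. \<bar>x i\<bar>)"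
  unfolding nrm_L2_set by (rule L2_set_le_sum_abs)

lemma sum_le_nrm: "(\<Sum>i<n. \<bar>x i\<bar>) \<le> sqrt (real n) * nrm n x"
  using L2_set_mult_ineq[of "\<lambda>_. 1" x "{..<n}"] by (simp add: nrm_L2_set L2_set_def)

lemma measurable_nrm [measurable]: "nrm n \<in> borel_measurable (vecM n)"
  unfolding nrm_def ip_def by measurable

lemma measurable_ip [measurable]: "ip n x \<in> borel_measurable (vecM n)"
  unfolding ip_def by measurable

lemma continuous_ip: "continuous_on S (\<lambda>x. ip n x y)"
  unfolding ip_def
  by (intro continuous_intros continuous_on_subset[OF continuous_on_product_coordinates]) auto

lemma continuous_nrm: "continuous_on S (nrm n)"
  unfolding nrm_def ip_def
  by (intro continuous_intros continuous_on_subset[OF continuous_on_product_coordinates]) auto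

lemma gm_component: "i < n \<Longrightarrow> distr (gm n) stdn (\<lambda>x. x i) = stdn"
  unfolding gm_def by (rule distr_PiM_component) (auto intro: prob_stdn)

lemma integrable_gm_abs: "i < n \<Longrightarrow> integrable (gm n) (\<lambda>x. \<bar>x i\<bar>)"
  and integral_gm_abs: "i < n \<Longrightarrow> (\<integral>x. \<bar>x i\<bar> \<partial>gm n) = sqrt (2 / pi)"
proof -
  have hb: "has_bochner_integral lborel (\<lambda>t. std_normal_density t * \<bar>t\<bar>) (sqrt (2 / pi))"
    using std_normal_moment_abs_odd[of 0] by simp
  have i: "integrable stdn (\<lambda>t. \<bar>t\<bar>)"
    using hb by (subst integrable_density) (auto simp: has_bochner_integral_iff)
  have v: "(\<integral>t. \<bar>t\<bar> \<partial>stdn) = sqrt (2 / pi)"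
    using hb by (subst integral_density) (auto simp: has_bochner_integral_iff)
  assume n: "i < n"
  have m: "(\<lambda>x. x i) \<in> gm n \<rightarrow>\<^sub>M stdn"
    using measurable_gm_I[OF measurable_vecM_component[OF n]] by simp
  show "integrable (gm n) (\<lambda>x. \<bar>x i\<bar>)"
    using i gm_component[OF n] integrable_distr[OF m, of "\<lambda>t. \<bar>t\<bar>"] by simp
  show "(\<integral>x. \<bar>x i\<bar> \<partial>gm n) = sqrt (2 / pi)"
    using v gm_component[OF n] integral_distr[OF m, of "\<lambda>t. \<bar>t\<bar>"] by simp
qed

lemma integrable_gm_nrm: "integrable (gm n) (nrm n)"
proof (rule Bochner_Integration.integrable_bound)
  show "integrable (gm n) (\<lambda>x. \<Sum>i<n. \<bar>x i\<bar>)" by (intro Bochner_Integration.integrable_sum integrable_gm_abs) simp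
  show "AE x in gm n. norm (nrm n x) \<le> norm (\<Sum>i<n. \<bar>x i\<bar>)"
    using nrm_le_sum[of n] ip_self(3)[of n] by (intro AE_I2) (simp add: sum_nonneg)
  show "nrm n \<in> borel_measurable (gm n)" by measurable
qed

text \<open>Cauchy--Schwarz bounds the sum of the |x_i| by sqrt n times the norm, and each
  coordinate has mean absolute value sqrt(2/pi). This lower bound brings the dimension into the
  final exponent.\<close>

lemma integral_gm_nrm_ge:
  assumes "n \<ge> 1"
  shows "sqrt (2 / pi) * sqrt (real n) \<le> (\<integral>x. nrm n x \<partial>gm n)"
proof -
  have "real n * sqrt (2 / pi) = (\<integral>x. (\<Sum>i<n. \<bar>x i\<bar>) \<partial>gm n)"
    by (subst Bochner_Integration.integral_sum) (auto intro: integrable_gm_abs simp: integral_gm_abs)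
  also have "\<dots> \<le> (\<integral>x. sqrt (real n) * nrm n x \<partial>gm n)"
    by (intro integral_mono sum_le_nrm Bochner_Integration.integrable_sum integrable_gm_abs integrable_mult_right integrable_gm_nrm) auto
  also have "\<dots> = sqrt (real n) * (\<integral>x. nrm n x \<partial>gm n)" by simp
  finally have "sqrt (real n) * (sqrt (real n) * sqrt (2 / pi)) \<le> sqrt (real n) * (\<integral>x. nrm n x \<partial>gm n)"
    by (simp add: mult.assoc[symmetric])
  then show ?thesis using assms by (simp add: mult.commute)
qed

lemma stdn_mgf: "(\<integral>\<^sup>+t. ennreal (exp (a * t)) \<partial>stdn) = ennreal (exp (a\<^sup>2 / 2))"
proof -
  have "(\<integral>\<^sup>+t. ennreal (exp (a * t)) \<partial>stdn) = (\<integral>\<^sup>+t. ennreal (std_normal_density t) * ennreal (exp (a * t)) \<partial>lborel)"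
    by (rule nn_integral_density) auto
  also have "\<dots> = (\<integral>\<^sup>+t. ennreal (exp (a\<^sup>2 / 2)) * ennreal (normal_density a 1 t) \<partial>lborel)"
  proof (rule nn_integral_cong)
    fix t :: real
    have "- t\<^sup>2 / 2 + a * t = a\<^sup>2 / 2 + - (t - a)\<^sup>2 / 2" by (simp add: power2_eq_square field_simps)
    then have "exp (- t\<^sup>2 / 2) * exp (a * t) = exp (a\<^sup>2 / 2) * exp (- (t - a)\<^sup>2 / 2)"
      unfolding exp_add[symmetric] by simp
    then have "std_normal_density t * exp (a * t) = exp (a\<^sup>2 / 2) * normal_density a 1 t"
      by (simp add: normal_density_def)
    then show "ennreal (std_normal_density t) * ennreal (exp (a * t)) = ennreal (exp (a\<^sup>2 / 2)) * ennreal (normal_density a 1 t)"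
      by (simp add: ennreal_mult'[symmetric])
  qed
  also have "\<dots> = ennreal (exp (a\<^sup>2 / 2)) * (\<integral>\<^sup>+t. ennreal (normal_density a 1 t) \<partial>lborel)"
    by (rule nn_integral_cmult) auto
  also have "(\<integral>\<^sup>+t. ennreal (normal_density a 1 t) \<partial>lborel) = 1"
    by (subst nn_integral_eq_integral) auto
  finally show ?thesis by simp
qed

lemma gm_mgf: "(\<integral>\<^sup>+g. ennreal (exp (u * ip n x g)) \<partial>gm n) = ennreal (exp (u\<^sup>2 * (nrm n x)\<^sup>2 / 2))"
proof -
  have "(\<integral>\<^sup>+g. ennreal (exp (u * ip n x g)) \<partial>gm n) = (\<integral>\<^sup>+g. (\<Prod>i<n. ennreal (exp (u * x i * g i))) \<partial>gm n)"
    by (rule nn_integral_cong) (simp add: prod_ennreal exp_sum[symmetric] ip_def sum_distrib_left mult.assoc)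
  also have "\<dots> = (\<Prod>i<n. ennreal (exp ((u * x i)\<^sup>2 / 2)))"
    by (subst nn_integral_gm_prod) (auto simp: stdn_mgf)
  also have "\<dots> = ennreal (exp (\<Sum>i<n. (u * x i)\<^sup>2 / 2))" by (simp add: prod_ennreal exp_sum)
  also have "(\<Sum>i<n. (u * x i)\<^sup>2 / 2) = u\<^sup>2 * (nrm n x)\<^sup>2 / 2"
    by (simp add: ip_self(2)[symmetric] ip_sum power_mult_distrib sum_distrib_left sum_divide_distrib)
  finally show ?thesis .
qed

text \<open>The tangent of exp at the mean lies below exp. If \<open>exp (f x)\<close> is not
  integrable, the right-hand side is infinite, so integrability of \<open>f\<close> alone
  suffices.\<close>

lemma jensen_exp:
  assumes "prob_space M" "integrable M f"
  shows "ennreal (exp (\<integral>x. f x \<partial>M)) \<le> (\<integral>\<^sup>+x. ennreal (exp (f x)) \<partial>M)"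
proof -
  interpret prob_space M by fact
  note [measurable] = borel_measurable_integrable[OF assms(2)]
  define m where "m = (\<integral>x. f x \<partial>M)"
  show ?thesis
  proof (cases "integrable M (\<lambda>x. exp (f x))")
    case True
    have "exp m * (1 + t - m) \<le> exp t" for t
    proof -
      have "exp m * (1 + (t - m)) \<le> exp m * exp (t - m)" by (intro mult_left_mono exp_ge_add_one_self) auto
      then show ?thesis by (simp add: exp_diff algebra_simps)
    qed
    then have "(\<integral>x. exp m * (1 + f x - m) \<partial>M) \<le> (\<integral>x. exp (f x) \<partial>M)"
      using True assms(2) by (intro integral_mono) auto
    also have "(\<integral>x. exp m * (1 + f x - m) \<partial>M) = exp m"
      using assms(2) by (simp add: m_def prob_space)
    finally show ?thesis
      using True by (subst nn_integral_eq_integral) (auto simp: m_def)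
  next
    case False
    then have "(\<integral>\<^sup>+x. ennreal (exp (f x)) \<partial>M) = \<infinity>"
      by (simp add: integrable_iff_bounded less_top[symmetric])
    then show ?thesis by simp
  qed
qed

section \<open>The support function of a symmetric convex body\<close>

locale body =
  fixes n :: nat and A :: "rvec set"
  assumes body: "sym_convex_body n A"
begin

abbreviation h where "h \<equiv> supp n A"
abbreviation R where "R \<equiv> radius n A"

lemma A_ne: "A \<noteq> {}" and A_compact: "compact A"
  and A_sym: "x \<in> A \<Longrightarrow> vneg n x \<in> A"
  using body by (auto simp: sym_convex_body_def)

lemma ip_bdd: "bdd_above ((\<lambda>x. ip n x y) ` A)"
  by (rule bounded_imp_bdd_above[OF compact_imp_bounded[OF compact_continuous_image[OF continuous_ip A_compact]]])

lemma ip_le_h: "x \<in> A \<Longrightarrow> ip n x y \<le> h y"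
  unfolding supp_def by (rule cSUP_upper[OF _ ip_bdd])

lemma h_attained: "\<exists>x\<in>A. h y = ip n x y"
proof -
  obtain x where x: "x \<in> A" "\<And>z. z \<in> A \<Longrightarrow> ip n z y \<le> ip n x y"
    using continuous_attains_sup[OF A_compact A_ne continuous_ip, of n y] by auto
  have "h y \<le> ip n x y" unfolding supp_def by (rule cSUP_least[OF A_ne]) (rule x(2))
  then show ?thesis using ip_le_h[OF x(1), of y] x(1) by force
qed

lemma nrm_le_R: "x \<in> A \<Longrightarrow> nrm n x \<le> R"
  unfolding radius_def
  by (rule cSUP_upper[OF _ bounded_imp_bdd_above[OF compact_imp_bounded[OF compact_continuous_image[OF continuous_nrm A_compact]]]])

lemma R_nonneg: "0 \<le> R"
  using A_ne nrm_le_R ip_self(3)[of n] order_trans by blast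

text \<open>Symmetry of the body enters here: \<open>h\<close> dominates both the inner product with
  \<open>x\<close> and its negative.\<close>

lemma h_nonneg: "0 \<le> h y"
proof -
  obtain x where x: "x \<in> A" using A_ne by auto
  have "ip n (vneg n x) y = - ip n x y" by (simp add: ip_def vneg_def sum_negf)
  then show ?thesis using ip_le_h[OF x, of y] ip_le_h[OF A_sym[OF x], of y] by linarith
qed

lemma h_le: "h y \<le> R * nrm n y"
proof -
  obtain x where x: "x \<in> A" "h y = ip n x y" using h_attained by blast
  have "h y \<le> nrm n x * nrm n y" using ip_le_nrm[of n x y] x by linarith
  also have "\<dots> \<le> R * nrm n y" using nrm_le_R[OF x(1)] ip_self(3) by (intro mult_right_mono) auto
  finally show ?thesis .
qed

lemma h_vsmul:
  assumes "a \<ge> 0"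
  shows "h (vsmul n a y) = a * h y"
proof (rule antisym)
  obtain x where x: "x \<in> A" "h (vsmul n a y) = ip n x (vsmul n a y)" using h_attained by blast
  then show "h (vsmul n a y) \<le> a * h y" using ip_le_h[OF x(1), of y] assms by (simp add: mult_left_mono)
  obtain x where x: "x \<in> A" "h y = ip n x y" using h_attained by blast
  then show "a * h y \<le> h (vsmul n a y)" using ip_le_h[OF x(1), of "vsmul n a y"] by simp
qed

text \<open>A supremum of uncountably many measurable functions is not measurable in general;
  continuity of the inner product lets a countable dense subset of \<open>A\<close> replace
  \<open>A\<close>.\<close>

lemma measurable_h [measurable]: "h \<in> borel_measurable (vecM n)"
proof -
  obtain D where D: "countable D" "D \<subseteq> A" "A \<subseteq> closure D" by (rule separable[of A])
  have ne: "D \<noteq> {}" using D A_ne by auto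
  have bdd: "bdd_above ((\<lambda>x. ip n x y) ` D)" for y using ip_bdd D(2) by (meson bdd_above_mono image_mono)
  have "h y = (SUP x\<in>D. ip n x y)" for y
  proof (rule antisym)
    have "closed {x. ip n x y \<le> (SUP x\<in>D. ip n x y)}"
      by (intro closed_Collect_le continuous_ip continuous_on_const)
    moreover have "D \<subseteq> {x. ip n x y \<le> (SUP x\<in>D. ip n x y)}" using cSUP_upper[OF _ bdd] by auto
    ultimately have "closure D \<subseteq> {x. ip n x y \<le> (SUP x\<in>D. ip n x y)}" by (rule closure_minimal[rotated])
    then show "h y \<le> (SUP x\<in>D. ip n x y)" unfolding supp_def using D(3) by (intro cSUP_least[OF A_ne]) auto
    show "(SUP x\<in>D. ip n x y) \<le> h y" using D(2) ip_le_h by (intro cSUP_least[OF ne]) auto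
  qed
  then have "h = (\<lambda>y. SUP x\<in>D. ip n x y)" by auto
  moreover have "(\<lambda>y. SUP x\<in>D. ip n x y) \<in> borel_measurable (vecM n)"
    by (rule borel_measurable_cSUP[OF D(1) _ bdd]) measurable
  ultimately show ?thesis by simp
qed

lemma integrable_h: "integrable (gm n) h"
proof (rule Bochner_Integration.integrable_bound)
  show "integrable (gm n) (\<lambda>x. R * nrm n x)" by (intro integrable_mult_right integrable_gm_nrm)
  show "AE x in gm n. norm (h x) \<le> norm (R * nrm n x)"
    using h_nonneg h_le R_nonneg ip_self(3)[of n] by (intro AE_I2) (simp add: abs_mult)
  show "h \<in> borel_measurable (gm n)" by measurable
qed

lemma measurable_h_rot: "(\<lambda>p. h (fst (rot n \<phi> p))) \<in> borel_measurable (vecM2 n)"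
  by (rule measurable_compose[OF measurable_compose[OF measurable_rot measurable_fst] measurable_h])

lemma measurable_gm2_I: "f \<in> vecM2 n \<rightarrow>\<^sub>M N \<Longrightarrow> f \<in> gm2 n \<rightarrow>\<^sub>M N"
  by (simp add: measurable_cong_sets[OF sets_pair_measure_cong[OF sets_gm sets_gm] refl])

text \<open>Convexity enters here: the gradient inequality at \<open>Y\<close> replaces differentiability, and only needs a maximiser
  for each fixed \<open>Y\<close>, since the integral over the independent \<open>Z\<close> is taken first.\<close>
lemma rotation_step:
  assumes u: "u \<ge> 0"
  shows "(\<integral>\<^sup>+p. ennreal (exp (u * (cos \<delta> * h (fst p) - h (fst (rot n (- \<delta>) p))))) \<partial>gm2 n)
     \<le> ennreal (exp (u\<^sup>2 * (sin \<delta>)\<^sup>2 * R\<^sup>2 / 2))"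
proof -
  interpret gm: prob_space "gm n" by (rule prob_gm)
  interpret pair_prob_space "gm n" "gm n" ..
  have m1: "(\<lambda>p. h (fst p)) \<in> borel_measurable (gm2 n)"
    by (rule measurable_compose[OF measurable_fst]) measurable
  note m2 = measurable_gm2_I[OF measurable_h_rot[of "- \<delta>"]]
  have "(\<integral>\<^sup>+p. ennreal (exp (u * (cos \<delta> * h (fst p) - h (fst (rot n (- \<delta>) p))))) \<partial>gm2 n)
     = (\<integral>\<^sup>+y. \<integral>\<^sup>+z. ennreal (exp (u * (cos \<delta> * h y - h (fst (rot n (- \<delta>) (y, z)))))) \<partial>gm n \<partial>gm n)"
    using m1 m2 by (subst gm.nn_integral_fst[symmetric]) auto
  also have "\<dots> \<le> (\<integral>\<^sup>+y. ennreal (exp (u\<^sup>2 * (sin \<delta>)\<^sup>2 * R\<^sup>2 / 2)) \<partial>gm n)"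
  proof (rule nn_integral_mono)
    fix y
    obtain x where x: "x \<in> A" "h y = ip n x y" using h_attained by blast
    have "(\<integral>\<^sup>+z. ennreal (exp (u * (cos \<delta> * h y - h (fst (rot n (- \<delta>) (y, z)))))) \<partial>gm n)
      \<le> (\<integral>\<^sup>+z. ennreal (exp ((u * sin \<delta>) * ip n x z)) \<partial>gm n)"
    proof (intro nn_integral_mono ennreal_leI, simp only: exp_le_cancel_iff)
      fix z
      have "ip n x (fst (rot n (- \<delta>) (y, z))) = cos \<delta> * ip n x y - sin \<delta> * ip n x z"
        by (simp add: ip_def rot_def sum_distrib_left sum_subtractf[symmetric] algebra_simps)
      then have "cos \<delta> * h y - h (fst (rot n (- \<delta>) (y, z))) \<le> sin \<delta> * ip n x z"
        using ip_le_h[OF x(1), of "fst (rot n (- \<delta>) (y, z))"] x(2) by simp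
      then show "u * (cos \<delta> * h y - h (fst (rot n (- \<delta>) (y, z)))) \<le> u * sin \<delta> * ip n x z"
        using mult_left_mono[OF _ u] by (simp add: mult.assoc)
    qed
    also have "\<dots> = ennreal (exp ((u * sin \<delta>)\<^sup>2 * (nrm n x)\<^sup>2 / 2))" by (rule gm_mgf)
    also have "\<dots> \<le> ennreal (exp (u\<^sup>2 * (sin \<delta>)\<^sup>2 * R\<^sup>2 / 2))"
      using nrm_le_R[OF x(1)] ip_self(3)[of n x]
      by (intro ennreal_leI) (auto simp: power_mult_distrib intro!: mult_left_mono power_mono)
    finally show "(\<integral>\<^sup>+z. ennreal (exp (u * (cos \<delta> * h y - h (fst (rot n (- \<delta>) (y, z)))))) \<partial>gm n)
      \<le> ennreal (exp (u\<^sup>2 * (sin \<delta>)\<^sup>2 * R\<^sup>2 / 2))" .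
  qed
  also have "\<dots> = ennreal (exp (u\<^sup>2 * (sin \<delta>)\<^sup>2 * R\<^sup>2 / 2))" using gm.emeasure_space_1 by simp
  finally show ?thesis .
qed

text \<open>The quarter turn is cut into \<open>N\<close> small rotations. Each gradient inequality
  loses a factor \<open>cos \<delta>\<close>, which accumulates to the power \<open>N\<close> in
  front of \<open>h (snd p)\<close>, while the bound on the right is the same for all
  \<open>N\<close>.\<close>

lemma rotation_chain:
  assumes s: "s \<ge> 0" and N: "N \<ge> (1::nat)"
  shows "(\<integral>\<^sup>+p. ennreal (exp (s * (cos (pi / (2 * real N)) ^ N * h (snd p) - h (fst p)))) \<partial>gm2 n)
     \<le> ennreal (exp (s\<^sup>2 * pi\<^sup>2 * R\<^sup>2 / 8))"
proof -
  interpret gm: prob_space "gm n" by (rule prob_gm)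
  interpret P: pair_prob_space "gm n" "gm n" ..
  define \<delta> where "\<delta> = pi / (2 * real N)"
  define c where "c = cos \<delta>"
  have N0: "real N > 0" using N by simp
  have d: "0 \<le> \<delta>" "\<delta> \<le> pi / 2" using N by (auto simp: \<delta>_def field_simps)
  have c01: "0 \<le> c" "c \<le> 1" unfolding c_def using d by (auto intro: cos_ge_zero)
  have rm: "rot n \<phi> \<in> gm2 n \<rightarrow>\<^sub>M vecM2 n" for \<phi> by (rule measurable_gm2_I[OF measurable_rot])
  have hr: "(\<lambda>p. h (fst (rot n \<phi> p))) \<in> borel_measurable (gm2 n)" for \<phi> by (rule measurable_gm2_I[OF measurable_h_rot])
  define D where "D j p = c * h (fst (rot n (real (Suc j) * \<delta>) p)) - h (fst (rot n (real j * \<delta>) p))" for j p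
  have Dm[measurable]: "D j \<in> borel_measurable (gm2 n)" for j
    unfolding D_def using hr by measurable
  \<comment> \<open>Each increment is the basic backward rotation by \<open>\<delta>\<close> applied
    to a rotated pair, and rotation preserves the law of the pair.\<close>
  have D1: "(\<integral>\<^sup>+p. ennreal (exp (u * D j p)) \<partial>gm2 n) \<le> ennreal (exp (u\<^sup>2 * (sin \<delta>)\<^sup>2 * R\<^sup>2 / 2))"
    if u: "u \<ge> 0" for u j
  proof -
    define \<phi> where "\<phi> = real (Suc j) * \<delta>"
    have "real j * \<delta> = \<phi> - \<delta>" by (simp add: \<phi>_def algebra_simps)
    moreover have "fst (rot n (\<psi> - \<delta>) p) = fst (rot n (- \<delta>) (rot n \<psi> p))" for p \<psi>
      by (auto simp: rot_def cos_diff sin_diff fun_eq_iff algebra_simps)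
    ultimately have rr: "fst (rot n (real j * \<delta>) p) = fst (rot n (- \<delta>) (rot n \<phi> p))" for p
      by simp
    have em: "(\<lambda>p. ennreal (exp (u * (cos \<delta> * h (fst p) - h (fst (rot n (- \<delta>) p)))))) \<in> borel_measurable (vecM2 n)"
      using measurable_h_rot measurable_compose[OF measurable_fst measurable_h] by measurable
    have "(\<integral>\<^sup>+p. ennreal (exp (u * D j p)) \<partial>gm2 n)
      = (\<integral>\<^sup>+p. ennreal (exp (u * (cos \<delta> * h (fst (rot n \<phi> p)) - h (fst (rot n (- \<delta>) (rot n \<phi> p)))))) \<partial>gm2 n)"
      unfolding D_def rr by (simp add: c_def \<phi>_def)
    also have "\<dots> = (\<integral>\<^sup>+p. ennreal (exp (u * (cos \<delta> * h (fst p) - h (fst (rot n (- \<delta>) p))))) \<partial>distr (gm2 n) (vecM2 n) (rot n \<phi>))"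
      using em by (subst nn_integral_distr[OF rm]) simp_all
    also have "\<dots> \<le> ennreal (exp (u\<^sup>2 * (sin \<delta>)\<^sup>2 * R\<^sup>2 / 2))"
      unfolding gm_rot by (rule rotation_step[OF u])
    finally show ?thesis .
  qed
  \<comment> \<open>The weights \<open>c ^ j\<close> compensate the factor \<open>c\<close> in each
    increment; the chain runs from angle 0 (the first vector) to pi/2 (the second).\<close>
  have tel: "c ^ N * h (snd p) - h (fst p) = (\<Sum>j<N. c ^ j * D j p)" if p: "p \<in> space (gm2 n)" for p
  proof -
    have pv: "fst p \<in> vecs n" "snd p \<in> vecs n" using p by (auto simp: space_pair_measure)
    have S: "(\<Sum>j<M. c ^ j * D j p) = c ^ M * h (fst (rot n (real M * \<delta>) p)) - h (fst (rot n 0 p))" for M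
      by (induction M) (simp_all add: D_def algebra_simps)
    have Nd: "real N * \<delta> = pi / 2" using N by (simp add: \<delta>_def)
    have "fst (rot n 0 p) = fst p" "fst (rot n (pi / 2) p) = snd p"
      using pv by (auto simp: rot_def vecs_def fun_eq_iff PiE_def extensional_def)
    then show ?thesis using S[of N] unfolding Nd by simp
  qed
  have "(\<integral>\<^sup>+p. ennreal (exp (s * (c ^ N * h (snd p) - h (fst p)))) \<partial>gm2 n)
     \<le> (\<integral>\<^sup>+p. (\<Sum>j<N. ennreal (1 / real N) * ennreal (exp ((s * real N * c ^ j) * D j p))) \<partial>gm2 n)"
  proof (rule nn_integral_mono)
    fix p assume p: "p \<in> space (gm2 n)"
    \<comment> \<open>The increments are dependent, so convexity of exp takes the place of a
      product: each of the \<open>N\<close> terms gets weight 1/N and is itself multiplied by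
      \<open>N\<close>.\<close>
    have "s * (c ^ N * h (snd p) - h (fst p)) = (\<Sum>j<N. (1 / real N) *\<^sub>R ((s * real N * c ^ j) * D j p))"
      using N0 by (simp add: tel[OF p] sum_distrib_left mult.assoc)
    then have "exp (s * (c ^ N * h (snd p) - h (fst p))) \<le> (\<Sum>j<N. (1 / real N) * exp ((s * real N * c ^ j) * D j p))"
      using convex_on_sum[of "{..<N}" UNIV exp "\<lambda>_. 1 / real N" "\<lambda>j. (s * real N * c ^ j) * D j p"] N0
      by (auto simp: exp_convex)
    then show "ennreal (exp (s * (c ^ N * h (snd p) - h (fst p)))) \<le> (\<Sum>j<N. ennreal (1 / real N) * ennreal (exp ((s * real N * c ^ j) * D j p)))"
      by (simp add: ennreal_mult'[symmetric] ennreal_leI)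
  qed
  also have "\<dots> = (\<Sum>j<N. ennreal (1 / real N) * (\<integral>\<^sup>+p. ennreal (exp ((s * real N * c ^ j) * D j p)) \<partial>gm2 n))"
    by (subst nn_integral_sum) (auto intro!: sum.cong nn_integral_cmult)
  also have "\<dots> \<le> (\<Sum>j<N. ennreal (1 / real N) * ennreal (exp (s\<^sup>2 * pi\<^sup>2 * R\<^sup>2 / 8)))"
  proof (intro sum_mono mult_left_mono)
    fix j
    have "(\<integral>\<^sup>+p. ennreal (exp ((s * real N * c ^ j) * D j p)) \<partial>gm2 n) \<le> ennreal (exp ((s * real N * c ^ j)\<^sup>2 * (sin \<delta>)\<^sup>2 * R\<^sup>2 / 2))"
      using s c01 by (intro D1) auto
    also have "\<dots> \<le> ennreal (exp (s\<^sup>2 * pi\<^sup>2 * R\<^sup>2 / 8))"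
    proof (intro ennreal_leI, simp only: exp_le_cancel_iff)
      \<comment> \<open>The factor \<open>N\<close> from the convex combination meets
        \<open>sin \<delta> \<le> pi / (2 N)\<close>, so \<open>N\<close> cancels.\<close>
      have "sin \<delta> \<le> \<delta>" using d by (intro sin_x_le_x)
      moreover have "0 \<le> sin \<delta>" using d pi_gt_zero by (intro sin_ge_zero) linarith+
      ultimately have "(s * real N * c ^ j) * sin \<delta> \<le> (s * real N * 1) * \<delta>"
        using s c01 by (intro mult_mono mult_nonneg_nonneg) (auto intro: power_le_one)
      also have "\<dots> = s * pi / 2" using N0 by (simp add: \<delta>_def)
      finally have "((s * real N * c ^ j) * sin \<delta>)\<^sup>2 \<le> (s * pi / 2)\<^sup>2"
        using s c01 \<open>0 \<le> sin \<delta>\<close> by (intro power_mono) auto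
      then have "((s * real N * c ^ j) * sin \<delta>)\<^sup>2 * (R\<^sup>2 / 2) \<le> (s * pi / 2)\<^sup>2 * (R\<^sup>2 / 2)"
        by (rule mult_right_mono) simp
      then show "(s * real N * c ^ j)\<^sup>2 * (sin \<delta>)\<^sup>2 * R\<^sup>2 / 2 \<le> s\<^sup>2 * pi\<^sup>2 * R\<^sup>2 / 8"
        by (simp add: power_mult_distrib power_divide)
    qed
    finally show "(\<integral>\<^sup>+p. ennreal (exp ((s * real N * c ^ j) * D j p)) \<partial>gm2 n) \<le> ennreal (exp (s\<^sup>2 * pi\<^sup>2 * R\<^sup>2 / 8))" .
  qed simp
  also have "\<dots> = ennreal (exp (s\<^sup>2 * pi\<^sup>2 * R\<^sup>2 / 8))"
    using N0 by (simp add: ennreal_mult'[symmetric] ennreal_of_nat_eq_real_of_nat)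
  finally show ?thesis unfolding c_def \<delta>_def .
qed

text \<open>Independence splits the exponential of a difference into two factors. Refining the
  rotation removes the loss, since cos(pi/(2N))^N tends to 1, and Fatou's lemma passes to the limit
  without a dominating function.\<close>

lemma h_exp_product:
  assumes s: "s \<ge> 0"
  shows "(\<integral>\<^sup>+x. ennreal (exp (s * h x)) \<partial>gm n) * (\<integral>\<^sup>+x. ennreal (exp (- s * h x)) \<partial>gm n) \<le> ennreal (exp (s\<^sup>2 * pi\<^sup>2 * R\<^sup>2 / 8))"
proof -
  interpret gm: prob_space "gm n" by (rule prob_gm)
  interpret P: pair_prob_space "gm n" "gm n" ..
  have m1[measurable]: "(\<lambda>p. h (fst p)) \<in> borel_measurable (gm2 n)"
    by (rule measurable_compose[OF measurable_fst]) measurable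
  have m2[measurable]: "(\<lambda>p. h (snd p)) \<in> borel_measurable (gm2 n)"
    by (rule measurable_compose[OF measurable_snd]) measurable
  define a where "a N = cos (pi / (2 * real (Suc N))) ^ Suc N" for N
  have a: "a \<longlonglongrightarrow> 1" unfolding a_def by real_asymp
  have "(\<integral>\<^sup>+x. ennreal (exp (s * h x)) \<partial>gm n) * (\<integral>\<^sup>+x. ennreal (exp (- s * h x)) \<partial>gm n)
    = (\<integral>\<^sup>+x. \<integral>\<^sup>+y. ennreal (exp (- s * h x)) * ennreal (exp (s * h y)) \<partial>gm n \<partial>gm n)"
    by (simp add: nn_integral_cmult nn_integral_multc mult.commute)
  also have "\<dots> = (\<integral>\<^sup>+p. ennreal (exp (- s * h (fst p))) * ennreal (exp (s * h (snd p))) \<partial>gm2 n)"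
    by (subst gm.nn_integral_fst[symmetric]) auto
  also have "\<dots> = (\<integral>\<^sup>+p. liminf (\<lambda>N. ennreal (exp (s * (a N * h (snd p) - h (fst p))))) \<partial>gm2 n)"
  proof (rule nn_integral_cong)
    fix p
    have "(\<lambda>N. ennreal (exp (s * (a N * h (snd p) - h (fst p))))) \<longlonglongrightarrow> ennreal (exp (s * (1 * h (snd p) - h (fst p))))"
      by (intro tendsto_intros a)
    from lim_imp_Liminf[OF trivial_limit_sequentially this]
    show "ennreal (exp (- s * h (fst p))) * ennreal (exp (s * h (snd p))) = liminf (\<lambda>N. ennreal (exp (s * (a N * h (snd p) - h (fst p)))))"
      by (simp add: ennreal_mult'[symmetric] exp_add[symmetric] algebra_simps)
  qed
  also have "\<dots> \<le> liminf (\<lambda>N. \<integral>\<^sup>+p. ennreal (exp (s * (a N * h (snd p) - h (fst p)))) \<partial>gm2 n)"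
    by (rule nn_integral_liminf) measurable
  also have "\<dots> \<le> ennreal (exp (s\<^sup>2 * pi\<^sup>2 * R\<^sup>2 / 8))"
    using rotation_chain[OF s, of "Suc _"] unfolding a_def
    by (intro order_trans[OF Liminf_le_Limsup Limsup_bounded]) (auto intro!: always_eventually)
  finally show ?thesis .
qed

text \<open>Jensen's inequality bounds \<open>exp (- s * m)\<close> by the mean of
  \<open>exp (- s * h x)\<close>, so centring at the mean costs no more than subtracting an
  independent copy. For negative \<open>s\<close> the two factors exchange roles.\<close>

lemma h_subgaussian:
  "(\<integral>\<^sup>+x. ennreal (exp (s * (h x - (\<integral>y. h y \<partial>gm n)))) \<partial>gm n) \<le> ennreal (exp (s\<^sup>2 * pi\<^sup>2 * R\<^sup>2 / 8))"
proof -
  interpret gm: prob_space "gm n" by (rule prob_gm)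
  define m where "m = (\<integral>y. h y \<partial>gm n)"
  define E where "E t = (\<integral>\<^sup>+x. ennreal (exp (t * h x)) \<partial>gm n)" for t
  have prod: "E s * E (- s) \<le> ennreal (exp (s\<^sup>2 * pi\<^sup>2 * R\<^sup>2 / 8))"
  proof (cases "s \<ge> 0")
    case True then show ?thesis using h_exp_product[OF True] by (simp add: E_def)
  next
    case False
    then show ?thesis using h_exp_product[of "- s"] by (simp add: E_def mult.commute)
  qed
  have J: "ennreal (exp (- s * m)) \<le> E (- s)"
    using jensen_exp[OF gm.prob_space_axioms, of "\<lambda>x. - s * h x"] integrable_h by (simp add: E_def m_def)
  have "(\<integral>\<^sup>+x. ennreal (exp (s * (h x - m))) \<partial>gm n) = (\<integral>\<^sup>+x. ennreal (exp (s * h x)) * ennreal (exp (- s * m)) \<partial>gm n)"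
    by (rule nn_integral_cong) (simp add: ennreal_mult'[symmetric] exp_add[symmetric] algebra_simps)
  also have "\<dots> = E s * ennreal (exp (- s * m))"
    unfolding E_def by (rule nn_integral_multc) measurable
  also have "\<dots> \<le> E s * E (- s)" by (intro mult_left_mono J) auto
  finally show ?thesis using prod unfolding m_def by (rule order_trans)
qed

end

section \<open>Gram--Schmidt projections of Gaussian matrices\<close>

definition res :: "nat \<Rightarrow> rmat \<Rightarrow> rvec \<Rightarrow> rvec" where
  "res n P g = (\<lambda>i\<in>{..<n}. g i - mv n P g i)"

text \<open>The projection onto the span of the first columns of \<open>G\<close>, by Gram--Schmidt. A column that depends on its
  predecessors has residual \<open>u = 0\<close> and, since division by zero yields zero, contributes nothing.\<close>
primrec gs :: "nat \<Rightarrow> rmat \<Rightarrow> nat \<Rightarrow> rmat" where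
  "gs n G 0 = mzero n"
| "gs n G (Suc j) = (let u = res n (gs n G j) (G j) in
      madd n (gs n G j) (outer n (vsmul n (1 / ip n u u) u) u))"

lemma mv_madd: "i < n \<Longrightarrow> mv n (madd n A B) x i = mv n A x i + mv n B x i"
  by (simp add: sum.distrib algebra_simps)

lemma res_vecs [simp]: "res n P g \<in> vecs n" by (simp add: res_def vecs_def)

text \<open>The residual \<open>u\<close> is orthogonal to the range of \<open>P\<close> and has the
  same inner product with \<open>g\<close> as with itself, so adding its line sends \<open>g\<close>
  to \<open>P g + u = g\<close>. The last two claims together say that the rank grows by one exactly
  when \<open>g\<close> is not already in the range.\<close>

lemma gs_step:
  assumes P: "proj n P" and g: "g \<in> vecs n"
  defines "u \<equiv> res n P g"
  defines "P' \<equiv> madd n P (outer n (vsmul n (1 / ip n u u) u) u)"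
  shows "proj n P'" "mv n P' g = g" "\<And>w. w \<in> vecs n \<Longrightarrow> mv n P w = w \<Longrightarrow> mv n P' w = w"
    "mtrace n P' = mtrace n P + (if ip n u u = 0 then 0 else 1)" "ip n u u = 0 \<longleftrightarrow> mv n P g = g"
proof -
  have uv: "u \<in> vecs n" by (simp add: u_def)
  have tP: "tr n P = P" "mm n P P = P" "P \<in> mats n" using P by (auto simp: proj_def)
  have ug: "u i = g i - mv n P g i" if "i < n" for i using that by (simp add: u_def res_def)
  have Pu: "mv n P u i = 0" if "i < n" for i
  proof -
    have "mv n P u i = mv n P g i - mv n P (mv n P g) i"
      using that by (simp add: ug sum_subtractf right_diff_distrib del: mv_nth(1)[of _ n P g] mv_nth(1)[of _ n P "mv n P g"])
    then show ?thesis by (simp add: mv_mm[symmetric] tP)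
  qed
  have uPx: "ip n u (mv n P x) = 0" for x
  proof -
    have "ip n u (mv n P x) = ip n (mv n P u) x" using ip_mv[of n P u x] tP by simp
    also have "\<dots> = 0" unfolding ip_def by (intro sum.neutral ballI) (simp add: Pu del: mv_nth(1))
    finally show ?thesis .
  qed
  have gu: "ip n u g = ip n u u"
  proof -
    have "ip n u u = ip n u g - ip n u (mv n P g)" by (simp add: ip_def ug right_diff_distrib sum_subtractf)
    then show ?thesis by (simp add: uPx)
  qed
  show u0: "ip n u u = 0 \<longleftrightarrow> mv n P g = g"
  proof
    assume "ip n u u = 0"
    then have "u i = 0" if "i < n" for i using ip_self_zero that by blast
    then show "mv n P g = g" using g by (intro vecs_eqI[of _ n]) (auto simp: ug simp del: mv_nth)
  next
    assume "mv n P g = g" then show "ip n u u = 0" by (simp add: ip_def ug)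
  qed
  have OP: "mm n P (outer n v u) = mzero n" if "v = vsmul n a u" for v a
    unfolding mm_outer that mv_vsmul by (rule mats_eqI[of _ n]) (auto simp: Pu simp del: mv_nth(1))
  define e where "e = vsmul n (1 / nrm n u) u"
  have oe: "outer n (vsmul n (1 / ip n u u) u) u = outer n e e"
    by (rule mats_eqI[of _ n]) (auto simp: e_def ip_self(2) power2_eq_square)
  show "proj n P'"
  proof (cases "ip n u u = 0")
    case True
    then have "P' = P" unfolding P'_def using tP
      by (intro mats_eqI[of _ n]) auto
    then show ?thesis using P by simp
  next
    case False
    have e1: "ip n e e = 1" using False by (simp add: e_def nrm_def field_simps ip_self(1))
    have "mm n P (outer n e e) = mzero n" using OP[OF refl, of "1 / ip n u u"] oe by simp
    moreover from arg_cong[OF this, of "tr n"] have "mm n (outer n e e) P = mzero n"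
      by (simp add: tr_mm mm_outer(3) tP)
    ultimately show ?thesis unfolding P'_def oe proj_def using tP
      by (simp add: mm_distrib mm_outer(3) outer_outer[OF e1])
  qed
  have P'x: "mv n P' x i = mv n P x i + (ip n u x) * (1 / ip n u u) * u i" if "i < n" for x i
    unfolding P'_def mv_madd[OF that] mv_outer using that by (simp del: mv_nth(1))
  show "mv n P' g = g"
  proof (rule vecs_eqI[OF _ g])
    fix i assume i: "i < n"
    show "mv n P' g i = g i"
    proof (cases "ip n u u = 0")
      case True
      then have "mv n P g = g" using u0 by simp
      then show ?thesis using True by (simp add: P'x[OF i])
    next
      case False
      then show ?thesis by (simp add: P'x[OF i] gu ug[OF i] del: mv_nth(1))
    qed
  qed simp
  show "mv n P' w = w" if w: "w \<in> vecs n" "mv n P w = w" for w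
  proof (rule vecs_eqI[OF _ w(1)])
    fix i assume i: "i < n"
    have "ip n u w = 0" using uPx[of w] w by simp
    then show "mv n P' w i = w i" using w by (simp add: P'x[OF i] del: mv_nth(1))
  qed simp
  show "mtrace n P' = mtrace n P + (if ip n u u = 0 then 0 else 1)" unfolding P'_def by simp
qed

lemma gs_props:
  assumes "\<And>i. i < j \<Longrightarrow> G i \<in> vecs n"
  shows "proj n (gs n G j) \<and> (\<forall>i<j. mv n (gs n G j) (G i) = G i)"
  using assms
proof (induction j)
  case 0
  then show ?case by (simp add: proj_def)
next
  case (Suc j)
  then have p: "proj n (gs n G j)" and f: "\<forall>i<j. mv n (gs n G j) (G i) = G i" by auto
  note st = gs_step[OF p Suc.prems[of j, OF lessI]]
  show ?case using st(1,2) st(3) f Suc.prems by (auto simp: Let_def less_Suc_eq)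
qed

lemma gs_cong: "(\<And>i. i < j \<Longrightarrow> G i = G' i) \<Longrightarrow> gs n G j = gs n G' j"
  by (induction j) (auto simp: Let_def)

definition conj_mat :: "nat \<Rightarrow> rmat \<Rightarrow> rmat \<Rightarrow> rmat" where
  "conj_mat n U P = mm n (mm n U P) (tr n U)"

lemma mv_conj_mat:
  assumes U: "U \<in> orth n" and g: "g \<in> vecs n"
  shows "mv n (conj_mat n U P) (mv n U g) = mv n U (mv n P g)"
proof -
  have "mv n (conj_mat n U P) (mv n U g) = mv n U (mv n P (mv n (mm n (tr n U) U) g))"
    by (simp add: conj_mat_def mv_mm)
  then show ?thesis using U g by (simp add: orth_def)
qed

text \<open>Rotating the columns rotates each residual and keeps its norm. The identity therefore
  holds for every family of columns, dependent ones included, and transfers invariance from the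
  columns to their span.\<close>

lemma gs_equivariant:
  assumes U: "U \<in> orth n" and G: "\<And>i. i < j \<Longrightarrow> G i \<in> vecs n"
  shows "gs n (\<lambda>i. mv n U (G i)) j = conj_mat n U (gs n G j)"
  using G
proof (induction j)
  case 0
  then show ?case by (simp add: conj_mat_def)
next
  case (Suc j)
  have Um: "U \<in> mats n" using U by (simp add: orth_def)
  have ih: "gs n (\<lambda>i. mv n U (G i)) j = conj_mat n U (gs n G j)" using Suc by auto
  let ?u = "res n (gs n G j) (G j)"
  have r: "res n (conj_mat n U (gs n G j)) (mv n U (G j)) = mv n U ?u"
  proof (rule vecs_eqI[of _ n])
    fix i assume i: "i < n"
    show "res n (conj_mat n U (gs n G j)) (mv n U (G j)) i = mv n U ?u i"
      unfolding res_def using i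
      by (simp add: mv_conj_mat[OF U Suc.prems[OF lessI]] sum_subtractf right_diff_distrib del: mv_nth(1)[of _ n "gs n G j"])
  qed auto
  have o: "conj_mat n U (outer n a b) = outer n (mv n U a) (mv n U b)" for a b
    by (simp add: conj_mat_def mm_outer tr_tr Um)
  have d: "conj_mat n U (madd n X Y) = madd n (conj_mat n U X) (conj_mat n U Y)" for X Y
    by (simp add: conj_mat_def mm_distrib)
  show ?case by (simp add: Let_def ih r o d orth_ip[OF U] mv_vsmul)
qed

lemma conj_mat_grass:
  assumes U: "U \<in> orth n" and P: "P \<in> grass n k"
  shows "conj_mat n U P \<in> grass n k"
proof -
  have p: "proj n P" "mtrace n P = real k" using P by (auto simp: grass_proj)
  have Um: "U \<in> mats n" "mm n (tr n U) U = idm n" using U by (auto simp: orth_def)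
  have "mm n (conj_mat n U P) (conj_mat n U P) = mm n (mm n U P) (mm n (mm n (tr n U) U) (mm n P (tr n U)))"
    by (simp only: conj_mat_def mm_assoc)
  also have "\<dots> = mm n U (mm n (mm n P P) (tr n U))" by (simp add: Um mm_assoc)
  also have "\<dots> = conj_mat n U P" using p by (simp add: proj_def conj_mat_def mm_assoc)
  finally have 1: "mm n (conj_mat n U P) (conj_mat n U P) = conj_mat n U P" .
  have 2: "tr n (conj_mat n U P) = conj_mat n U P" using p by (simp add: conj_mat_def tr_mm tr_tr Um mm_assoc proj_def)
  have "mtrace n (conj_mat n U P) = mtrace n (mm n (mm n (tr n U) U) P)"
    unfolding conj_mat_def by (subst mtrace_mm) (simp add: mm_assoc)
  then have 3: "mtrace n (conj_mat n U P) = real k" using p by (simp add: Um proj_def)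
  show ?thesis using 1 2 3 by (simp add: grass_proj proj_def conj_mat_def)
qed

text \<open>Fubini with one coordinate integrated first: it is enough that the property holds almost
  surely when coordinate \<open>i\<close> alone is redrawn.\<close>

lemma AE_PiM_coordinate:
  assumes I: "finite I" "i \<in> I" and M: "\<And>j. prob_space (M j)"
    and m: "{x\<in>space (PiM I M). Q x} \<in> sets (PiM I M)"
    and AE: "\<And>x. x \<in> space (PiM (I - {i}) M) \<Longrightarrow> AE y in M i. Q (x(i := y))"
  shows "AE x in PiM I M. Q x"
proof -
  interpret product_sigma_finite M
    by (intro product_sigma_finite.intro prob_space_imp_sigma_finite M)
  let ?N = "{x\<in>space (PiM I M). \<not> Q x}"
  have mN: "?N \<in> sets (PiM I M)" using m by (rule sets.sets_Collect_neg)
  have ins: "insert i (I - {i}) = I" using I by auto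
  have "emeasure (PiM I M) ?N = (\<integral>\<^sup>+x. indicator ?N x \<partial>PiM I M)" using mN by simp
  also have "\<dots> = (\<integral>\<^sup>+x. \<integral>\<^sup>+y. indicator ?N (x(i := y)) \<partial>M i \<partial>PiM (I - {i}) M)"
  proof -
    have "indicator ?N \<in> borel_measurable (PiM (insert i (I - {i})) M)" unfolding ins using mN by simp
    from product_nn_integral_insert[OF _ _ this] show ?thesis using I unfolding ins by blast
  qed
  also have "\<dots> = (\<integral>\<^sup>+x. 0 \<partial>PiM (I - {i}) M)"
  proof (rule nn_integral_cong)
    fix x assume x: "x \<in> space (PiM (I - {i}) M)"
    have "(\<integral>\<^sup>+y. indicator ?N (x(i := y)) \<partial>M i) = (\<integral>\<^sup>+y. 0 \<partial>M i)"
      by (rule nn_integral_cong_AE) (use AE[OF x] in \<open>auto elim!: eventually_mono\<close>)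
    then show "(\<integral>\<^sup>+y. indicator ?N (x(i := y)) \<partial>M i) = 0" by simp
  qed
  finally have "emeasure (PiM I M) ?N = 0" by simp
  then show ?thesis using mN by (intro AE_I[of _ _ ?N]) auto
qed

text \<open>With all coordinates but \<open>l\<close> frozen, the sum vanishes for a single value of
  coordinate \<open>l\<close>.\<close>

lemma gm_linear_nonzero:
  assumes l: "l < n" "r l \<noteq> 0"
  shows "AE g in gm n. (\<Sum>j<n. r j * g j) \<noteq> 0"
  unfolding gm_def
proof (rule AE_PiM_coordinate[where i=l])
  have "{x \<in> space (gm n). (\<Sum>j<n. r j * x j) \<noteq> 0} \<in> sets (gm n)" by measurable
  then show "{x \<in> space (Pi\<^sub>M {..<n} (\<lambda>_. stdn)). (\<Sum>j<n. r j * x j) \<noteq> 0} \<in> sets (Pi\<^sub>M {..<n} (\<lambda>_. stdn))"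
    by (simp add: gm_def)
  fix x :: "nat \<Rightarrow> real"
  define t where "t = - (\<Sum>j\<in>{..<n} - {l}. r j * x j) / r l"
  have "AE y in lborel. y \<noteq> t" by (rule AE_lborel_singleton)
  then have "AE y in stdn. y \<noteq> t" by (subst AE_density) auto
  then show "AE y in stdn. (\<Sum>j<n. r j * (x(l := y)) j) \<noteq> 0"
  proof eventually_elim
    case (elim y)
    have "(\<Sum>j<n. r j * (x(l := y)) j) = r l * y + (\<Sum>j\<in>{..<n} - {l}. r j * x j)"
      using l by (subst sum.remove[of _ l]) (auto intro!: sum.cong)
    then show ?case using elim l by (auto simp: t_def field_simps)
  qed
qed (use l prob_stdn in auto)

text \<open>Vectors fixed by a proper projection satisfy a nontrivial linear equation, read off from
  a nonzero row of the complement.\<close>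

lemma gm_proj_null:
  assumes P: "proj n P" and t: "mtrace n P \<noteq> real n"
  shows "AE g in gm n. mv n P g \<noteq> g"
proof -
  let ?Q = "msub n (idm n) P"
  have "?Q \<noteq> mzero n" using t by (metis mtrace_simps(2,3,4) eq_iff_diff_eq_0)
  moreover have "?Q = mzero n" if "\<And>i l. i < n \<Longrightarrow> l < n \<Longrightarrow> ?Q i l = 0"
    using that by (intro mats_eqI[of _ n]) (simp_all del: mat_nth(5))
  ultimately obtain i l where il: "i < n" "l < n" "?Q i l \<noteq> 0" by blast
  have "AE g in gm n. (\<Sum>j<n. ?Q i j * g j) \<noteq> 0" by (rule gm_linear_nonzero[of l n "?Q i", OF il(2,3)])
  then show ?thesis
  proof (rule AE_mp, intro AE_I2 impI notI)
    fix g assume g: "g \<in> space (gm n)" "(\<Sum>j<n. ?Q i j * g j) \<noteq> 0" "mv n P g = g"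
    have "(\<Sum>j<n. ?Q i j * g j) = mv n (idm n) g i - mv n P g i"
      using il by (simp add: left_diff_distrib sum_subtractf)
    then show False using g by simp
  qed
qed

section \<open>Measurability on the space of matrices\<close>

lemma space_matM [simp]: "space (matM n) = mats n"
  by (simp add: matM_def space_PiM mats_def)

lemma measurable_matM_component [measurable]: "i < n \<Longrightarrow> j < n \<Longrightarrow> (\<lambda>P. P i j) \<in> borel_measurable (matM n)"
  unfolding matM_def
  by (rule measurable_compose[OF measurable_component_singleton[of i "{..<n}" "\<lambda>_. vecM n"] measurable_vecM_component]) auto

lemma measurable_matM_I:
  assumes "\<And>x. x \<in> space M \<Longrightarrow> f x \<in> mats n" "\<And>i j. i < n \<Longrightarrow> j < n \<Longrightarrow> (\<lambda>x. f x i j) \<in> borel_measurable M"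
  shows "f \<in> M \<rightarrow>\<^sub>M matM n"
proof -
  have "(\<lambda>x. \<lambda>i\<in>{..<n}. f x i) \<in> M \<rightarrow>\<^sub>M matM n"
    unfolding matM_def
    by (intro measurable_restrict measurable_vecM_I) (use assms in \<open>auto simp: mats_def\<close>)
  moreover have "(\<lambda>i\<in>{..<n}. f x i) = f x" if "x \<in> space M" for x
    using assms(1)[OF that] by (auto simp: mats_def fun_eq_iff PiE_def extensional_def)
  ultimately show ?thesis by (simp cong: measurable_cong)
qed

lemma measurable_conj_mat: "conj_mat n U \<in> matM n \<rightarrow>\<^sub>M matM n"
  by (rule measurable_matM_I) (auto simp: conj_mat_def)

lemma pred_eq_real:
  fixes f g :: "'a \<Rightarrow> real"
  assumes [measurable]: "f \<in> borel_measurable M" "g \<in> borel_measurable M"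
  shows "Measurable.pred M (\<lambda>x. f x = g x)"
  unfolding eq_iff[of "f _" "g _"] by measurable

lemma grass_sets: "grass n k \<in> sets (matM n)"
proof -
  have "grass n k = {P\<in>space (matM n). (\<forall>i\<in>{..<n}. \<forall>j\<in>{..<n}. P j i = P i j)
      \<and> (\<forall>i\<in>{..<n}. \<forall>j\<in>{..<n}. (\<Sum>l<n. P i l * P l j) = P i j) \<and> (\<Sum>i<n. P i i) = real k}"
  proof (rule set_eqI)
    fix P
    have e: "X = P \<longleftrightarrow> (\<forall>i<n. \<forall>j<n. X i j = P i j)" if "P \<in> mats n" "X \<in> mats n" for X
      using that mats_eqI by auto
    show "P \<in> grass n k \<longleftrightarrow> P \<in> {P\<in>space (matM n). (\<forall>i\<in>{..<n}. \<forall>j\<in>{..<n}. P j i = P i j)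
      \<and> (\<forall>i\<in>{..<n}. \<forall>j\<in>{..<n}. (\<Sum>l<n. P i l * P l j) = P i j) \<and> (\<Sum>i<n. P i i) = real k}"
      unfolding grass_def using e[of "tr n P"] e[of "mm n P P"] by (cases "P \<in> mats n") auto
  qed
  also have "\<dots> \<in> sets (matM n)"
    unfolding pred_def[symmetric]
    by (intro pred_intros_logic pred_intros_finite pred_eq_real borel_measurable_sum borel_measurable_times
        borel_measurable_const measurable_matM_component) simp_all
  finally show ?thesis .
qed

section \<open>Gaussian columns and the rank of their span\<close>

definition cols :: "nat \<Rightarrow> nat \<Rightarrow> rmat measure" where
  "cols n k = PiM {..<k} (\<lambda>_. gm n)"

lemma prob_cols: "prob_space (cols n k)"
  unfolding cols_def by (intro prob_space_PiM prob_gm)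

lemma space_cols: "G \<in> space (cols n k) \<Longrightarrow> i < k \<Longrightarrow> G i \<in> vecs n"
  by (auto simp: cols_def space_PiM)

lemma measurable_cols_component: "j < k \<Longrightarrow> (\<lambda>G. G j) \<in> cols n k \<rightarrow>\<^sub>M vecM n"
  using measurable_component_singleton[of j "{..<k}" "\<lambda>_. gm n"]
  by (simp add: cols_def measurable_cong_sets[OF refl sets_gm])

lemma gs_mats: "gs n G j \<in> mats n"
  by (cases j) (auto simp: Let_def)

lemma measurable_res:
  assumes "j < k" "i < n" "\<And>i l. i < n \<Longrightarrow> l < n \<Longrightarrow> (\<lambda>G. gs n G j i l) \<in> borel_measurable (cols n k)"
  shows "(\<lambda>G. res n (gs n G j) (G j) i) \<in> borel_measurable (cols n k)"
proof -
  have gj: "(\<lambda>G. G j i) \<in> borel_measurable (cols n k)" if "i < n" for i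
    by (rule measurable_compose[OF measurable_cols_component[OF assms(1)] measurable_vecM_component[OF that]])
  have "(\<lambda>G. G j i - (\<Sum>l<n. gs n G j i l * G j l)) \<in> borel_measurable (cols n k)"
    by (intro borel_measurable_diff borel_measurable_sum borel_measurable_times gj assms) (use assms(2) in auto)
  then show ?thesis using assms(2) by (simp add: res_def)
qed

lemma measurable_gs_entry:
  "j \<le> k \<Longrightarrow> i < n \<Longrightarrow> l < n \<Longrightarrow> (\<lambda>G. gs n G j i l) \<in> borel_measurable (cols n k)"
proof (induction j arbitrary: i l)
  case (Suc j)
  let ?u = "\<lambda>G. res n (gs n G j) (G j)"
  have [measurable]: "(\<lambda>G. gs n G j i l) \<in> borel_measurable (cols n k)" if "i < n" "l < n" for i l
    using Suc that by auto
  then have [measurable]: "(\<lambda>G. ?u G i) \<in> borel_measurable (cols n k)" if "i < n" for i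
    using measurable_res Suc.prems(1) that by auto
  have "(\<lambda>G. gs n G j i l + 1 / ip n (?u G) (?u G) * ?u G i * ?u G l) \<in> borel_measurable (cols n k)"
    unfolding ip_def using Suc.prems by measurable
  moreover have "gs n G (Suc j) i l = gs n G j i l + 1 / ip n (?u G) (?u G) * ?u G i * ?u G l" for G
    using Suc.prems by (simp only: gs.simps Let_def mat_nth mv_nth)
  ultimately show ?case by (simp only:)
qed simp

lemma measurable_gs [measurable]: "(\<lambda>G. gs n G k) \<in> cols n k \<rightarrow>\<^sub>M matM n"
  by (rule measurable_matM_I) (auto intro: gs_mats measurable_gs_entry)

text \<open>Given its predecessors, a new column avoids their span almost surely as long as that
  span is proper, so every Gram--Schmidt step adds one to the trace. The span before step
  \<open>j\<close> is proper because \<open>j < k \<le> n\<close>.\<close>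

lemma gs_mtrace_AE:
  assumes "k \<le> n"
  shows "AE G in cols n k. mtrace n (gs n G k) = real k"
proof -
  have "j \<le> k \<Longrightarrow> AE G in cols n k. mtrace n (gs n G j) = real j" for j
  proof (induction j)
    case (Suc j)
    let ?r = "\<lambda>G. ip n (res n (gs n G j) (G j)) (res n (gs n G j) (G j))"
    have "AE G in cols n k. mtrace n (gs n G j) = real j \<longrightarrow> ?r G \<noteq> 0"
      unfolding cols_def
    proof (rule AE_PiM_coordinate[where i=j])
      have ge: "(\<lambda>G. gs n G j i l) \<in> borel_measurable (cols n k)" if "i < n" "l < n" for i l
        using measurable_gs_entry that Suc.prems by auto
      have "{G \<in> space (cols n k). mtrace n (gs n G j) = real j \<longrightarrow> ?r G \<noteq> 0} \<in> sets (cols n k)"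
        unfolding pred_def[symmetric] mtrace_def ip_def
        by (intro pred_intros_logic pred_eq_real borel_measurable_sum borel_measurable_times borel_measurable_const
            ge measurable_res) (use Suc.prems in simp_all)
      then show "{G \<in> space (Pi\<^sub>M {..<k} (\<lambda>_. gm n)). mtrace n (gs n G j) = real j \<longrightarrow> ?r G \<noteq> 0}
         \<in> sets (Pi\<^sub>M {..<k} (\<lambda>_. gm n))" by (simp add: cols_def)
      fix G assume G: "G \<in> space (Pi\<^sub>M ({..<k} - {j}) (\<lambda>_. gm n))"
      then have Gv: "G i \<in> vecs n" if "i < j" for i
        using PiE_mem[OF G[unfolded space_PiM], of i] that Suc.prems by simp
      \<comment> \<open>\<open>gs n G j\<close> reads only the columns below \<open>j\<close>, so
        redrawing column \<open>j\<close> leaves the projection fixed.\<close>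
      have e: "gs n (G(j := y)) j = gs n G j" for y by (rule gs_cong) simp
      have p: "proj n (gs n G j)" using gs_props[of j G n] Gv by blast
      show "AE y in gm n. mtrace n (gs n (G(j := y)) j) = real j \<longrightarrow> ?r (G(j := y)) \<noteq> 0"
      proof (cases "mtrace n (gs n G j) = real j")
        case True
        then have "mtrace n (gs n G j) \<noteq> real n" using Suc.prems assms by simp
        from gm_proj_null[OF p this] AE_space show ?thesis
          by eventually_elim (simp add: e gs_step(5)[OF p])
      qed (simp add: e)
    qed (use Suc.prems prob_gm in auto)
    with Suc.IH[OF Suc_leD[OF Suc.prems]] AE_space show ?case
    proof eventually_elim
      case (elim G)
      have Gv: "G i \<in> vecs n" if "i < Suc j" for i using space_cols[OF elim(2)] that Suc.prems by auto
      then have "proj n (gs n G j)" using gs_props[of j G n] by auto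
      from gs_step(4)[OF this Gv[OF lessI]] show ?case using elim by (simp add: Let_def)
    qed
  qed simp
  then show ?thesis by simp
qed

lemma gs_grass_AE:
  assumes "k \<le> n"
  shows "AE G in cols n k. gs n G k \<in> grass n k"
  using gs_mtrace_AE[OF assms] AE_space
proof eventually_elim
  case (elim G)
  then show ?case using gs_props[of k G n] space_cols[OF elim(2)] by (simp add: grass_proj)
qed

lemma cols_orth:
  assumes U: "U \<in> orth n"
  shows "distr (cols n k) (cols n k) (compose {..<k} (mv n U)) = cols n k"
proof -
  have m: "mv n U \<in> gm n \<rightarrow>\<^sub>M gm n" using measurable_mv by (simp add: measurable_cong_sets[OF sets_gm sets_gm])
  have pp: "product_prob_space (\<lambda>_::nat. gm n)"
    by (intro product_prob_space.intro product_sigma_finite.intro product_prob_space_axioms.intro prob_gm prob_space_imp_sigma_finite)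
  show ?thesis unfolding cols_def using distr_PiM_finite_prob_space[OF _ pp pp m, of "{..<k}"] by (simp add: gm_orth'[OF U])
qed

section \<open>The invariant measures on spheres and Grassmannians\<close>

lemma sets_Collect_mem: "X \<in> sets M \<Longrightarrow> {x\<in>space M. x \<in> X} \<in> sets M"
  using sets.Int[of "space M" M X] by (simp add: Int_def)

text \<open>Evaluates the definite descriptions for spheres and Grassmannians. Existence comes from
  restricting an explicit invariant \<open>\<mu>\<close> to \<open>X\<close>; for uniqueness a
  competitor on \<open>X\<close> is pushed into \<open>N\<close>, where the coordinates live, and
  compared with \<open>\<mu>\<close>.\<close>

lemma THE_invariant_measure:
  assumes X: "X \<in> sets N" and s: "sets \<mu> = sets N" and p: "prob_space \<mu>" and AEX: "AE x in \<mu>. x \<in> X"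
    and Tm: "\<And>T. T \<in> \<T> \<Longrightarrow> T \<in> N \<rightarrow>\<^sub>M N" and TX: "\<And>T x. T \<in> \<T> \<Longrightarrow> x \<in> X \<Longrightarrow> T x \<in> X"
    and inv: "\<And>T. T \<in> \<T> \<Longrightarrow> distr \<mu> N T = \<mu>"
    and c: "coords J c N" and iso: "\<And>T x w. T \<in> \<T> \<Longrightarrow> csq J c (T x) (T w) = csq J c x w"
    and trans: "\<And>x y. x \<in> X \<Longrightarrow> y \<in> X \<Longrightarrow> \<exists>T\<in>\<T>. T x = y"
  shows "(THE \<nu>. prob_space \<nu> \<and> sets \<nu> = sets (restrict_space N X) \<and> (\<forall>T\<in>\<T>. distr \<nu> \<nu> T = \<nu>)) = restrict_space \<mu> X"
    "prob_space (restrict_space \<mu> X)"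
proof -
  interpret prob_space \<mu> by fact
  have XN: "X \<subseteq> space N" using sets.sets_into_space[OF X] .
  have sp: "space \<mu> = space N" using s by (rule sets_eq_imp_space_eq)
  have X1: "emeasure \<mu> X = 1"
    using AEX X s by (intro emeasure_eq_1_AE) auto
  let ?r = "restrict_space \<mu> X"
  have spr: "space ?r = X" using XN by (auto simp: space_restrict_space sp)
  have setr: "sets ?r = sets (restrict_space N X)" by (rule sets_restrict_space_cong[OF s])
  show pr: "prob_space ?r" using X s X1 by (intro prob_space_restrict_space) auto
  have inB: "B \<in> sets N \<and> B \<subseteq> X" if "B \<in> sets (restrict_space N X)" for B
    using that X XN sets.sets_into_space by (subst (asm) sets_restrict_space_iff) auto
  have emr: "emeasure ?r B = emeasure \<mu> B" if "B \<in> sets (restrict_space N X)" for B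
    using inB[OF that] X s by (intro emeasure_restrict_space) (auto simp: Int_absorb2 XN sp)
  have TrN: "T \<in> restrict_space N X \<rightarrow>\<^sub>M restrict_space N X" if T: "T \<in> \<T>" for T
    using Tm[OF T] TX[OF T] by (intro measurable_restrict_space2 measurable_restrict_space1) (auto simp: space_restrict_space)
  show "(THE \<nu>. prob_space \<nu> \<and> sets \<nu> = sets (restrict_space N X) \<and> (\<forall>T\<in>\<T>. distr \<nu> \<nu> T = \<nu>)) = ?r"
  proof (rule the_equality)
    have "distr ?r ?r T = ?r" if T: "T \<in> \<T>" for T
    proof (rule measure_eqI)
      fix B assume "B \<in> sets (distr ?r ?r T)"
      then have B: "B \<in> sets (restrict_space N X)" using setr by simp
      have Tr: "T \<in> ?r \<rightarrow>\<^sub>M ?r" using TrN[OF T] by (simp add: measurable_cong_sets[OF setr setr])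
      have B1: "T -` B \<inter> X \<in> sets (restrict_space N X)"
        using measurable_sets[OF TrN[OF T] B] XN by (simp add: space_restrict_space Int_absorb2)
      have Tmu: "T \<in> \<mu> \<rightarrow>\<^sub>M N" using Tm[OF T] by (simp add: measurable_cong_sets[OF s refl])
      have "emeasure (distr ?r ?r T) B = emeasure ?r (T -` B \<inter> X)"
        using Tr B setr by (simp add: emeasure_distr spr)
      also have "\<dots> = emeasure \<mu> (T -` B \<inter> X)" by (rule emr[OF B1])
      \<comment> \<open>Points outside \<open>X\<close> may be mapped into \<open>B\<close>, but
        they form a null set.\<close>
      also have "\<dots> = emeasure \<mu> (T -` B \<inter> space \<mu>)"
        using AEX inB[OF B] inB[OF B1] measurable_sets[OF Tmu] s XN sp
        by (intro emeasure_eq_AE) (auto elim!: eventually_mono)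
      also have "\<dots> = emeasure (distr \<mu> N T) B" using inB[OF B] Tmu by (simp add: emeasure_distr)
      also have "\<dots> = emeasure ?r B" by (simp add: inv[OF T] emr[OF B])
      finally show "emeasure (distr ?r ?r T) B = emeasure ?r B" .
    qed simp
    then show "prob_space ?r \<and> sets ?r = sets (restrict_space N X) \<and> (\<forall>T\<in>\<T>. distr ?r ?r T = ?r)"
      using pr setr by blast
    fix \<nu> assume \<nu>: "prob_space \<nu> \<and> sets \<nu> = sets (restrict_space N X) \<and> (\<forall>T\<in>\<T>. distr \<nu> \<nu> T = \<nu>)"
    then have sn: "sets \<nu> = sets (restrict_space N X)" by blast
    have spn: "space \<nu> = X" using sets_eq_imp_space_eq[OF sn] XN by (auto simp: space_restrict_space)
    have idm: "(\<lambda>x. x) \<in> \<nu> \<rightarrow>\<^sub>M N"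
      by (simp add: measurable_cong_sets[OF sn refl] measurable_restrict_space1)
    let ?L = "distr \<nu> N (\<lambda>x. x)"
    have "?L = \<mu>"
    proof (rule invariant_eqI[OF c _ s _ p _ AEX Tm _ inv iso trans])
      show "prob_space ?L" using \<nu> idm by (intro prob_space.prob_space_distr) auto
      show "AE x in ?L. x \<in> X" using idm X by (subst AE_distr_iff) (auto simp: spn)
      fix T assume T: "T \<in> \<T>"
      have Tn: "T \<in> \<nu> \<rightarrow>\<^sub>M \<nu>" using TrN[OF T] by (simp add: measurable_cong_sets[OF sn sn])
      have "distr ?L N T = distr \<nu> N T" using Tm[OF T] idm by (simp add: distr_distr comp_def)
      also have "\<dots> = distr (distr \<nu> \<nu> T) N (\<lambda>x. x)" using Tn idm by (simp add: distr_distr comp_def)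
      also have "\<dots> = ?L" using \<nu> T by simp
      finally show "distr ?L N T = ?L" .
    qed simp
    show "\<nu> = ?r"
    proof (rule measure_eqI)
      fix B assume "B \<in> sets \<nu>"
      then have B: "B \<in> sets (restrict_space N X)" using sn by simp
      have "emeasure ?L B = emeasure \<nu> B"
        using inB[OF B] idm by (simp add: emeasure_distr spn Int_absorb2)
      then show "emeasure \<nu> B = emeasure ?r B" using emr[OF B] \<open>?L = \<mu>\<close> by simp
    qed (simp add: sn setr)
  qed
qed

lemma integral_restrict_AE:
  fixes f :: "'a \<Rightarrow> real"
  assumes "X \<in> sets \<mu>" "AE x in \<mu>. x \<in> X" "f \<in> borel_measurable \<mu>"
  shows "(\<integral>x. f x \<partial>restrict_space \<mu> X) = (\<integral>x. f x \<partial>\<mu>)"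
proof -
  have "X \<inter> space \<mu> \<in> sets \<mu>" using assms by auto
  then have "(\<integral>x. f x \<partial>restrict_space \<mu> X) = (\<integral>x. indicator X x *\<^sub>R f x \<partial>\<mu>)"
    by (rule integral_restrict_space)
  also have "\<dots> = (\<integral>x. f x \<partial>\<mu>)"
    using assms by (intro integral_cong_AE) (auto elim!: eventually_mono intro!: borel_measurable_scaleR borel_measurable_indicator)
  finally show ?thesis .
qed

text \<open>The zero vector is sent to itself, because 1 / 0 is 0. Almost sure statements, zero
  weights or homogeneity of the support function dispose of this case.\<close>

definition normv :: "nat \<Rightarrow> rvec \<Rightarrow> rvec" where
  "normv n x = vsmul n (1 / nrm n x) x"

lemma orth_nrm: "U \<in> orth n \<Longrightarrow> nrm n (mv n U x) = nrm n x"
  by (simp add: nrm_def orth_ip)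

lemma normv_orth: "U \<in> orth n \<Longrightarrow> normv n (mv n U x) = mv n U (normv n x)"
  by (simp add: normv_def orth_nrm mv_vsmul)

lemma nrm_zero_iff: "x \<in> vecs n \<Longrightarrow> nrm n x = 0 \<longleftrightarrow> (\<forall>i<n. x i = 0)"
proof
  assume "nrm n x = 0"
  then have "ip n x x = 0" by (simp add: ip_self(2))
  then show "\<forall>i<n. x i = 0" using ip_self_zero by blast
qed (simp add: nrm_def ip_def)

lemma nrm_normv: "nrm n x \<noteq> 0 \<Longrightarrow> nrm n (normv n x) = 1"
proof -
  assume "nrm n x \<noteq> 0"
  then have "ip n (normv n x) (normv n x) = 1"
    unfolding normv_def ip_vsmul ip_self(2)[of n x] by (simp add: power2_eq_square)
  then show ?thesis by (simp add: nrm_def)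
qed

lemma measurable_normv [measurable]: "normv n \<in> vecM n \<rightarrow>\<^sub>M vecM n"
  by (rule measurable_vecM_I) (auto simp: normv_def)

lemma measurable_normv_mv: "(\<lambda>g. normv n (mv n P g)) \<in> gm n \<rightarrow>\<^sub>M vecM n"
  by (rule measurable_gm_I[OF measurable_compose[OF measurable_mv measurable_normv]])

lemma measurable_mv_pair: "(\<lambda>q. mv n (fst q) (snd q)) \<in> matM n \<Otimes>\<^sub>M gm n \<rightarrow>\<^sub>M vecM n"
  by (rule measurable_vecM_I)
    (auto intro!: borel_measurable_sum borel_measurable_times measurable_compose[OF measurable_fst measurable_matM_component]
      measurable_compose[OF measurable_snd measurable_gm_I[OF measurable_vecM_component]])

lemma usphere_sets: "usphere n P \<in> sets (vecM n)"
proof -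
  have "usphere n P = {x\<in>space (vecM n). (\<forall>i\<in>{..<n}. (\<Sum>j<n. P i j * x j) = x i) \<and> nrm n x = 1}"
  proof (rule set_eqI)
    fix x
    have "mv n P x = x \<longleftrightarrow> (\<forall>i<n. mv n P x i = x i)" if "x \<in> vecs n"
      by (metis vecs_eqI[OF vecs_closed(1) that])
    then show "x \<in> usphere n P \<longleftrightarrow> x \<in> {x\<in>space (vecM n). (\<forall>i\<in>{..<n}. (\<Sum>j<n. P i j * x j) = x i) \<and> nrm n x = 1}"
      unfolding usphere_def by auto
  qed
  also have "\<dots> \<in> sets (vecM n)"
    unfolding pred_def[symmetric]
    by (intro pred_intros_logic pred_intros_finite pred_eq_real borel_measurable_sum borel_measurable_times
        borel_measurable_const measurable_vecM_component measurable_nrm) simp_all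
  finally show ?thesis .
qed

abbreviation vcsq :: "nat \<Rightarrow> rvec \<Rightarrow> rvec \<Rightarrow> real" where
  "vcsq n \<equiv> csq {..<n} (\<lambda>x j. x j)"

lemma csq_vec_orth: "U \<in> orth n \<Longrightarrow> vcsq n (mv n U x) (mv n U w) = vcsq n x w"
proof -
  assume U: "U \<in> orth n"
  have e: "vcsq n u v = ip n u u - 2 * ip n u v + ip n v v" for u v
    by (simp add: csq_def ip_def power2_eq_square algebra_simps sum.distrib sum_subtractf sum_distrib_left)
  show ?thesis unfolding e orth_ip[OF U] ..
qed

section \<open>Matrices in the Frobenius metric\<close>

lemma coords_matM: "coords ({..<n} \<times> {..<n}) (\<lambda>P (i, j). P i j) (matM n)"
proof (rule coordsI[where g="\<lambda>z. \<lambda>i\<in>{..<n}. \<lambda>j\<in>{..<n}. z (i, j)"])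
  show "(\<lambda>z. \<lambda>i\<in>{..<n}. \<lambda>j\<in>{..<n}. z (i, j)) \<in> PiM ({..<n} \<times> {..<n}) (\<lambda>_. borel) \<rightarrow>\<^sub>M matM n"
    by (rule measurable_matM_I) (auto simp: mats_def vecs_def intro!: measurable_component_singleton)
  fix P assume "P \<in> space (matM n)"
  then have P: "P \<in> mats n" by simp
  show "(\<lambda>i\<in>{..<n}. \<lambda>j\<in>{..<n}. (\<lambda>j\<in>{..<n} \<times> {..<n}. case j of (i, j) \<Rightarrow> P i j) (i, j)) = P"
    by (rule mats_eqI[OF _ P]) (auto simp: mats_def vecs_def)
qed auto

abbreviation mcsq :: "nat \<Rightarrow> rmat \<Rightarrow> rmat \<Rightarrow> real" where
  "mcsq n \<equiv> csq ({..<n} \<times> {..<n}) (\<lambda>P (i, j). P i j)"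

text \<open>Writing the squared Frobenius distance as a trace reduces invariance under conjugation
  to cyclicity of the trace.\<close>

lemma csq_mat: "mcsq n A B = mtrace n (mm n (tr n (msub n A B)) (msub n A B))"
proof -
  have "mcsq n A B = (\<Sum>i<n. \<Sum>j<n. (A i j - B i j)\<^sup>2)"
    unfolding csq_def by (subst sum.cartesian_product) (simp add: case_prod_unfold)
  also have "\<dots> = (\<Sum>j<n. \<Sum>i<n. (A i j - B i j)\<^sup>2)" by (rule sum.swap)
  also have "\<dots> = mtrace n (mm n (tr n (msub n A B)) (msub n A B))"
    by (simp add: mtrace_def power2_eq_square)
  finally show ?thesis .
qed

lemma csq_mat_orth:
  assumes U: "U \<in> orth n"
  shows "mcsq n (conj_mat n U A) (conj_mat n U B) = mcsq n A B"
proof -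
  have Um: "U \<in> mats n" "mm n (tr n U) U = idm n" using U by (auto simp: orth_def)
  define D where "D = msub n A B"
  have Dm: "D \<in> mats n" by (simp add: D_def)
  have "msub n (conj_mat n U A) (conj_mat n U B) = conj_mat n U D" by (simp add: conj_mat_def D_def mm_distrib)
  moreover have "mtrace n (mm n (tr n (conj_mat n U D)) (conj_mat n U D)) = mtrace n (mm n (tr n D) D)"
  proof -
    have "mm n (tr n (conj_mat n U D)) (conj_mat n U D) = mm n U (mm n (tr n D) (mm n (mm n (tr n U) U) (mm n D (tr n U))))"
      by (simp add: conj_mat_def tr_mm tr_tr Um(1) mm_assoc)
    also have "\<dots> = mm n U (mm n (mm n (tr n D) D) (tr n U))" by (simp add: Um(2) mm_assoc)
    finally have "mtrace n (mm n (tr n (conj_mat n U D)) (conj_mat n U D)) = mtrace n (mm n (mm n (mm n (tr n D) D) (tr n U)) U)"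
      by (simp only: mtrace_mm[of n U])
    also have "\<dots> = mtrace n (mm n (tr n D) D)" by (simp only: mm_assoc Um(2)) (simp add: Dm)
    finally show ?thesis .
  qed
  ultimately show ?thesis by (simp add: csq_mat D_def)
qed

lemma proj_normv_usphere:
  assumes P: "proj n P" and nz: "nrm n (mv n P g) \<noteq> 0"
  shows "normv n (mv n P g) \<in> usphere n P"
proof -
  have "mv n P (normv n (mv n P g)) = normv n (mv n P g)"
    unfolding normv_def mv_vsmul using P by (simp add: mv_mm[symmetric] proj_def)
  then show ?thesis using nrm_normv[OF nz] by (simp add: usphere_def normv_def)
qed

text \<open>\<open>P g = 0\<close> says that \<open>g\<close> is fixed by the complementary
  projection, which is proper because \<open>P\<close> has nonzero trace.\<close>

lemma gm_proj_nonzero: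
  assumes P: "proj n P" and t: "mtrace n P \<noteq> 0"
  shows "AE g in gm n. nrm n (mv n P g) \<noteq> 0"
proof -
  let ?Q = "msub n (idm n) P"
  have Q: "proj n ?Q" using P by (intro proj_msub proj_idm) (auto simp: proj_def)
  have "AE g in gm n. mv n ?Q g \<noteq> g" by (rule gm_proj_null[OF Q]) (use t in simp)
  then show ?thesis using AE_space
  proof eventually_elim
    case (elim g)
    then have g: "g \<in> vecs n" by simp
    show ?case
    proof
      assume "nrm n (mv n P g) = 0"
      then have z: "mv n P g i = 0" if "i < n" for i using that nrm_zero_iff[of "mv n P g" n] by auto
      have "mv n ?Q g = g"
      proof (rule vecs_eqI[OF _ g])
        fix i assume i: "i < n"
        have "mv n ?Q g i = mv n (idm n) g i - mv n P g i"
          using i by (simp add: left_diff_distrib sum_subtractf)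
        then show "mv n ?Q g i = g i" using z[OF i] g by (simp del: mv_nth(1))
      qed simp
      then show False using elim by simp
    qed
  qed
qed

lemma usphere_ip: "x \<in> usphere n P \<Longrightarrow> mv n P x = x \<and> ip n x x = 1"
  by (simp add: usphere_def ip_self(2))

text \<open>A Gaussian vector, projected and normalised, is the explicit model. A map
  \<open>U\<close> that commutes with \<open>P\<close> passes through both operations and is
  absorbed by the invariance of \<open>gm n\<close>.\<close>

lemma unif_sphere_eq:
  assumes P: "P \<in> grass n k" and k: "k \<ge> 1"
  defines "\<mu> \<equiv> distr (gm n) (vecM n) (\<lambda>g. normv n (mv n P g))"
  shows "unif_sphere n P = restrict_space \<mu> (usphere n P)" "AE x in \<mu>. x \<in> usphere n P" "prob_space \<mu>"
    "prob_space (unif_sphere n P)"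
proof -
  interpret gm: prob_space "gm n" by (rule prob_gm)
  have p: "proj n P" "mtrace n P \<noteq> 0" using P k by (auto simp: grass_proj)
  note m = measurable_normv_mv[of n P]
  show pm: "prob_space \<mu>" unfolding \<mu>_def by (rule gm.prob_space_distr[OF m])
  show AEm: "AE x in \<mu>. x \<in> usphere n P" unfolding \<mu>_def
  proof (subst AE_distr_iff[OF m])
    show "{x \<in> space (vecM n). x \<in> usphere n P} \<in> sets (vecM n)" by (rule sets_Collect_mem[OF usphere_sets])
    show "AE g in gm n. normv n (mv n P g) \<in> usphere n P"
      using gm_proj_nonzero[OF p] by eventually_elim (rule proj_normv_usphere[OF p(1)])
  qed
  define \<T> where "\<T> = mv n ` {U \<in> orth n. mm n U P = mm n P U}"
  have ue: "unif_sphere n P = (THE \<nu>. prob_space \<nu> \<and> sets \<nu> = sets (restrict_space (vecM n) (usphere n P)) \<and> (\<forall>T\<in>\<T>. distr \<nu> \<nu> T = \<nu>))"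
    unfolding unif_sphere_def \<T>_def by (rule arg_cong[where f=The]) (auto intro!: ext)
  note TI = THE_invariant_measure[of "usphere n P" "vecM n" \<mu> \<T>, OF usphere_sets _ pm AEm]
  have inv: "distr \<mu> (vecM n) T = \<mu>" if "T \<in> \<T>" for T
  proof -
    from that obtain U where U: "U \<in> orth n" "mm n U P = mm n P U" "T = mv n U" by (auto simp: \<T>_def)
    have "distr \<mu> (vecM n) T = distr (gm n) (vecM n) (\<lambda>g. mv n U (normv n (mv n P g)))"
      unfolding \<mu>_def U(3) by (subst distr_distr[OF measurable_mv m]) (simp add: comp_def)
    also have "(\<lambda>g. mv n U (normv n (mv n P g))) = (\<lambda>g. normv n (mv n P (mv n U g)))"
      using U by (simp add: normv_orth[symmetric] mv_mm[symmetric])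
    also have "distr (gm n) (vecM n) (\<lambda>g. normv n (mv n P (mv n U g))) = distr (distr (gm n) (vecM n) (mv n U)) (vecM n) (\<lambda>g. normv n (mv n P g))"
      by (subst distr_distr) (auto simp: comp_def)
    finally show ?thesis by (simp add: gm_orth[OF U(1)] \<mu>_def)
  qed
  have Tm: "T \<in> vecM n \<rightarrow>\<^sub>M vecM n" if "T \<in> \<T>" for T using that by (auto simp: \<T>_def)
  have TX: "T x \<in> usphere n P" if "T \<in> \<T>" "x \<in> usphere n P" for T x
  proof -
    from that obtain U where U: "U \<in> orth n" "mm n U P = mm n P U" "T = mv n U" by (auto simp: \<T>_def)
    have "mv n P (mv n U x) = mv n U (mv n P x)" using U by (simp add: mv_mm[symmetric])
    then show ?thesis using that(2) U by (simp add: usphere_def orth_nrm)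
  qed
  have iso: "vcsq n (T x) (T w) = vcsq n x w" if "T \<in> \<T>" for T x w
    using that csq_vec_orth by (auto simp: \<T>_def)
  have trans: "\<exists>T\<in>\<T>. T x = y" if xy: "x \<in> usphere n P" "y \<in> usphere n P" for x y
  proof -
    obtain U where U: "U \<in> orth n" "mv n U x = y" "mm n (mm n U P) (tr n U) = P"
      using orth_transitive_flags[OF P P] usphere_ip[OF xy(1)] usphere_ip[OF xy(2)] by blast
    \<comment> \<open>An orthogonal map carrying the subspace to itself commutes with its
      projection: multiply \<open>U P U^T = P\<close> by \<open>U\<close> on the right.\<close>
    have "mm n P U = mm n U (mm n P (mm n (tr n U) U))" by (subst U(3)[symmetric]) (simp only: mm_assoc)
    then have "mm n U P = mm n P U" using U(1) p(1) by (simp add: orth_def proj_def)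
    then show ?thesis using U(1,2) by (auto simp: \<T>_def)
  qed
  have sm: "sets \<mu> = sets (vecM n)" by (simp add: \<mu>_def)
  have pr: "prob_space (restrict_space \<mu> (usphere n P))" by (rule TI(2)[OF sm]) (fact Tm TX inv iso trans coords_vecM)+
  show "unif_sphere n P = restrict_space \<mu> (usphere n P)"
    unfolding ue by (rule TI(1)[OF sm]) (fact Tm TX inv iso trans coords_vecM)+
  then show "prob_space (unif_sphere n P)" using pr by simp
qed

lemma measurable_compose_mv:
  "compose {..<k} (mv n U) \<in> cols n k \<rightarrow>\<^sub>M cols n k"
proof -
  have "(\<lambda>G. \<lambda>j\<in>{..<k}. mv n U (G j)) \<in> cols n k \<rightarrow>\<^sub>M PiM {..<k} (\<lambda>_. gm n)"
    by (rule measurable_restrict)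
      (use measurable_compose[OF measurable_cols_component measurable_mv] in \<open>simp add: measurable_cong_sets[OF refl sets_gm]\<close>)
  moreover have "compose {..<k} (mv n U) = (\<lambda>G. \<lambda>j\<in>{..<k}. mv n U (G j))" by (simp add: fun_eq_iff compose_def)
  ultimately show ?thesis by (simp add: cols_def)
qed

lemma gs_compose:
  assumes U: "U \<in> orth n" and G: "G \<in> space (cols n k)"
  shows "gs n (compose {..<k} (mv n U) G) k = conj_mat n U (gs n G k)"
proof -
  have "gs n (compose {..<k} (mv n U) G) k = gs n (\<lambda>i. mv n U (G i)) k"
    by (rule gs_cong) (simp add: compose_def)
  also have "\<dots> = conj_mat n U (gs n G k)" by (rule gs_equivariant[OF U space_cols[OF G]])
  finally show ?thesis .
qed

text \<open>The span of \<open>k\<close> Gaussian columns is the explicit model of Haar measure;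
  equivariance of Gram--Schmidt turns invariance of the columns into invariance of the span.\<close>

lemma nu_eq:
  assumes k: "1 \<le> k" "k \<le> n"
  defines "\<mu> \<equiv> distr (cols n k) (matM n) (\<lambda>G. gs n G k)"
  shows "nu n k = restrict_space \<mu> (grass n k)" "AE P in \<mu>. P \<in> grass n k" "prob_space \<mu>" "prob_space (nu n k)"
proof -
  interpret cols: prob_space "cols n k" by (rule prob_cols)
  have m: "(\<lambda>G. gs n G k) \<in> cols n k \<rightarrow>\<^sub>M matM n" by measurable
  have sm: "sets \<mu> = sets (matM n)" by (simp add: \<mu>_def)
  show pm: "prob_space \<mu>" unfolding \<mu>_def by (rule cols.prob_space_distr[OF m])
  show AEm: "AE P in \<mu>. P \<in> grass n k" unfolding \<mu>_def
    using sets_Collect_mem[OF grass_sets] gs_grass_AE[OF k(2)] by (subst AE_distr_iff[OF m]) auto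
  define \<T> where "\<T> = conj_mat n ` orth n"
  have ue: "nu n k = (THE \<nu>. prob_space \<nu> \<and> sets \<nu> = sets (restrict_space (matM n) (grass n k)) \<and> (\<forall>T\<in>\<T>. distr \<nu> \<nu> T = \<nu>))"
    unfolding nu_def \<T>_def conj_mat_def by (rule arg_cong[where f=The]) (auto intro!: ext)
  note TI = THE_invariant_measure[of "grass n k" "matM n" \<mu> \<T>, OF grass_sets sm pm AEm]
  have inv: "distr \<mu> (matM n) T = \<mu>" if "T \<in> \<T>" for T
  proof -
    from that obtain U where U: "U \<in> orth n" "T = conj_mat n U" by (auto simp: \<T>_def)
    have "distr \<mu> (matM n) T = distr (cols n k) (matM n) (\<lambda>G. conj_mat n U (gs n G k))"
      unfolding \<mu>_def U(2) by (subst distr_distr[OF measurable_conj_mat m]) (simp add: comp_def)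
    also have "\<dots> = distr (cols n k) (matM n) (\<lambda>G. gs n (compose {..<k} (mv n U) G) k)"
      by (rule distr_cong) (simp_all add: gs_compose[OF U(1)])
    also have "\<dots> = distr (distr (cols n k) (cols n k) (compose {..<k} (mv n U))) (matM n) (\<lambda>G. gs n G k)"
      by (subst distr_distr[OF m measurable_compose_mv]) (simp add: comp_def)
    finally show ?thesis by (simp add: cols_orth[OF U(1)] \<mu>_def)
  qed
  have Tm: "T \<in> matM n \<rightarrow>\<^sub>M matM n" if "T \<in> \<T>" for T using that measurable_conj_mat by (auto simp: \<T>_def)
  have TX: "T x \<in> grass n k" if "T \<in> \<T>" "x \<in> grass n k" for T x
    using that conj_mat_grass by (auto simp: \<T>_def)
  have iso: "mcsq n (T A) (T B) = mcsq n A B" if "T \<in> \<T>" for T A B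
    using that csq_mat_orth by (auto simp: \<T>_def)
  have trans: "\<exists>T\<in>\<T>. T P = Q" if PQ: "P \<in> grass n k" "Q \<in> grass n k" for P Q
  proof -
    \<comment> \<open>Transitivity is available for flags, so each subspace is first equipped with
      an arbitrary unit vector, which exists because \<open>k \<ge> 1\<close>.\<close>
    obtain x where x: "mv n P x = x" "ip n x x = 1" using proj_unit_vector[of n P] PQ k by (auto simp: grass_proj)
    obtain y where y: "mv n Q y = y" "ip n y y = 1" using proj_unit_vector[of n Q] PQ k by (auto simp: grass_proj)
    show ?thesis using orth_transitive_flags[OF PQ x y] by (auto simp: \<T>_def conj_mat_def)
  qed
  have pr: "prob_space (restrict_space \<mu> (grass n k))" by (rule TI(2)) (fact Tm TX inv iso trans coords_matM)+
  show "nu n k = restrict_space \<mu> (grass n k)"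
    unfolding ue by (rule TI(1)) (fact Tm TX inv iso trans coords_matM)+
  then show "prob_space (nu n k)" using pr by simp
qed

section \<open>Flags\<close>

definition flags :: "nat \<Rightarrow> nat \<Rightarrow> (rvec \<times> rmat) set" where
  "flags n k = {p. snd p \<in> grass n k \<and> fst p \<in> usphere n (snd p)}"

abbreviation flagM :: "nat \<Rightarrow> (rvec \<times> rmat) measure" where
  "flagM n \<equiv> vecM n \<Otimes>\<^sub>M matM n"

text \<open>The vector is stored as an extra column \<open>n\<close> next to the matrix, so that a
  single rectangular index set serves both parts.\<close>

definition fcoord :: "nat \<Rightarrow> rvec \<times> rmat \<Rightarrow> nat \<times> nat \<Rightarrow> real" where
  "fcoord n p = (\<lambda>(i, j). if j < n then snd p i j else fst p i)"

definition flag_map :: "nat \<Rightarrow> rmat \<Rightarrow> rvec \<times> rmat \<Rightarrow> rvec \<times> rmat" where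
  "flag_map n U p = (mv n U (fst p), conj_mat n U (snd p))"

lemma measurable_flag_fst: "i < n \<Longrightarrow> (\<lambda>p. fst p i) \<in> borel_measurable (flagM n)"
  by (rule measurable_compose[OF measurable_fst measurable_vecM_component])

lemma measurable_flag_snd: "i < n \<Longrightarrow> j < n \<Longrightarrow> (\<lambda>p. snd p i j) \<in> borel_measurable (flagM n)"
  by (rule measurable_compose[OF measurable_snd measurable_matM_component])

lemma measurable_flag_map: "flag_map n U \<in> flagM n \<rightarrow>\<^sub>M flagM n"
  unfolding flag_map_def
  by (intro measurable_Pair measurable_compose[OF measurable_fst measurable_mv] measurable_compose[OF measurable_snd measurable_conj_mat])

lemma coords_flagM: "coords ({..<n} \<times> {..<Suc n}) (fcoord n) (flagM n)"
proof (rule coordsI[where g="\<lambda>z. (\<lambda>i\<in>{..<n}. z (i, n), \<lambda>i\<in>{..<n}. \<lambda>j\<in>{..<n}. z (i, j))"])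
  show "(\<lambda>z. (\<lambda>i\<in>{..<n}. z (i, n), \<lambda>i\<in>{..<n}. \<lambda>j\<in>{..<n}. z (i, j))) \<in> PiM ({..<n} \<times> {..<Suc n}) (\<lambda>_. borel) \<rightarrow>\<^sub>M flagM n"
    by (intro measurable_Pair measurable_matM_I measurable_vecM_I)
      (auto simp: mats_def vecs_def intro!: measurable_component_singleton)
  show "(\<lambda>p. fcoord n p j) \<in> borel_measurable (flagM n)" if "j \<in> {..<n} \<times> {..<Suc n}" for j
    using that measurable_flag_fst measurable_flag_snd by (cases j; cases "snd j < n") (auto simp: fcoord_def)
  fix p assume "p \<in> space (flagM n)"
  then have p: "fst p \<in> vecs n" "snd p \<in> mats n" by (auto simp: space_pair_measure)
  let ?z = "\<lambda>j\<in>{..<n} \<times> {..<Suc n}. fcoord n p j"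
  have "(\<lambda>i\<in>{..<n}. ?z (i, n)) = fst p"
    by (rule vecs_eqI[OF _ p(1)]) (auto simp: vecs_def fcoord_def)
  moreover have "(\<lambda>i\<in>{..<n}. \<lambda>j\<in>{..<n}. ?z (i, j)) = snd p"
    by (rule mats_eqI[OF _ p(2)]) (auto simp: mats_def vecs_def fcoord_def)
  ultimately show "(\<lambda>i\<in>{..<n}. ?z (i, n), \<lambda>i\<in>{..<n}. \<lambda>j\<in>{..<n}. ?z (i, j)) = p" by (simp add: prod_eq_iff)
qed auto

lemma csq_flag:
  "csq ({..<n} \<times> {..<Suc n}) (fcoord n) p q =
    mcsq n (snd p) (snd q) + vcsq n (fst p) (fst q)"
proof -
  have "csq ({..<n} \<times> {..<Suc n}) (fcoord n) p q = (\<Sum>i<n. \<Sum>j<Suc n. (fcoord n p (i, j) - fcoord n q (i, j))\<^sup>2)"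
    unfolding csq_def by (subst sum.cartesian_product) simp
  also have "\<dots> = (\<Sum>i<n. (\<Sum>j<n. (snd p i j - snd q i j)\<^sup>2) + (fst p i - fst q i)\<^sup>2)"
    by (simp add: fcoord_def)
  also have "\<dots> = (\<Sum>i<n. \<Sum>j<n. (snd p i j - snd q i j)\<^sup>2) + vcsq n (fst p) (fst q)"
    by (simp add: sum.distrib csq_def)
  also have "(\<Sum>i<n. \<Sum>j<n. (snd p i j - snd q i j)\<^sup>2) = mcsq n (snd p) (snd q)"
    unfolding csq_def by (subst sum.cartesian_product) (simp add: case_prod_unfold)
  finally show ?thesis .
qed

lemma flags_sets: "{p\<in>space (flagM n). p \<in> flags n k} \<in> sets (flagM n)"
proof -
  have "{p\<in>space (flagM n). p \<in> flags n k} = {p\<in>space (flagM n). snd p \<in> grass n k \<and>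
     (\<forall>i\<in>{..<n}. (\<Sum>j<n. snd p i j * fst p j) = fst p i) \<and> nrm n (fst p) = 1}"
  proof (intro Collect_cong conj_cong refl)
    fix p assume "p \<in> space (flagM n)"
    then have p: "fst p \<in> vecs n" by (auto simp: space_pair_measure)
    have "mv n (snd p) (fst p) = fst p \<longleftrightarrow> (\<forall>i<n. mv n (snd p) (fst p) i = fst p i)"
      by (metis vecs_eqI[OF vecs_closed(1) p])
    then show "p \<in> flags n k \<longleftrightarrow> snd p \<in> grass n k \<and> (\<forall>i\<in>{..<n}. (\<Sum>j<n. snd p i j * fst p j) = fst p i) \<and> nrm n (fst p) = 1"
      using p by (auto simp: flags_def usphere_def)
  qed
  also have "\<dots> \<in> sets (flagM n)"
    unfolding pred_def[symmetric]
    by (intro pred_intros_logic(2,3) pred_intros_finite pred_eq_real borel_measurable_sum borel_measurable_times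
        borel_measurable_const measurable_flag_fst measurable_flag_snd measurable_compose[OF measurable_fst measurable_nrm]
        pred_sets2[OF grass_sets measurable_snd]) simp_all
  finally show ?thesis .
qed

text \<open>The orthogonal group acts transitively on flags, and isometrically for the sum of the
  two squared distances. This compares joint laws of direction and subspace without disintegrating
  them.\<close>

lemma flag_measure_eqI:
  assumes s: "sets \<mu> = sets (flagM n)" "sets \<nu> = sets (flagM n)" and p: "prob_space \<mu>" "prob_space \<nu>"
    and X: "AE p in \<mu>. p \<in> flags n k" "AE p in \<nu>. p \<in> flags n k"
    and inv: "\<And>U. U \<in> orth n \<Longrightarrow> distr \<mu> (flagM n) (flag_map n U) = \<mu>"
      "\<And>U. U \<in> orth n \<Longrightarrow> distr \<nu> (flagM n) (flag_map n U) = \<nu>"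
  shows "\<mu> = \<nu>"
proof (rule invariant_eqI[OF coords_flagM s p X, where \<T>="flag_map n ` orth n"])
  fix T assume "T \<in> flag_map n ` orth n"
  then obtain U where U: "U \<in> orth n" "T = flag_map n U" by blast
  show "T \<in> flagM n \<rightarrow>\<^sub>M flagM n" "distr \<mu> (flagM n) T = \<mu>" "distr \<nu> (flagM n) T = \<nu>"
    unfolding U(2) by (rule measurable_flag_map inv[OF U(1)])+
  show "csq ({..<n} \<times> {..<Suc n}) (fcoord n) (T p) (T w) = csq ({..<n} \<times> {..<Suc n}) (fcoord n) p w" for p w
    unfolding csq_flag U(2) by (simp add: flag_map_def csq_mat_orth[OF U(1)] csq_vec_orth[OF U(1)])
next
  fix p q assume pq: "p \<in> flags n k" "q \<in> flags n k"
  obtain U where U: "U \<in> orth n" "mv n U (fst p) = fst q" "mm n (mm n U (snd p)) (tr n U) = snd q"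
    using orth_transitive_flags[of "snd p" n k "snd q" "fst p" "fst q"] usphere_ip[of "fst p" n "snd p"] usphere_ip[of "fst q" n "snd q"] pq
    unfolding flags_def by blast
  then have "flag_map n U p = q" by (simp add: flag_map_def conj_mat_def prod_eq_iff)
  then show "\<exists>T\<in>flag_map n ` orth n. T p = q" using U(1) by blast
qed

lemma cols_component: "j < k \<Longrightarrow> distr (cols n k) (gm n) (\<lambda>G. G j) = gm n"
  unfolding cols_def by (rule distr_PiM_component) (auto intro: prob_gm)

lemma measurable_cols_gm: "j < k \<Longrightarrow> (\<lambda>G. G j) \<in> cols n k \<rightarrow>\<^sub>M gm n"
  unfolding cols_def by (rule measurable_component_singleton) simp

text \<open>Both sides integrate \<open>H\<close> against an invariant measure on flags: on the left a column of \<open>G\<close> inside the span of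
  \<open>G\<close>, size-biased by its length, and on the right an independent uniform direction in that span.\<close>
lemma flag_identity:
  assumes k: "k \<le> n" and j: "j < k" and H: "H \<in> borel_measurable (flagM n)"
  shows "(\<integral>\<^sup>+G. ennreal (nrm n (G j)) * H (normv n (G j), gs n G k) \<partial>cols n k)
    = ennreal (\<integral>x. nrm n x \<partial>gm n) * (\<integral>\<^sup>+G. \<integral>\<^sup>+g. H (normv n (mv n (gs n G k) g), gs n G k) \<partial>gm n \<partial>cols n k)"
proof -
  interpret gm: prob_space "gm n" by (rule prob_gm)
  interpret C: prob_space "cols n k" by (rule prob_cols)
  interpret P: pair_prob_space "cols n k" "gm n" ..
  define c where "c = (\<integral>x. nrm n x \<partial>gm n)"
  have n1: "n \<ge> 1" using k j by simp
  have "0 < sqrt (2 / pi) * sqrt (real n)" using n1 by simp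
  then have c0: "c > 0" unfolding c_def using integral_gm_nrm_ge[OF n1] by linarith
  have nm: "(\<lambda>G. nrm n (G j)) \<in> borel_measurable (cols n k)"
    by (rule measurable_compose[OF measurable_cols_component[OF j] measurable_nrm])
  \<comment> \<open>Size bias as a density; dividing by the mean length \<open>c\<close> gives total
    mass 1.\<close>
  define w where "w G = ennreal (nrm n (G j) / c)" for G :: rmat
  have wm: "w \<in> borel_measurable (cols n k)" unfolding w_def using nm by measurable
  define f1 where "f1 q = (normv n (mv n (gs n (fst q) k) (snd q)), gs n (fst q) k)" for q :: "rmat \<times> rvec"
  define f2 where "f2 G = (normv n (G j), gs n G k)" for G
  have mvm: "(\<lambda>q. mv n (gs n (fst q) k) (snd q)) \<in> cols n k \<Otimes>\<^sub>M gm n \<rightarrow>\<^sub>M vecM n"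
    using measurable_compose[OF measurable_Pair[OF measurable_compose[OF measurable_fst measurable_gs] measurable_snd] measurable_mv_pair]
    by simp
  have f1m: "f1 \<in> cols n k \<Otimes>\<^sub>M gm n \<rightarrow>\<^sub>M flagM n"
    unfolding f1_def by (intro measurable_Pair measurable_compose[OF mvm measurable_normv] measurable_compose[OF measurable_fst measurable_gs])
  have f2m: "f2 \<in> cols n k \<rightarrow>\<^sub>M flagM n"
    unfolding f2_def by (intro measurable_Pair measurable_compose[OF measurable_cols_component[OF j] measurable_normv] measurable_gs)
  have f2m': "f2 \<in> density (cols n k) w \<rightarrow>\<^sub>M flagM n" using f2m by simp
  let ?\<mu> = "distr (cols n k \<Otimes>\<^sub>M gm n) (flagM n) f1"
  let ?\<nu> = "distr (density (cols n k) w) (flagM n) f2"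
  have dens: "prob_space (density (cols n k) w)"
  proof (rule prob_spaceI)
    have "emeasure (density (cols n k) w) (space (density (cols n k) w)) = (\<integral>\<^sup>+G. w G \<partial>cols n k)"
      using wm by (simp add: emeasure_density cong: nn_integral_cong)
    also have "\<dots> = (\<integral>\<^sup>+x. ennreal (nrm n x / c) \<partial>distr (cols n k) (gm n) (\<lambda>G. G j))"
      unfolding w_def by (subst nn_integral_distr[OF measurable_cols_gm[OF j]]) auto
    also have "\<dots> = (\<integral>\<^sup>+x. ennreal (nrm n x / c) \<partial>gm n)" by (simp add: cols_component[OF j])
    also have "\<dots> = ennreal (\<integral>x. nrm n x / c \<partial>gm n)"
      using c0 ip_self(3) by (intro nn_integral_eq_integral) (auto intro: integrable_gm_nrm)
    also have "\<dots> = 1" using c0 by (simp add: c_def)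
    finally show "emeasure (density (cols n k) w) (space (density (cols n k) w)) = 1" .
  qed
  have eq: "?\<mu> = ?\<nu>"
  proof (rule flag_measure_eqI)
    show "prob_space ?\<mu>" by (rule P.prob_space_distr[OF f1m])
    show "prob_space ?\<nu>" by (rule prob_space.prob_space_distr[OF dens f2m'])
    have "AE G in cols n k. AE g in gm n. f1 (G, g) \<in> flags n k"
      using gs_grass_AE[OF k]
    proof eventually_elim
      case (elim G)
      then have p: "proj n (gs n G k)" "mtrace n (gs n G k) \<noteq> 0" using j by (auto simp: grass_proj)
      from gm_proj_nonzero[OF p] show ?case
        by eventually_elim (use elim proj_normv_usphere[OF p(1)] in \<open>auto simp: f1_def flags_def\<close>)
    qed
    moreover have "{q\<in>space (cols n k \<Otimes>\<^sub>M gm n). f1 q \<in> flags n k} \<in> sets (cols n k \<Otimes>\<^sub>M gm n)"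
    proof -
      have "{q\<in>space (cols n k \<Otimes>\<^sub>M gm n). f1 q \<in> flags n k} = f1 -` {p\<in>space (flagM n). p \<in> flags n k} \<inter> space (cols n k \<Otimes>\<^sub>M gm n)"
        using measurable_space[OF f1m] by auto
      then show ?thesis using measurable_sets[OF f1m flags_sets] by simp
    qed
    ultimately have "AE q in cols n k \<Otimes>\<^sub>M gm n. f1 q \<in> flags n k" by (rule P.AE_pair_measure[rotated])
    then show "AE p in ?\<mu>. p \<in> flags n k" by (subst AE_distr_iff[OF f1m flags_sets])
    \<comment> \<open>A zero column has weight 0, so the case in which normalising fails to give a
      unit vector is invisible to this density.\<close>
    have "AE G in density (cols n k) w. f2 G \<in> flags n k"
    proof (subst AE_density[OF wm])
      show "AE G in cols n k. 0 < w G \<longrightarrow> f2 G \<in> flags n k"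
        using gs_grass_AE[OF k] AE_space
      proof eventually_elim
        case (elim G)
        show ?case
        proof
          assume "0 < w G"
          then have "nrm n (G j) \<noteq> 0" by (auto simp: w_def)
          moreover have "mv n (gs n G k) (G j) = G j" using gs_props[of k G n] space_cols[OF elim(2)] j by blast
          ultimately show "f2 G \<in> flags n k"
            using elim(1) nrm_normv by (simp add: f2_def flags_def usphere_def normv_def mv_vsmul)
        qed
      qed
    qed
    then show "AE p in ?\<nu>. p \<in> flags n k" by (subst AE_distr_iff[OF f2m' flags_sets])
    fix U assume U: "U \<in> orth n"
    let ?C = "compose {..<k} (mv n U)"
    have mvg: "mv n U \<in> gm n \<rightarrow>\<^sub>M gm n" using measurable_mv by (simp add: measurable_cong_sets[OF sets_gm sets_gm])
    have pairU: "distr (cols n k \<Otimes>\<^sub>M gm n) (cols n k \<Otimes>\<^sub>M gm n) (\<lambda>(G, g). (?C G, mv n U g)) = cols n k \<Otimes>\<^sub>M gm n"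
      using pair_measure_distr[OF measurable_compose_mv[of k n U] mvg] gm.sigma_finite_measure_axioms
      by (simp add: gm_orth'[OF U] cols_orth[OF U])
    have pairUm: "(\<lambda>(G, g). (?C G, mv n U g)) \<in> cols n k \<Otimes>\<^sub>M gm n \<rightarrow>\<^sub>M cols n k \<Otimes>\<^sub>M gm n"
      unfolding case_prod_unfold
      by (intro measurable_Pair measurable_compose[OF measurable_fst measurable_compose_mv] measurable_compose[OF measurable_snd mvg])
    have "distr ?\<mu> (flagM n) (flag_map n U) = distr (cols n k \<Otimes>\<^sub>M gm n) (flagM n) (\<lambda>q. flag_map n U (f1 q))"
      by (subst distr_distr[OF measurable_flag_map f1m]) (simp add: comp_def)
    also have "\<dots> = distr (cols n k \<Otimes>\<^sub>M gm n) (flagM n) (\<lambda>q. f1 (case q of (G, g) \<Rightarrow> (?C G, mv n U g)))"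
    proof (rule distr_cong[OF refl refl])
      fix q assume q: "q \<in> space (cols n k \<Otimes>\<^sub>M gm n)"
      then have G: "fst q \<in> space (cols n k)" and g: "snd q \<in> vecs n" by (auto simp: space_pair_measure)
      show "flag_map n U (f1 q) = f1 (case q of (G, g) \<Rightarrow> (?C G, mv n U g))"
        by (simp add: case_prod_unfold f1_def flag_map_def gs_compose[OF U G] mv_conj_mat[OF U g] normv_orth[OF U])
    qed
    also have "\<dots> = distr (distr (cols n k \<Otimes>\<^sub>M gm n) (cols n k \<Otimes>\<^sub>M gm n) (\<lambda>(G, g). (?C G, mv n U g))) (flagM n) f1"
      by (subst distr_distr[OF f1m pairUm]) (simp add: comp_def)
    finally show "distr ?\<mu> (flagM n) (flag_map n U) = ?\<mu>" by (simp add: pairU)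
    \<comment> \<open>The weight depends only on the length of one column, and orthogonal maps keep
      lengths, so the reweighted law of the columns is still invariant.\<close>
    have densU: "distr (density (cols n k) w) (cols n k) ?C = density (cols n k) w"
    proof -
      have wc: "w \<circ> ?C \<in> borel_measurable (cols n k)"
        unfolding comp_def by (rule measurable_compose[OF measurable_compose_mv wm])
      have "density (cols n k) w = density (cols n k) (w \<circ> ?C)"
        by (rule density_cong[OF wm wc AE_I2]) (simp add: w_def compose_def orth_nrm[OF U] j)
      then have "distr (density (cols n k) w) (cols n k) ?C = distr (density (cols n k) (\<lambda>x. w (?C x))) (cols n k) ?C"
        by (simp add: comp_def)
      also have "\<dots> = density (distr (cols n k) (cols n k) ?C) w"
        by (rule density_distr[symmetric, OF _ measurable_compose_mv]) (use wm in simp)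
      finally show ?thesis by (simp add: cols_orth[OF U])
    qed
    have Cm: "?C \<in> density (cols n k) w \<rightarrow>\<^sub>M cols n k" using measurable_compose_mv by simp
    have "distr ?\<nu> (flagM n) (flag_map n U) = distr (density (cols n k) w) (flagM n) (\<lambda>G. flag_map n U (f2 G))"
      by (subst distr_distr[OF measurable_flag_map f2m']) (simp add: comp_def)
    also have "\<dots> = distr (density (cols n k) w) (flagM n) (\<lambda>G. f2 (?C G))"
    proof (rule distr_cong[OF refl refl])
      fix G assume "G \<in> space (density (cols n k) w)"
      then have G: "G \<in> space (cols n k)" by simp
      show "flag_map n U (f2 G) = f2 (?C G)"
        by (simp add: f2_def flag_map_def gs_compose[OF U G] normv_orth[OF U, symmetric]) (simp add: compose_def j)
    qed
    also have "\<dots> = distr (distr (density (cols n k) w) (cols n k) ?C) (flagM n) f2"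
      by (subst distr_distr[OF f2m Cm]) (simp add: comp_def)
    finally show "distr ?\<nu> (flagM n) (flag_map n U) = ?\<nu>" by (simp add: densU)
  qed simp_all
  have "(\<integral>\<^sup>+p. H p \<partial>?\<nu>) = (\<integral>\<^sup>+G. w G * H (f2 G) \<partial>cols n k)"
    using H wm measurable_compose[OF f2m H] by (simp add: nn_integral_distr[OF f2m'] nn_integral_density)
  moreover have "(\<integral>\<^sup>+p. H p \<partial>?\<mu>) = (\<integral>\<^sup>+G. \<integral>\<^sup>+g. H (f1 (G, g)) \<partial>gm n \<partial>cols n k)"
  proof -
    have "(\<integral>\<^sup>+p. H p \<partial>?\<mu>) = (\<integral>\<^sup>+q. H (f1 q) \<partial>(cols n k \<Otimes>\<^sub>M gm n))" using H by (simp add: nn_integral_distr[OF f1m])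
    then show ?thesis using gm.nn_integral_fst[OF measurable_compose[OF f1m H]] by simp
  qed
  ultimately have e: "(\<integral>\<^sup>+G. w G * H (f2 G) \<partial>cols n k) = (\<integral>\<^sup>+G. \<integral>\<^sup>+g. H (f1 (G, g)) \<partial>gm n \<partial>cols n k)"
    using eq by simp
  have "(\<integral>\<^sup>+G. ennreal (nrm n (G j)) * H (normv n (G j), gs n G k) \<partial>cols n k) = (\<integral>\<^sup>+G. ennreal c * (w G * H (f2 G)) \<partial>cols n k)"
  proof (rule nn_integral_cong)
    fix G
    have "ennreal (nrm n (G j)) = ennreal c * w G"
      using c0 ip_self(3) by (simp add: w_def ennreal_mult'[symmetric])
    then show "ennreal (nrm n (G j)) * H (normv n (G j), gs n G k) = ennreal c * (w G * H (f2 G))"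
      by (simp add: f2_def mult.assoc)
  qed
  also have "\<dots> = ennreal c * (\<integral>\<^sup>+G. w G * H (f2 G) \<partial>cols n k)"
    using wm measurable_compose[OF f2m H] by (intro nn_integral_cmult) auto
  also have "\<dots> = ennreal c * (\<integral>\<^sup>+G. \<integral>\<^sup>+g. H (normv n (mv n (gs n G k) g), gs n G k) \<partial>gm n \<partial>cols n k)"
    unfolding e by (simp add: f1_def)
  finally show ?thesis by (simp add: c_def)
qed

section \<open>Concentration of the mean width\<close>

context body
begin

text \<open>A form of the mean width of the projected body that makes sense for every matrix
  \<open>P\<close>, which yields a measurable and bounded function on all matrices. On a
  Grassmannian with \<open>k \<ge> 1\<close> it agrees with the mean width.\<close>

definition \<Phi> :: "rmat \<Rightarrow> real" where
  "\<Phi> P = (\<integral>g. h (normv n (mv n P g)) \<partial>gm n)"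

abbreviation c where "c \<equiv> (\<integral>x. nrm n x \<partial>gm n)"
abbreviation m where "m \<equiv> (\<integral>x. h x \<partial>gm n)"

lemma h_normv_le: "h (normv n x) \<le> R"
proof (cases "nrm n x = 0")
  case True
  then have "nrm n (normv n x) = 0" by (simp add: normv_def nrm_def ip_def)
  then show ?thesis using h_le[of "normv n x"] R_nonneg by simp
next
  case False
  then show ?thesis using h_le[of "normv n x"] nrm_normv by simp
qed

lemma h_homogeneous:
  assumes "x \<in> vecs n"
  shows "nrm n x * h (normv n x) = h x"
proof (cases "nrm n x = 0")
  case True
  then have "h x \<le> 0" using h_le[of x] by simp
  then show ?thesis using True h_nonneg[of x] by simp
next
  case False
  have "vsmul n (nrm n x) (normv n x) = x"
    by (rule vecs_eqI[OF vecs_closed(2) assms]) (use False in \<open>simp add: normv_def\<close>)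
  then show ?thesis using h_vsmul[OF ip_self(3)[of n x], of "normv n x"] by simp
qed

lemma measurable_h_normv_mv: "(\<lambda>g. h (normv n (mv n P g))) \<in> borel_measurable (gm n)"
  by (rule measurable_compose[OF measurable_normv_mv measurable_h])

lemma integrable_h_normv_mv: "integrable (gm n) (\<lambda>g. h (normv n (mv n P g)))"
proof -
  interpret gm: prob_space "gm n" by (rule prob_gm)
  show ?thesis
    by (rule gm.integrable_const_bound[where B=R]) (use h_normv_le h_nonneg measurable_h_normv_mv in auto)
qed

lemma \<Phi>_bounds: "0 \<le> \<Phi> P" "\<Phi> P \<le> R"
proof -
  interpret gm: prob_space "gm n" by (rule prob_gm)
  show "0 \<le> \<Phi> P" unfolding \<Phi>_def by (intro integral_nonneg_AE AE_I2 h_nonneg)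
  have "\<Phi> P \<le> (\<integral>g. R \<partial>gm n)"
    unfolding \<Phi>_def by (intro integral_mono integrable_h_normv_mv h_normv_le) auto
  then show "\<Phi> P \<le> R" using gm.prob_space by simp
qed

lemma nn_\<Phi>: "(\<integral>\<^sup>+g. ennreal (h (normv n (mv n P g))) \<partial>gm n) = ennreal (\<Phi> P)"
  unfolding \<Phi>_def by (rule nn_integral_eq_integral[OF integrable_h_normv_mv]) (simp add: h_nonneg)

lemma measurable_\<Phi> [measurable]: "\<Phi> \<in> borel_measurable (matM n)"
proof -
  interpret gm: prob_space "gm n" by (rule prob_gm)
  have "(\<lambda>q. h (normv n (mv n (fst q) (snd q)))) \<in> borel_measurable (matM n \<Otimes>\<^sub>M gm n)"
    by (rule measurable_compose[OF measurable_compose[OF measurable_mv_pair measurable_normv] measurable_h])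
  then show ?thesis
    unfolding \<Phi>_def by (intro gm.borel_measurable_lebesgue_integral) (simp add: case_prod_unfold)
qed

lemma supp_proj: "tr n P = P \<Longrightarrow> mv n P y = y \<Longrightarrow> supp n (mv n P ` A) y = h y"
  by (simp add: supp_def image_image ip_mv)

text \<open>The set \<open>B\<close> is left free to cover two cases: the projected body on a
  subspace and, for the identity matrix, \<open>A\<close> itself.\<close>

lemma mwidth_eq_\<Phi>:
  assumes P: "P \<in> grass n k" and k: "k \<ge> 1" and B: "\<And>y. y \<in> usphere n P \<Longrightarrow> supp n B y = h y"
  shows "mwidth n P B = \<Phi> P"
proof -
  let ?\<mu> = "distr (gm n) (vecM n) (\<lambda>g. normv n (mv n P g))"
  note U = unif_sphere_eq[OF P k]
  have "mwidth n P B = (\<integral>y. h y \<partial>restrict_space ?\<mu> (usphere n P))"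
    unfolding mwidth_def U(1)
    by (rule Bochner_Integration.integral_cong) (auto simp: space_restrict_space B)
  also have "\<dots> = (\<integral>y. h y \<partial>?\<mu>)"
    by (rule integral_restrict_AE) (use usphere_sets U(2) measurable_h in auto)
  also have "\<dots> = \<Phi> P" unfolding \<Phi>_def by (rule integral_distr[OF measurable_normv_mv measurable_h])
  finally show ?thesis .
qed

lemma mwidth_grass: "P \<in> grass n k \<Longrightarrow> k \<ge> 1 \<Longrightarrow> mwidth n P (mv n P ` A) = \<Phi> P"
  by (rule mwidth_eq_\<Phi>) (auto intro!: supp_proj simp: grass_def usphere_def)

text \<open>The weak form of E(h(g_j) | F) = c \<Phi>(F): bounded nonnegative test functions of the
  subspace stand in for conditioning. Homogeneity of \<open>h\<close> splits off the length of the
  column, which becomes the size bias.\<close>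

lemma h_identity:
  assumes k: "k \<le> n" and j: "j < k" and \<psi>: "\<psi> \<in> borel_measurable (matM n)" "\<And>P. 0 \<le> \<psi> P" "\<And>P. \<psi> P \<le> B"
  shows "integrable (cols n k) (\<lambda>G. h (G j) * \<psi> (gs n G k))"
    "(\<integral>G. h (G j) * \<psi> (gs n G k) \<partial>cols n k) = c * (\<integral>G. \<Phi> (gs n G k) * \<psi> (gs n G k) \<partial>cols n k)"
proof -
  interpret gm: prob_space "gm n" by (rule prob_gm)
  interpret C: prob_space "cols n k" by (rule prob_cols)
  have hm: "(\<lambda>G. h (G j)) \<in> borel_measurable (cols n k)"
    by (rule measurable_compose[OF measurable_cols_component[OF j] measurable_h])
  have pm: "(\<lambda>G. \<psi> (gs n G k)) \<in> borel_measurable (cols n k)"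
    by (rule measurable_compose[OF measurable_gs \<psi>(1)])
  have fm: "(\<lambda>G. \<Phi> (gs n G k)) \<in> borel_measurable (cols n k)"
    by (rule measurable_compose[OF measurable_gs measurable_\<Phi>])
  have c0: "0 \<le> c" by (intro integral_nonneg_AE AE_I2 ip_self(3))
  define H where "H p = ennreal (h (fst p)) * ennreal (\<psi> (snd p))" for p
  have Hm: "H \<in> borel_measurable (flagM n)"
    unfolding H_def
    using measurable_compose[OF measurable_fst measurable_h] measurable_compose[OF measurable_snd \<psi>(1)] by measurable
  have "(\<integral>\<^sup>+G. ennreal (h (G j) * \<psi> (gs n G k)) \<partial>cols n k) = (\<integral>\<^sup>+G. ennreal (nrm n (G j)) * H (normv n (G j), gs n G k) \<partial>cols n k)"
  proof (rule nn_integral_cong)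
    fix G assume "G \<in> space (cols n k)"
    then have "h (G j) = nrm n (G j) * h (normv n (G j))" using h_homogeneous space_cols j by metis
    then show "ennreal (h (G j) * \<psi> (gs n G k)) = ennreal (nrm n (G j)) * H (normv n (G j), gs n G k)"
      using ip_self(3) h_nonneg \<psi>(2) by (simp add: H_def ennreal_mult'[symmetric] mult.assoc)
  qed
  also have "\<dots> = ennreal c * (\<integral>\<^sup>+G. \<integral>\<^sup>+g. H (normv n (mv n (gs n G k) g), gs n G k) \<partial>gm n \<partial>cols n k)"
    by (rule flag_identity[OF k j Hm])
  also have "(\<integral>\<^sup>+G. \<integral>\<^sup>+g. H (normv n (mv n (gs n G k) g), gs n G k) \<partial>gm n \<partial>cols n k)
      = (\<integral>\<^sup>+G. ennreal (\<Phi> (gs n G k) * \<psi> (gs n G k)) \<partial>cols n k)"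
  proof (rule nn_integral_cong)
    fix G
    have "(\<integral>\<^sup>+g. H (normv n (mv n (gs n G k) g), gs n G k) \<partial>gm n) = ennreal (\<Phi> (gs n G k)) * ennreal (\<psi> (gs n G k))"
      unfolding H_def fst_conv snd_conv nn_\<Phi>[symmetric]
      by (rule nn_integral_multc) (use measurable_h_normv_mv in measurable)
    then show "(\<integral>\<^sup>+g. H (normv n (mv n (gs n G k) g), gs n G k) \<partial>gm n) = ennreal (\<Phi> (gs n G k) * \<psi> (gs n G k))"
      using \<Phi>_bounds(1) \<psi>(2) by (simp add: ennreal_mult'[symmetric])
  qed
  finally have key: "(\<integral>\<^sup>+G. ennreal (h (G j) * \<psi> (gs n G k)) \<partial>cols n k)
      = ennreal c * (\<integral>\<^sup>+G. ennreal (\<Phi> (gs n G k) * \<psi> (gs n G k)) \<partial>cols n k)" .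
  have "\<bar>\<Phi> P * \<psi> P\<bar> \<le> R * B" for P
    using \<Phi>_bounds \<psi>(2,3) R_nonneg by (auto simp: abs_mult intro!: mult_mono)
  then have fi: "integrable (cols n k) (\<lambda>G. \<Phi> (gs n G k) * \<psi> (gs n G k))"
    using fm pm by (intro C.integrable_const_bound[where B="R * B"]) auto
  have "(\<integral>\<^sup>+G. ennreal (\<Phi> (gs n G k) * \<psi> (gs n G k)) \<partial>cols n k) = ennreal (\<integral>G. \<Phi> (gs n G k) * \<psi> (gs n G k) \<partial>cols n k)"
    by (rule nn_integral_eq_integral[OF fi]) (simp add: \<Phi>_bounds \<psi>(2))
  then have key2: "(\<integral>\<^sup>+G. ennreal (h (G j) * \<psi> (gs n G k)) \<partial>cols n k) = ennreal (c * (\<integral>G. \<Phi> (gs n G k) * \<psi> (gs n G k) \<partial>cols n k))"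
    using key c0 by (simp add: ennreal_mult')
  show "integrable (cols n k) (\<lambda>G. h (G j) * \<psi> (gs n G k))"
    using hm pm key2 h_nonneg \<psi>(2) by (intro integrableI_bounded) (auto simp: abs_mult)
  have "0 \<le> (\<integral>G. \<Phi> (gs n G k) * \<psi> (gs n G k) \<partial>cols n k)"
    by (intro integral_nonneg_AE AE_I2) (simp add: \<Phi>_bounds \<psi>(2))
  then show "(\<integral>G. h (G j) * \<psi> (gs n G k) \<partial>cols n k) = c * (\<integral>G. \<Phi> (gs n G k) * \<psi> (gs n G k) \<partial>cols n k)"
    using hm pm h_nonneg \<psi>(2) c0 by (subst integral_eq_nn_integral) (auto simp: key2)
qed

section \<open>Gaussian means against spherical means\<close>

lemma integral_h_cols: "j < k \<Longrightarrow> (\<integral>G. h (G j) \<partial>cols n k) = m"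
  using integral_distr[OF measurable_cols_gm, of j k h n] cols_component[of j k n] measurable_h
  by (simp add: measurable_cong_sets[OF sets_gm refl])

lemma grass_full: "P \<in> grass n n \<Longrightarrow> P = idm n"
proof -
  assume "P \<in> grass n n"
  then have P: "proj n P" "mtrace n P = real n" by (auto simp: grass_proj)
  have "msub n (idm n) P = mzero n"
    using P by (intro proj_mtrace_0 proj_msub proj_idm) (auto simp: proj_def)
  moreover have "P \<in> mats n" using P by (simp add: proj_def)
  ultimately have "idm n = P" using msub_eq_mzero[OF mats_closed(3)] by blast
  then show "P = idm n" by (rule sym)
qed

text \<open>The case \<open>k = n\<close> of \<open>h_identity\<close> with constant test function:
  \<open>n\<close> Gaussian columns almost surely span the whole space, so the subspace is
  deterministic.\<close>

lemma m_eq_wA: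
  assumes "n \<ge> 1"
  shows "m = c * wA n A"
proof -
  interpret C: prob_space "cols n n" by (rule prob_cols)
  have idg: "idm n \<in> grass n n" by (simp add: grass_proj proj_idm)
  have w: "wA n A = \<Phi> (idm n)" unfolding wA_def by (rule mwidth_eq_\<Phi>[OF idg assms]) simp
  have "m = (\<integral>G. h (G 0) * 1 \<partial>cols n n)" using integral_h_cols[of 0 n] assms by simp
  also have "\<dots> = c * (\<integral>G. \<Phi> (gs n G n) * 1 \<partial>cols n n)"
    using assms by (intro h_identity(2)[where \<psi>="\<lambda>_. 1" and B=1]) auto
  also have "(\<integral>G. \<Phi> (gs n G n) * 1 \<partial>cols n n) = (\<integral>G. \<Phi> (idm n) \<partial>cols n n)"
  proof (rule integral_cong_AE)
    show "AE G in cols n n. \<Phi> (gs n G n) * 1 = \<Phi> (idm n)"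
      using gs_grass_AE[OF order_refl] by eventually_elim (auto dest: grass_full)
    show "(\<lambda>G. \<Phi> (gs n G n) * 1) \<in> borel_measurable (cols n n)"
      using measurable_compose[OF measurable_gs measurable_\<Phi>] by simp
  qed simp
  finally show ?thesis by (simp add: w C.prob_space)
qed

text \<open>A crude bound that does not depend on \<open>P\<close>; it makes the exponential an
  admissible bounded test function.\<close>

lemma exp_\<Phi>_le: "exp (s * (c * \<Phi> P - m)) \<le> exp (\<bar>s\<bar> * (c * R + \<bar>m\<bar>))"
proof -
  have c0: "0 \<le> c" by (intro integral_nonneg_AE AE_I2 ip_self(3))
  have "c * \<Phi> P \<le> c * R" "0 \<le> c * \<Phi> P" using c0 \<Phi>_bounds[of P] by (auto intro: mult_left_mono)
  then have "\<bar>c * \<Phi> P - m\<bar> \<le> c * R + \<bar>m\<bar>" by linarith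
  then have "\<bar>s\<bar> * \<bar>c * \<Phi> P - m\<bar> \<le> \<bar>s\<bar> * (c * R + \<bar>m\<bar>)" by (rule mult_left_mono) simp
  then have "s * (c * \<Phi> P - m) \<le> \<bar>s\<bar> * (c * R + \<bar>m\<bar>)"
    unfolding abs_mult[symmetric] by linarith
  then show ?thesis by simp
qed

text \<open>Jensen in weak form: exp b is at least exp a * (1 + b - a), taken with a =
  \<open>\<tau> * (c * \<Phi> (gs n G k) - m)\<close> and b = \<open>\<tau> * (f G - m)\<close>,
  where \<open>f\<close> averages \<open>h\<close> over the columns. Since exp a is a function of
  the subspace, the linear term has mean zero by \<open>h_identity\<close>.\<close>

lemma \<Phi>_subgaussian:
  assumes k: "1 \<le> k" "k \<le> n"
  shows "(\<integral>G. exp (\<tau> * (c * \<Phi> (gs n G k) - m)) \<partial>cols n k) \<le> exp (\<tau>\<^sup>2 * pi\<^sup>2 * R\<^sup>2 / (8 * real k))"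
proof -
  interpret gm: prob_space "gm n" by (rule prob_gm)
  interpret C: prob_space "cols n k" by (rule prob_cols)
  have c0: "0 \<le> c" by (intro integral_nonneg_AE AE_I2 ip_self(3))
  have k0: "real k > 0" using k by simp
  define \<psi> where "\<psi> P = exp (\<tau> * (c * \<Phi> P - m))" for P
  define f where "f G = (\<Sum>j<k. h (G j)) / real k" for G
  define B where "B = exp (\<bar>\<tau>\<bar> * (c * R + \<bar>m\<bar>))"
  have \<psi>m: "\<psi> \<in> borel_measurable (matM n)" unfolding \<psi>_def by measurable
  have \<psi>0: "0 \<le> \<psi> P" for P by (simp add: \<psi>_def)
  have \<psi>B: "\<psi> P \<le> B" for P unfolding \<psi>_def B_def by (rule exp_\<Phi>_le)
  note I = h_identity[OF k(2) _ \<psi>m \<psi>0 \<psi>B]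
  have pm: "(\<lambda>G. \<psi> (gs n G k)) \<in> borel_measurable (cols n k)"
    by (rule measurable_compose[OF measurable_gs \<psi>m])
  have fm: "(\<lambda>G. \<Phi> (gs n G k)) \<in> borel_measurable (cols n k)"
    by (rule measurable_compose[OF measurable_gs measurable_\<Phi>])
  have hm: "(\<lambda>G. h (G j)) \<in> borel_measurable (cols n k)" if "j < k" for j
    by (rule measurable_compose[OF measurable_cols_component[OF that] measurable_h])
  have fGm: "f \<in> borel_measurable (cols n k)"
    unfolding f_def using hm by (intro borel_measurable_divide borel_measurable_sum) auto
  have i1: "integrable (cols n k) (\<lambda>G. \<psi> (gs n G k))"
    using pm \<psi>0 \<psi>B by (intro C.integrable_const_bound[where B=B]) auto
  have "\<bar>\<Phi> P * \<psi> P\<bar> \<le> R * B" for P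
    using \<Phi>_bounds \<psi>0 \<psi>B R_nonneg by (auto simp: abs_mult intro!: mult_mono)
  then have i2: "integrable (cols n k) (\<lambda>G. \<Phi> (gs n G k) * \<psi> (gs n G k))"
    using fm pm by (intro C.integrable_const_bound[where B="R * B"]) auto
  have fe: "f G * \<psi> (gs n G k) = (\<Sum>j<k. h (G j) * \<psi> (gs n G k)) / real k" for G
    by (simp add: f_def sum_distrib_right)
  have i3: "integrable (cols n k) (\<lambda>G. f G * \<psi> (gs n G k))"
    unfolding fe using I(1) by (intro integrable_divide Bochner_Integration.integrable_sum) auto
  have fint: "(\<integral>G. f G * \<psi> (gs n G k) \<partial>cols n k) = c * (\<integral>G. \<Phi> (gs n G k) * \<psi> (gs n G k) \<partial>cols n k)"
  proof -
    have "(\<integral>G. f G * \<psi> (gs n G k) \<partial>cols n k) = (\<integral>G. (\<Sum>j<k. h (G j) * \<psi> (gs n G k)) \<partial>cols n k) / real k"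
      unfolding fe by simp
    also have "(\<integral>G. (\<Sum>j<k. h (G j) * \<psi> (gs n G k)) \<partial>cols n k) = (\<Sum>j<k. \<integral>G. h (G j) * \<psi> (gs n G k) \<partial>cols n k)"
      using I(1) by (intro Bochner_Integration.integral_sum) auto
    also have "\<dots> = real k * (c * (\<integral>G. \<Phi> (gs n G k) * \<psi> (gs n G k) \<partial>cols n k))"
      using I(2) by simp
    finally show ?thesis using k0 by simp
  qed
  interpret PS: product_sigma_finite "\<lambda>_::nat. gm n"
    by (intro product_sigma_finite.intro gm.sigma_finite_measure_axioms)
  have eX: "(\<integral>\<^sup>+G. ennreal (exp (\<tau> * (f G - m))) \<partial>cols n k) \<le> ennreal (exp (\<tau>\<^sup>2 * pi\<^sup>2 * R\<^sup>2 / (8 * real k)))"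
  proof -
    have "(\<integral>\<^sup>+G. ennreal (exp (\<tau> * (f G - m))) \<partial>cols n k) = (\<integral>\<^sup>+G. (\<Prod>j<k. ennreal (exp (\<tau> / real k * (h (G j) - m)))) \<partial>cols n k)"
    proof (rule nn_integral_cong)
      fix G
      have "\<tau> * (f G - m) = (\<Sum>j<k. \<tau> / real k * (h (G j) - m))"
        using k0 unfolding sum_distrib_left[symmetric] sum_subtractf by (simp add: f_def field_simps)
      then show "ennreal (exp (\<tau> * (f G - m))) = (\<Prod>j<k. ennreal (exp (\<tau> / real k * (h (G j) - m))))"
        by (simp add: prod_ennreal exp_sum)
    qed
    also have "\<dots> = (\<Prod>j<k. \<integral>\<^sup>+x. ennreal (exp (\<tau> / real k * (h x - m))) \<partial>gm n)"
      unfolding cols_def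
      by (rule PS.product_nn_integral_prod)
        (use measurable_h in \<open>auto simp: measurable_cong_sets[OF sets_gm refl] intro!: measurable_compose[OF _ measurable_ennreal]\<close>)
    \<comment> \<open>Each column is used at parameter \<open>\<tau> / real k\<close>; the product
      of \<open>k\<close> such bounds leaves a single factor 1/k in the exponent.\<close>
    also have "\<dots> \<le> (\<Prod>j<k. ennreal (exp ((\<tau> / real k)\<^sup>2 * pi\<^sup>2 * R\<^sup>2 / 8)))"
      by (intro prod_mono_ennreal h_subgaussian)
    also have "\<dots> = ennreal (exp (\<tau>\<^sup>2 * pi\<^sup>2 * R\<^sup>2 / (8 * real k)))"
      using k0 by (simp add: ennreal_power exp_of_nat_mult[symmetric] power_divide power2_eq_square)
    finally show ?thesis .
  qed
  have Xm: "(\<lambda>G. exp (\<tau> * (f G - m))) \<in> borel_measurable (cols n k)" using fGm by measurable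
  have Xi: "integrable (cols n k) (\<lambda>G. exp (\<tau> * (f G - m)))"
    using Xm eX by (intro integrableI_bounded) (auto intro: le_less_trans)
  \<comment> \<open>The added term has integral zero by \<open>fint\<close>; it is inserted to make
    the two integrands comparable pointwise.\<close>
  have "(\<integral>G. \<psi> (gs n G k) \<partial>cols n k)
      = (\<integral>G. \<psi> (gs n G k) + \<tau> * (f G * \<psi> (gs n G k) - c * (\<Phi> (gs n G k) * \<psi> (gs n G k))) \<partial>cols n k)"
    using i1 i2 i3 fint by simp
  also have "\<dots> \<le> (\<integral>G. exp (\<tau> * (f G - m)) \<partial>cols n k)"
  proof (rule integral_mono)
    show "integrable (cols n k) (\<lambda>G. \<psi> (gs n G k) + \<tau> * (f G * \<psi> (gs n G k) - c * (\<Phi> (gs n G k) * \<psi> (gs n G k))))"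
      using i1 i2 i3 by auto
    show "integrable (cols n k) (\<lambda>G. exp (\<tau> * (f G - m)))" by (rule Xi)
    fix G
    define a where "a = \<tau> * (c * \<Phi> (gs n G k) - m)"
    have "exp a * (1 + (\<tau> * (f G - m) - a)) \<le> exp a * exp (\<tau> * (f G - m) - a)"
      by (intro mult_left_mono exp_ge_add_one_self) auto
    also have "\<dots> = exp (\<tau> * (f G - m))" by (simp add: exp_add[symmetric])
    finally show "\<psi> (gs n G k) + \<tau> * (f G * \<psi> (gs n G k) - c * (\<Phi> (gs n G k) * \<psi> (gs n G k))) \<le> exp (\<tau> * (f G - m))"
      by (simp add: \<psi>_def a_def[symmetric]) (simp add: a_def algebra_simps)
  qed
  also have "\<dots> \<le> exp (\<tau>\<^sup>2 * pi\<^sup>2 * R\<^sup>2 / (8 * real k))"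
    using eX nn_integral_eq_integral[OF Xi] by simp
  finally show ?thesis by (simp add: \<psi>_def)
qed

lemma wA_nonneg: "n \<ge> 1 \<Longrightarrow> 0 \<le> wA n A"
  using mwidth_eq_\<Phi>[of "idm n" n A] \<Phi>_bounds(1)[of "idm n"]
  by (simp add: wA_def grass_proj proj_idm)

text \<open>Chernoff's bound for both tails of \<open>c * \<Phi> P - m\<close>, which is
  \<open>c\<close> times the deviation of the mean width because
  \<open>m = c * wA n A\<close>.\<close>

lemma deviation_bound:
  assumes k: "1 \<le> k" "k \<le> n" and t: "t > 0"
  shows "measure (nu n k) {P \<in> grass n k. \<bar>mwidth n P (mv n P ` A) - wA n A\<bar> \<ge> t * wA n A}
    \<le> 2 * exp (- (4 / pi ^ 3) * t\<^sup>2 * real k * kstar n A)"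
proof (cases "R = 0")
  case True
  interpret N: prob_space "nu n k" by (rule nu_eq(4)[OF k])
  \<comment> \<open>Division by zero makes \<open>kstar\<close> zero, so the claimed bound is 2,
    above any probability.\<close>
  have "kstar n A = 0" using True by (simp add: kstar_def)
  then show ?thesis using N.prob_le_1 by (simp add: order_trans[OF N.prob_le_1])
next
  case False
  then have R0: "R > 0" using R_nonneg by simp
  interpret C: prob_space "cols n k" by (rule prob_cols)
  have n1: "n \<ge> 1" using k by simp
  have k0: "real k > 0" using k by simp
  define w where "w = wA n A"
  have w0: "0 \<le> w" using wA_nonneg[OF n1] by (simp add: w_def)
  have cge: "sqrt (2 / pi) * sqrt (real n) \<le> c" by (rule integral_gm_nrm_ge[OF n1])
  have "0 < sqrt (2 / pi) * sqrt (real n)" using n1 by simp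
  then have c0: "c > 0" using cge by linarith
  have c2: "2 / pi * real n \<le> c\<^sup>2"
  proof -
    have "(sqrt (2 / pi) * sqrt (real n))\<^sup>2 \<le> c\<^sup>2" using cge by (intro power_mono) auto
    then show ?thesis by (simp add: power_mult_distrib)
  qed
  have mw: "m = c * w" using m_eq_wA[OF n1] by (simp add: w_def)
  \<comment> \<open>The minimiser of \<open>\<tau>\<^sup>2 * pi\<^sup>2 * R\<^sup>2 / (8 * real k) -
    \<tau> * (c * t * w)\<close>.\<close>
  define \<tau> where "\<tau> = 4 * c * t * w * real k / (pi\<^sup>2 * R\<^sup>2)"
  have \<tau>0: "\<tau> \<ge> 0" using c0 t w0 by (simp add: \<tau>_def)
  let ?\<mu> = "distr (cols n k) (matM n) (\<lambda>G. gs n G k)"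
  let ?S = "{P \<in> grass n k. \<bar>mwidth n P (mv n P ` A) - wA n A\<bar> \<ge> t * wA n A}"
  let ?T = "{P \<in> space (matM n). \<bar>\<Phi> P - w\<bar> \<ge> t * w}"
  \<comment> \<open>One exponential for each tail; since the moment bound is even in
    \<open>\<tau>\<close>, this costs the factor 2.\<close>
  define Z where "Z G = exp (\<tau> * (c * \<Phi> (gs n G k) - m)) + exp (- \<tau> * (c * \<Phi> (gs n G k) - m))" for G
  have \<Phi>m: "(\<lambda>G. \<Phi> (gs n G k)) \<in> borel_measurable (cols n k)"
    by (rule measurable_compose[OF measurable_gs measurable_\<Phi>])
  have ei: "integrable (cols n k) (\<lambda>G. exp (s * (c * \<Phi> (gs n G k) - m)))" for s
  proof (rule C.integrable_const_bound[where B="exp (\<bar>s\<bar> * (c * R + \<bar>m\<bar>))"])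
    show "AE G in cols n k. norm (exp (s * (c * \<Phi> (gs n G k) - m))) \<le> exp (\<bar>s\<bar> * (c * R + \<bar>m\<bar>))"
      using exp_\<Phi>_le by simp
    show "(\<lambda>G. exp (s * (c * \<Phi> (gs n G k) - m))) \<in> borel_measurable (cols n k)" using \<Phi>m by measurable
  qed
  have Zi: "integrable (cols n k) Z" unfolding Z_def using ei[of \<tau>] ei[of "- \<tau>"] by (rule Bochner_Integration.integrable_add)
  have EZ: "(\<integral>G. Z G \<partial>cols n k) \<le> 2 * exp (\<tau>\<^sup>2 * pi\<^sup>2 * R\<^sup>2 / (8 * real k))"
    unfolding Z_def Bochner_Integration.integral_add[OF ei[of \<tau>] ei[of "- \<tau>"]]
    using \<Phi>_subgaussian[OF k, of \<tau>] \<Phi>_subgaussian[OF k, of "- \<tau>"] by simp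
  have "measure (nu n k) ?S \<le> measure ?\<mu> ?T"
  proof -
    have "?S = grass n k \<inter> ?T"
      using mwidth_grass[OF _ k(1)] sets.sets_into_space[OF grass_sets] by (auto simp: w_def)
    moreover have Tm: "?T \<in> sets (matM n)" by measurable
    moreover have "measure (restrict_space ?\<mu> (grass n k)) (grass n k \<inter> ?T) = measure ?\<mu> (grass n k \<inter> ?T)"
      by (intro measure_restrict_space) (use sets.Int[OF grass_sets[of n k] sets.top[of "matM n"]] in auto)
    moreover have "measure ?\<mu> (grass n k \<inter> ?T) \<le> measure ?\<mu> ?T"
      using Tm nu_eq(3)[OF k] by (intro finite_measure.finite_measure_mono prob_space.finite_measure) auto
    ultimately show ?thesis by (simp add: nu_eq(1)[OF k])
  qed
  also have "measure ?\<mu> ?T = measure (cols n k) {G \<in> space (cols n k). t * w \<le> \<bar>\<Phi> (gs n G k) - w\<bar>}"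
  proof -
    have "?T \<in> sets (matM n)" by measurable
    then have "measure ?\<mu> ?T = measure (cols n k) ((\<lambda>G. gs n G k) -` ?T \<inter> space (cols n k))"
      by (intro measure_distr measurable_gs)
    also have "(\<lambda>G. gs n G k) -` ?T \<inter> space (cols n k) = {G \<in> space (cols n k). t * w \<le> \<bar>\<Phi> (gs n G k) - w\<bar>}"
      using gs_mats by auto
    finally show ?thesis .
  qed
  also have "\<dots> \<le> measure (cols n k) {G \<in> space (cols n k). exp (\<tau> * (c * t * w)) \<le> Z G}"
  proof (rule C.finite_measure_mono)
    show "{G \<in> space (cols n k). exp (\<tau> * (c * t * w)) \<le> Z G} \<in> C.events"
      using borel_measurable_integrable[OF Zi] by measurable
    show "{G \<in> space (cols n k). t * w \<le> \<bar>\<Phi> (gs n G k) - w\<bar>} \<subseteq> {G \<in> space (cols n k). exp (\<tau> * (c * t * w)) \<le> Z G}"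
    proof (rule subsetI)
      fix G assume "G \<in> {G \<in> space (cols n k). t * w \<le> \<bar>\<Phi> (gs n G k) - w\<bar>}"
      then have Gs: "G \<in> space (cols n k)" and G: "t * w \<le> \<bar>\<Phi> (gs n G k) - w\<bar>" by auto
      define y where "y = c * \<Phi> (gs n G k) - m"
      have "c * t * w \<le> c * \<bar>\<Phi> (gs n G k) - w\<bar>" using mult_left_mono[OF G, of c] c0 by (simp add: mult.assoc)
      also have "\<dots> = \<bar>y\<bar>" using c0 by (simp add: y_def mw right_diff_distrib[symmetric] abs_mult)
      finally have "\<tau> * (c * t * w) \<le> \<tau> * \<bar>y\<bar>" using \<tau>0 by (rule mult_left_mono)
      moreover have "exp (\<tau> * \<bar>y\<bar>) \<le> exp (\<tau> * y) + exp (- \<tau> * y)"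
        by (cases "y \<ge> 0") (auto simp: abs_if)
      ultimately have "exp (\<tau> * (c * t * w)) \<le> Z G"
        unfolding Z_def y_def[symmetric] using exp_le_cancel_iff order_trans by blast
      then show "G \<in> {G \<in> space (cols n k). exp (\<tau> * (c * t * w)) \<le> Z G}" using Gs by simp
    qed
  qed
  also have "\<dots> \<le> (\<integral>G. Z G \<partial>cols n k) / exp (\<tau> * (c * t * w))"
    by (rule integral_Markov_inequality_measure[OF Zi, of "{}"]) (auto simp: Z_def add_nonneg_nonneg)
  also have "\<dots> \<le> 2 * exp (\<tau>\<^sup>2 * pi\<^sup>2 * R\<^sup>2 / (8 * real k)) / exp (\<tau> * (c * t * w))"
    using EZ by (intro divide_right_mono) auto
  also have "\<dots> = 2 * exp (\<tau>\<^sup>2 * pi\<^sup>2 * R\<^sup>2 / (8 * real k) - \<tau> * (c * t * w))"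
    by (simp add: exp_diff)
  also have "\<tau>\<^sup>2 * pi\<^sup>2 * R\<^sup>2 / (8 * real k) - \<tau> * (c * t * w) = - (2 * (t\<^sup>2 * w\<^sup>2 * real k) / (pi\<^sup>2 * R\<^sup>2)) * c\<^sup>2"
    using R0 k0 pi_gt_zero by (simp add: \<tau>_def power2_eq_square field_simps)
  \<comment> \<open>The bound \<open>2 / pi * real n \<le> c\<^sup>2\<close> supplies the dimension
    that belongs to \<open>kstar\<close> and completes the constant
    \<open>4 / pi ^ 3\<close>.\<close>
  also have "2 * exp \<dots> \<le> 2 * exp (- (2 * (t\<^sup>2 * w\<^sup>2 * real k) / (pi\<^sup>2 * R\<^sup>2)) * (2 / pi * real n))"
  proof -
    have "(2 * (t\<^sup>2 * w\<^sup>2 * real k) / (pi\<^sup>2 * R\<^sup>2)) * (2 / pi * real n) \<le> (2 * (t\<^sup>2 * w\<^sup>2 * real k) / (pi\<^sup>2 * R\<^sup>2)) * c\<^sup>2"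
      by (rule mult_left_mono[OF c2]) simp
    then show ?thesis by simp
  qed
  also have "- (2 * (t\<^sup>2 * w\<^sup>2 * real k) / (pi\<^sup>2 * R\<^sup>2)) * (2 / pi * real n) = - (4 / pi ^ 3) * t\<^sup>2 * real k * kstar n A"
    by (simp add: kstar_def w_def power_divide power2_eq_square power3_eq_cube mult_ac)
  finally show ?thesis .
qed

end

theorem theorem6p8:
  shows "\<exists>c1>0. \<exists>c2>0. \<forall>n k (A :: (nat \<Rightarrow> real) set) (t::real).
    1 \<le> k \<and> k \<le> n - 1 \<and> sym_convex_body n A \<and> t > 0 \<longrightarrow>
    measure (nu n k) {P \<in> grass n k. \<bar>mwidth n P (mv n P ` A) - wA n A\<bar> \<ge> t * wA n A}
      \<le> c1 * exp (- c2 * t\<^sup>2 * real k * kstar n A)"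
proof (rule exI[of _ 2], rule conjI, simp, rule exI[of _ "4 / pi ^ 3"], rule conjI, simp, intro allI impI)
  fix n k :: nat and A :: "(nat \<Rightarrow> real) set" and t :: real
  assume a: "1 \<le> k \<and> k \<le> n - 1 \<and> sym_convex_body n A \<and> t > 0"
  then interpret body n A by unfold_locales blast
  from a have "1 \<le> k" "k \<le> n" "t > 0" by auto
  then show "measure (nu n k) {P \<in> grass n k. \<bar>mwidth n P (mv n P ` A) - wA n A\<bar> \<ge> t * wA n A}
      \<le> 2 * exp (- (4 / pi ^ 3) * t\<^sup>2 * real k * kstar n A)"
    by (rule deviation_bound)
qed

end
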